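(* Let $n\ge1$ be an integer, $-\infty<a<b<\infty$, and let $A$ be the minimal operator generated in $L^2(a,b)$ by $(-1)^n\frac{d^{2n}}{dx^{2n}}$. Let $\Pi=\{\mathbb{C}^{2n},\Gamma_0,\Gamma_1\}$ be the boundary triplet for $A^*$ given, for $f\in\operatorname{dom}A^*=W^{2n,2}(a,b)$, by $$\Gamma_0 f=\big(f(a),\dots,f^{(n-1)}(a),f(b),\dots,f^{(n-1)}(b)\big)^{\top},$$ $$\Gamma_1 f=\big((-1)^{n-1}f^{(2n-1)}(a),\dots,f^{(n)}(a),(-1)^{n}f^{(2n-1)}(b),\dots,-f^{(n)}(b)\big)^{\top},$$ that is, for $k=1,\dots,n$, the $k$-th entry of $\Gamma_1 f$ is $(-1)^{n-k}f^{(2n-k)}(a)$ and the $(n+k)$-th entry is $(-1)^{n-k+1}f^{(2n-k)}(b)$. Let $M(\cdot)$ be the Weyl function corresponding to $\Pi$, and let $M(0)$ be its limit value at zero. Then $$B_K=M(0)=B_K^*,$$ where $$B_K=\begin{pmatrix} QT_2^{-1}T_1S & -QT_2^{-1}S\\ -QT_1T_2^{-1}T_1S & QT_1T_2^{-1}S\end{pmatrix}$$ and $T_1,T_2,Q,S$ are the $n\times n$ matrices with entries, for $j,k\in\{1,\dots,n\}$: $(T_1)_{jk}=\frac{(b-a)^{j-k}}{(j-k)!}$ if $j\ge k$ and $0$ otherwise; $(T_2)_{jk}=\frac{(b-a)^{n+j-k}}{(n+j-k)!}$; $Q=\operatorname{diag}\big((-1)^n,(-1)^{n-1},\dots,-1\big)$;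 and $S_{jk}=1$ if $j+k=n+1$, $S_{jk}=0$ otherwise.
   Context: The minimal operator $A$ is the closure in $L^2(a,b)$ of $f\mapsto(-1)^nf^{(2n)}$ defined on $C_0^\infty(a,b)$. Its adjoint is $A^*f=(-1)^nf^{(2n)}$ with domain $W^{2n,2}(a,b)$. A boundary triplet for $A^*$ is a triple $\{\mathcal{H},\Gamma_0,\Gamma_1\}$ with $\mathcal{H}$ a Hilbert space and $\Gamma_0,\Gamma_1:\operatorname{dom}A^*\to\mathcal{H}$ linear maps such that $(A^*f,g)-(f,A^*g)=(\Gamma_1f,\Gamma_0g)_{\mathcal{H}}-(\Gamma_0f,\Gamma_1g)_{\mathcal{H}}$ for all $f,g\in\operatorname{dom}A^*$ and $f\mapsto(\Gamma_0f,\Gamma_1f)$ is onto $\mathcal{H}\oplus\mathcal{H}$. Let $A_0=A^*\upharpoonright\ker\Gamma_0$ and $\mathfrak{N}_z=\ker(A^*-z)$. The $\gamma$-field and the Weyl function corresponding to the triplet are defined for $z\in\rho(A_0)$ by $$\gamma(z)=\big(\Gamma_0\upharpoonright\mathfrak{N}_z\big)^{-1},\qquad M(z)=\Gamma_1\gamma(z).$$ The limit value at zero is $M(0):=\operatorname{s-R-lim}_{x\uparrow0}M(x)$, the limit in the strong resolvent sense of the self-adjoint matrices $M(x)$ as $x<0$ tends to $0$. *)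

theory Defs
  imports
    "HOL-Analysis.Analysis"
    "Jordan_Normal_Form.Gauss_Jordan_Elimination"
    "Jordan_Normal_Form.Schur_Decomposition"
begin

text \<open>Elements of \<open>L\<^sup>2(a,b)\<close> are represented by functions on the real line; only their values
  almost everywhere on \<open>(a,b)\<close> matter. Inner products are linear in the first argument.\<close>

definition L2 :: "real \<Rightarrow> real \<Rightarrow> (real \<Rightarrow> complex) set" where
  "L2 a b = {f \<in> borel_measurable (lebesgue_on {a<..<b}).
     integrable (lebesgue_on {a<..<b}) (\<lambda>x. (cmod (f x))\<^sup>2)}"

definition L2_inner :: "real \<Rightarrow> real \<Rightarrow> (real \<Rightarrow> complex) \<Rightarrow> (real \<Rightarrow> complex) \<Rightarrow> complex" where
  "L2_inner a b f g = integral\<^sup>L (lebesgue_on {a<..<b}) (\<lambda>x. f x * cnj (g x))"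

definition L2_norm :: "real \<Rightarrow> real \<Rightarrow> (real \<Rightarrow> complex) \<Rightarrow> real" where
  "L2_norm a b f = sqrt (integral\<^sup>L (lebesgue_on {a<..<b}) (\<lambda>x. (cmod (f x))\<^sup>2))"

definition L2_eq :: "real \<Rightarrow> real \<Rightarrow> (real \<Rightarrow> complex) \<Rightarrow> (real \<Rightarrow> complex) \<Rightarrow> bool" where
  "L2_eq a b f g \<longleftrightarrow> (AE x in lebesgue_on {a<..<b}. f x = g x)"

text \<open>Operators in \<open>L\<^sup>2(a,b)\<close> are given by their graphs, as sets of pairs of representatives.\<close>

type_synonym L2_op = "((real \<Rightarrow> complex) \<times> (real \<Rightarrow> complex)) set"

definition L2_closure :: "real \<Rightarrow> real \<Rightarrow> L2_op \<Rightarrow> L2_op" where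
  "L2_closure a b T = {(f, g). f \<in> L2 a b \<and> g \<in> L2 a b \<and>
     (\<exists>u v. (\<forall>k::nat. (u k, v k) \<in> T) \<and>
        (\<lambda>k. L2_norm a b (\<lambda>x. u k x - f x)) \<longlonglongrightarrow> 0 \<and>
        (\<lambda>k. L2_norm a b (\<lambda>x. v k x - g x)) \<longlonglongrightarrow> 0)}"

definition L2_adjoint :: "real \<Rightarrow> real \<Rightarrow> L2_op \<Rightarrow> L2_op" where
  "L2_adjoint a b T = {(f, g). f \<in> L2 a b \<and> g \<in> L2 a b \<and>
     (\<forall>(u, v) \<in> T. L2_inner a b v f = L2_inner a b u g)}"

definition resolvent_set :: "real \<Rightarrow> real \<Rightarrow> L2_op \<Rightarrow> complex set" where
  "resolvent_set a b T = {z.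
     (\<forall>h \<in> L2 a b. \<exists>(f, g) \<in> T. L2_eq a b (\<lambda>x. g x - z * f x) h) \<and>
     (\<exists>C. \<forall>(f, g) \<in> T. L2_norm a b f \<le> C * L2_norm a b (\<lambda>x. g x - z * f x))}"

definition vderiv :: "(real \<Rightarrow> complex) \<Rightarrow> real \<Rightarrow> complex" where
  "vderiv f = (\<lambda>x. vector_derivative f (at x))"

definition test_function :: "real \<Rightarrow> real \<Rightarrow> (real \<Rightarrow> complex) \<Rightarrow> bool" where
  "test_function a b f \<longleftrightarrow>
     (\<forall>k x. (vderiv ^^ k) f differentiable (at x)) \<and>
     (\<exists>c d. a < c \<and> d < b \<and> (\<forall>x. x \<notin> {c..d} \<longrightarrow> f x = 0))"

definition minimal_operator :: "real \<Rightarrow> real \<Rightarrow> nat \<Rightarrow> L2_op" where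
  "minimal_operator a b n = L2_closure a b
     {(f, (\<lambda>x. (-1) ^ n * (vderiv ^^ (2 * n)) f x)) | f. test_function a b f}"

text \<open>\<open>d 0, \<dots>, d m\<close> are the derivatives of \<open>f\<close>, where for \<open>j < m\<close> the function \<open>d j\<close> is
  absolutely continuous on \<open>[a,b]\<close> with derivative \<open>d (j+1)\<close> almost everywhere, and \<open>d 0\<close> is
  the continuous representative of \<open>f\<close>.\<close>

definition sobolev_jet ::
  "real \<Rightarrow> real \<Rightarrow> nat \<Rightarrow> (real \<Rightarrow> complex) \<Rightarrow> (nat \<Rightarrow> real \<Rightarrow> complex) \<Rightarrow> bool" where
  "sobolev_jet a b m f d \<longleftrightarrow> f \<in> L2 a b \<and> d m \<in> L2 a b \<and> L2_eq a b f (d 0) \<and>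
     (\<forall>j<m. \<forall>x\<in>{a..b}. (d (Suc j) has_integral (d j x - d j a)) {a..x})"

definition sobolev_space :: "real \<Rightarrow> real \<Rightarrow> nat \<Rightarrow> (real \<Rightarrow> complex) set" where
  "sobolev_space a b m = {f. \<exists>d. sobolev_jet a b m f d}"

text \<open>For \<open>f\<close> in \<open>sobolev_space a b m\<close> this is determined on \<open>[a,b]\<close> if \<open>j < m\<close>, and almost
  everywhere on \<open>(a,b)\<close> if \<open>j = m\<close>.\<close>

definition sobolev_deriv ::
  "real \<Rightarrow> real \<Rightarrow> nat \<Rightarrow> (real \<Rightarrow> complex) \<Rightarrow> nat \<Rightarrow> real \<Rightarrow> complex" where
  "sobolev_deriv a b m f = (SOME d. sobolev_jet a b m f d)"

definition Gamma0 :: "real \<Rightarrow> real \<Rightarrow> nat \<Rightarrow> (real \<Rightarrow> complex) \<Rightarrow> complex vec" where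
  "Gamma0 a b n f = Matrix.vec (2 * n) (\<lambda>i.
     if i < n then sobolev_deriv a b (2 * n) f i a
     else sobolev_deriv a b (2 * n) f (i - n) b)"

text \<open>Indices of JNF vectors and matrices start at 0, hence the shifts \<open>i + 1\<close>.\<close>

definition Gamma1 :: "real \<Rightarrow> real \<Rightarrow> nat \<Rightarrow> (real \<Rightarrow> complex) \<Rightarrow> complex vec" where
  "Gamma1 a b n f = Matrix.vec (2 * n) (\<lambda>i.
     if i < n then let k = i + 1 in
       (-1) ^ (n - k) * sobolev_deriv a b (2 * n) f (2 * n - k) a
     else let k = i - n + 1 in
       (-1) ^ (n - k + 1) * sobolev_deriv a b (2 * n) f (2 * n - k) b)"

text \<open>\<open>T\<close> is the graph of \<open>A\<^sup>*\<close>. The first two clauses say that the boundary maps are well defined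
  on the elements of \<open>L\<^sup>2(a,b)\<close> (not only on representatives) and take values in \<open>\<complex>\<^sup>m\<close>.\<close>

definition boundary_triplet ::
  "real \<Rightarrow> real \<Rightarrow> L2_op \<Rightarrow> nat \<Rightarrow> ((real \<Rightarrow> complex) \<Rightarrow> complex vec) \<Rightarrow>
     ((real \<Rightarrow> complex) \<Rightarrow> complex vec) \<Rightarrow> bool" where
  "boundary_triplet a b T m \<Gamma>\<^sub>0 \<Gamma>\<^sub>1 \<longleftrightarrow>
     (\<forall>\<Gamma>\<in>{\<Gamma>\<^sub>0, \<Gamma>\<^sub>1}.
        (\<forall>f\<in>Domain T. \<Gamma> f \<in> carrier_vec m) \<and>
        (\<forall>f\<in>Domain T. \<forall>g\<in>Domain T. L2_eq a b f g \<longrightarrow> \<Gamma> f = \<Gamma> g) \<and>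
        (\<forall>f\<in>Domain T. \<forall>g\<in>Domain T. \<Gamma> (\<lambda>x. f x + g x) = \<Gamma> f + \<Gamma> g) \<and>
        (\<forall>f\<in>Domain T. \<forall>c. \<Gamma> (\<lambda>x. c * f x) = c \<cdot>\<^sub>v \<Gamma> f)) \<and>
     (\<forall>(f, f')\<in>T. \<forall>(g, g')\<in>T.
        L2_inner a b f' g - L2_inner a b f g' = \<Gamma>\<^sub>1 f \<bullet>c \<Gamma>\<^sub>0 g - \<Gamma>\<^sub>0 f \<bullet>c \<Gamma>\<^sub>1 g) \<and>
     (\<forall>h\<^sub>0\<in>carrier_vec m. \<forall>h\<^sub>1\<in>carrier_vec m. \<exists>f\<in>Domain T. \<Gamma>\<^sub>0 f = h\<^sub>0 \<and> \<Gamma>\<^sub>1 f = h\<^sub>1)"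

definition ker_extension :: "L2_op \<Rightarrow> nat \<Rightarrow> ((real \<Rightarrow> complex) \<Rightarrow> complex vec) \<Rightarrow> L2_op" where
  "ker_extension T m \<Gamma>\<^sub>0 = {(f, g) \<in> T. \<Gamma>\<^sub>0 f = 0\<^sub>v m}"

definition defect_space :: "L2_op \<Rightarrow> complex \<Rightarrow> (real \<Rightarrow> complex) set" where
  "defect_space T z = {f. (f, (\<lambda>x. z * f x)) \<in> T}"

text \<open>The \<open>\<gamma>\<close>-field and the Weyl function are given by their graphs, as the inverse relation of
  \<open>\<Gamma>\<^sub>0\<close> restricted to the defect space, and its composition with \<open>\<Gamma>\<^sub>1\<close>. They are meant for \<open>z\<close> in
  the resolvent set of \<open>ker_extension T m \<Gamma>\<^sub>0\<close>, where they are graphs of operators on \<open>\<complex>\<^sup>m\<close>.\<close>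

definition gamma_field ::
  "L2_op \<Rightarrow> ((real \<Rightarrow> complex) \<Rightarrow> complex vec) \<Rightarrow> complex \<Rightarrow> (complex vec \<times> (real \<Rightarrow> complex)) set" where
  "gamma_field T \<Gamma>\<^sub>0 z = {(f, \<Gamma>\<^sub>0 f) | f. f \<in> defect_space T z}\<inverse>"

definition weyl_function ::
  "L2_op \<Rightarrow> ((real \<Rightarrow> complex) \<Rightarrow> complex vec) \<Rightarrow> ((real \<Rightarrow> complex) \<Rightarrow> complex vec) \<Rightarrow>
     complex \<Rightarrow> (complex vec \<times> complex vec) set" where
  "weyl_function T \<Gamma>\<^sub>0 \<Gamma>\<^sub>1 z = {(h, \<Gamma>\<^sub>1 f) | h f. (h, f) \<in> gamma_field T \<Gamma>\<^sub>0 z}"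

definition rel_adjoint :: "nat \<Rightarrow> (complex vec \<times> complex vec) set \<Rightarrow> (complex vec \<times> complex vec) set" where
  "rel_adjoint m R = {(h, k). h \<in> carrier_vec m \<and> k \<in> carrier_vec m \<and>
     (\<forall>(f, g) \<in> R. g \<bullet>c h = f \<bullet>c k)}"

definition self_adjoint_rel :: "nat \<Rightarrow> (complex vec \<times> complex vec) set \<Rightarrow> bool" where
  "self_adjoint_rel m R \<longleftrightarrow> rel_adjoint m R = R"

text \<open>\<open>(R - \<zeta>)\<inverse> h\<close>; for a self-adjoint relation and non-real \<open>\<zeta>\<close> this is an everywhere defined
  operator.\<close>

definition rel_resolvent :: "(complex vec \<times> complex vec) set \<Rightarrow> complex \<Rightarrow> complex vec \<Rightarrow> complex vec" where
  "rel_resolvent R \<zeta> h = (THE f. \<exists>g. (f, g) \<in> R \<and> g - \<zeta> \<cdot>\<^sub>v f = h)"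

text \<open>The limit may in general be a self-adjoint relation. Convergence in \<open>\<complex>\<^sup>m\<close> is expressed
  componentwise, since the type of JNF vectors carries no topology.\<close>

definition has_strong_resolvent_limit ::
  "nat \<Rightarrow> (real \<Rightarrow> (complex vec \<times> complex vec) set) \<Rightarrow> (complex vec \<times> complex vec) set \<Rightarrow>
     real filter \<Rightarrow> bool" where
  "has_strong_resolvent_limit m R R\<^sub>0 F \<longleftrightarrow>
     (\<forall>\<^sub>F x in F. self_adjoint_rel m (R x)) \<and> self_adjoint_rel m R\<^sub>0 \<and>
     (\<forall>\<zeta>. Im \<zeta> \<noteq> 0 \<longrightarrow> (\<forall>h\<in>carrier_vec m. \<forall>i<m.
        ((\<lambda>x. vec_index (rel_resolvent (R x) \<zeta> h) i)
           \<longlongrightarrow> vec_index (rel_resolvent R\<^sub>0 \<zeta> h) i) F))"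

definition weyl_limit_zero ::
  "nat \<Rightarrow> (complex \<Rightarrow> (complex vec \<times> complex vec) set) \<Rightarrow> (complex vec \<times> complex vec) set" where
  "weyl_limit_zero m M =
     (THE R\<^sub>0. has_strong_resolvent_limit m (\<lambda>x. M (complex_of_real x)) R\<^sub>0 (at_left 0))"

definition mat_graph :: "nat \<Rightarrow> complex mat \<Rightarrow> (complex vec \<times> complex vec) set" where
  "mat_graph m B = {(h, B *\<^sub>v h) | h. h \<in> carrier_vec m}"

definition T1_mat :: "real \<Rightarrow> real \<Rightarrow> nat \<Rightarrow> complex mat" where
  "T1_mat a b n = Matrix.mat n n (\<lambda>(j, k).
     if j \<ge> k then complex_of_real ((b - a) ^ (j - k) / fact (j - k)) else 0)"

definition T2_mat :: "real \<Rightarrow> real \<Rightarrow> nat \<Rightarrow> complex mat" where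
  "T2_mat a b n = Matrix.mat n n (\<lambda>(j, k).
     complex_of_real ((b - a) ^ (n + j - k) / fact (n + j - k)))"

definition Q_mat :: "nat \<Rightarrow> complex mat" where
  "Q_mat n = Matrix.mat n n (\<lambda>(j, k). if j = k then (-1) ^ (n - j) else 0)"

definition S_mat :: "nat \<Rightarrow> complex mat" where
  "S_mat n = Matrix.mat n n (\<lambda>(j, k). if (j + 1) + (k + 1) = n + 1 then 1 else 0)"

definition B_K :: "real \<Rightarrow> real \<Rightarrow> nat \<Rightarrow> complex mat" where
  "B_K a b n = (let T1 = T1_mat a b n; T2inv = the (mat_inverse (T2_mat a b n));
       Q = Q_mat n; S = S_mat n in
     four_block_mat
       (Q * T2inv * T1 * S)         (- (Q * T2inv * S))
       (- (Q * T1 * T2inv * T1 * S)) (Q * T1 * T2inv * S))"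

end

theory Submission
  imports Defs
begin

text \<open>
The operator \<open>A\<^sup>*\<close> acts as \<open>(-1)\<^sup>n f\<^sup>(\<^sup>2\<^sup>n\<^sup>)\<close> on \<open>W\<^sup>2\<^sup>n\<^sup>,\<^sup>2(a,b)\<close>, and its restriction \<open>A\<^sub>0\<close> to the
kernel of \<open>\<Gamma>\<^sub>0\<close> is the Dirichlet operator. Integrating by parts \<open>n\<close> times gives
\<open>(A\<^sub>0 u, u) = \<parallel>u\<^sup>(\<^sup>n\<^sup>)\<parallel>\<^sup>2 \<ge> 0\<close>; integrating by parts \<open>2n\<close> times gives the Green identity of the
triplet.

Fix a boundary vector \<open>h\<close>. For \<open>x < 0\<close> let \<open>f\<^sub>x\<close> solve \<open>A\<^sup>*f\<^sub>x = x f\<^sub>x\<close>, \<open>\<Gamma>\<^sub>0 f\<^sub>x = h\<close>, so that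
\<open>M(x) h = \<Gamma>\<^sub>1 f\<^sub>x\<close>, and let \<open>f\<^sub>0\<close> be the polynomial of degree less than \<open>2n\<close> with \<open>\<Gamma>\<^sub>0 f\<^sub>0 = h\<close>. The
difference \<open>u = f\<^sub>x - f\<^sub>0\<close> satisfies \<open>\<Gamma>\<^sub>0 u = 0\<close> and \<open>(A\<^sub>0 - x) u = x f\<^sub>0\<close>. Since \<open>A\<^sub>0 \<ge> 0\<close>, this forces
\<open>\<parallel>u\<parallel> \<le> \<parallel>f\<^sub>0\<parallel>\<close>. Testing the Green identity with the polynomial \<open>g\<^sub>i\<close> whose boundary vector \<open>\<Gamma>\<^sub>0 g\<^sub>i\<close>
is the \<open>i\<close>-th unit vector, the \<open>i\<close>-th entry of \<open>\<Gamma>\<^sub>1 u\<close> is \<open>x (f\<^sub>x, g\<^sub>i)\<close>, of modulus at most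
\<open>2 \<bar>x\<bar> \<parallel>f\<^sub>0\<parallel> \<parallel>g\<^sub>i\<parallel>\<close>. Hence \<open>M(x) h \<rightarrow> \<Gamma>\<^sub>1 f\<^sub>0\<close> as \<open>x\<close> increases to \<open>0\<close>
(\<open>weyl_function_tendsto_0\<close>). The Taylor expansion of \<open>f\<^sub>0\<close> at \<open>a\<close>, evaluated at \<open>b\<close>, is a linear
system with the coefficient matrices \<open>T\<^sub>1\<close> and \<open>T\<^sub>2\<close> for the missing derivatives; solving it gives
\<open>\<Gamma>\<^sub>1 f\<^sub>0 = B\<^sub>K h\<close> (\<open>graph_B_K_subset_weyl_function\<close>). By the Green identity all \<open>M(x)\<close> and \<open>B\<^sub>K\<close> are
Hermitian, and for Hermitian matrices convergence of the entries implies convergence of the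
resolvents, whose limit determines the limit relation (\<open>has_strong_resolvent_limitI\<close>,
\<open>strong_resolvent_limit_unique\<close>).

Two existence results carry this argument. The first is that the adjoint of the minimal operator is
no larger than the operator on \<open>W\<^sup>2\<^sup>n\<^sup>,\<^sup>2(a,b)\<close>: this is the lemma of du Bois-Reymond for higher
derivatives (\<open>weak_derivative_imp_jet\<close>), which in turn needs a supply of test functions. The second
is the solvability of \<open>(-1)\<^sup>n f\<^sup>(\<^sup>2\<^sup>n\<^sup>) = x f + h\<close> with prescribed Dirichlet data for \<open>x \<le> 0\<close>
(\<open>dirichlet_problem_solvable\<close>): the initial value problem is a Volterra equation, and matching the
data at \<open>b\<close> is an \<open>n \<times> n\<close> linear system that is injective because \<open>A\<^sub>0 - x\<close> is. It yields the
resolvent of \<open>A\<^sub>0\<close> and the solutions \<open>f\<^sub>x\<close> and \<open>g\<^sub>i\<close>. For twice the order it also yields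
surjectivity of \<open>(\<Gamma>\<^sub>0, \<Gamma>\<^sub>1)\<close>.
\<close>

section \<open>Primitives of integrable functions\<close>

lemma AE_lebesgue_on_if_negligible:
  assumes "negligible N" "\<And>x. x \<in> S \<Longrightarrow> x \<notin> N \<Longrightarrow> P x"  "S \<in> sets lebesgue"
  shows "AE x in lebesgue_on S. P x"
proof -
  have "AE x in lebesgue. x \<notin> N"
    using assms(1) by (simp add: negligible_iff_null_sets AE_not_in)
  then have "AE x in lebesgue. x \<in> S \<longrightarrow> P x"
    by eventually_elim (use assms in auto)
  then show ?thesis
    using assms(3) by (simp add: AE_restrict_space_iff)
qed

lemma negligible_if_AE_on_interval:
  fixes a b :: real
  assumes "AE x in lebesgue_on {a<..<b}. P x"
  obtains N where "negligible N" "\<And>x. x \<in> {a..b} \<Longrightarrow> x \<notin> N \<Longrightarrow> P x"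
proof -
  have "AE x in lebesgue. x \<in> {a<..<b} \<longrightarrow> P x"
    by (rule AE_restrict_space_iff[THEN iffD1, OF _ assms]) auto
  then obtain N where N: "N \<in> null_sets lebesgue" "{x. \<not> (x \<in> {a<..<b} \<longrightarrow> P x)} \<subseteq> N"
    by (auto elim: AE_E3 simp: eventually_ae_filter)
  then have "negligible (insert a (insert b N))"
    by (simp add: negligible_iff_null_sets[symmetric])
  moreover have "P x" if "x \<in> {a..b}" "x \<notin> insert a (insert b N)" for x
  proof -
    have "x \<in> {a<..<b}" "x \<notin> N" using that by auto
    then show ?thesis using N(2) by blast
  qed
  ultimately show ?thesis by (rule that)
qed

text \<open>By Lebesgue's differentiation theorem, \<open>f x\<close> is for almost every \<open>x\<close> the limit of the means of
  \<open>f\<close> over \<open>[x, x + h]\<close>, and all these means vanish.\<close>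

lemma AE_zero_if_interval_integrals_zero:
  fixes f :: "real \<Rightarrow> complex"
  assumes "f absolutely_integrable_on {a..b}"
    and zero: "\<And>c d. a < c \<Longrightarrow> c < d \<Longrightarrow> d < b \<Longrightarrow> integral {c..d} f = 0"
  shows "AE x in lebesgue_on {a<..<b}. f x = 0"
proof -
  \<comment> \<open>The differentiation theorem is about functions that are integrable on every interval.\<close>
  let ?g = "\<lambda>x. if x \<in> {a..b} then f x else 0"
  have "?g integrable_on UNIV"
    using assms(1) set_lebesgue_integral_eq_integral(1) integrable_restrict_UNIV by blast
  then have "?g integrable_on cbox u v" for u v :: real
    using integrable_on_subcbox by blast
  then obtain N where N: "negligible N"
    "\<And>x e. \<lbrakk>x \<notin> N; 0 < e\<rbrakk> \<Longrightarrow> \<exists>d>0. \<forall>h. 0 < h \<and> h < d \<longrightarrow>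
        norm (integral (cbox x (x + h *\<^sub>R One)) ?g /\<^sub>R h ^ DIM(real) - ?g x) < e"
    using integrable_ccontinuous_explicit[of ?g] by blast
  have "f x = 0" if x: "x \<in> {a<..<b}" "x \<notin> N" for x
  proof (rule ccontr)
    assume "f x \<noteq> 0"
    then obtain d where d: "d > 0" "\<And>h. 0 < h \<Longrightarrow> h < d \<Longrightarrow>
       norm (integral (cbox x (x + h *\<^sub>R One)) ?g /\<^sub>R h ^ DIM(real) - ?g x) < norm (f x)"
      using N(2)[OF x(2), of "norm (f x)"] by auto
    define h where "h = min d (b - x) / 2"
    have h: "0 < h" "h < d" "x + h < b" using d x by (auto simp: h_def min_def field_simps)
    have "integral (cbox x (x + h *\<^sub>R One)) ?g = integral {x..x+h} f"
      by (rule Henstock_Kurzweil_Integration.integral_cong[THEN trans]) (use h x in auto)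
    also have "\<dots> = 0" using h x by (intro zero) auto
    finally show False using d(2)[OF h(1,2)] x by auto
  qed
  then show ?thesis
    by (intro AE_lebesgue_on_if_negligible[OF N(1)]) auto
qed

lemma continuous_eq_if_AE_eq:
  fixes f g :: "real \<Rightarrow> complex"
  assumes "continuous_on {a..b} f" "continuous_on {a..b} g" "AE x in lebesgue_on {a<..<b}. f x = g x"
    and "a < b" "x \<in> {a..b}"
  shows "f x = g x"
proof -
  obtain N where N: "negligible N" "\<And>x. x \<in> {a..b} \<Longrightarrow> x \<notin> N \<Longrightarrow> f x = g x"
    using negligible_if_AE_on_interval[OF assms(3)] by blast
  have "((\<lambda>x. norm (f x - g x)) has_integral 0) {a..b}"
    by (rule has_integral_spike[OF N(1) _ has_integral_0]) (use N in auto)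
  then have "norm (f x - g x) = 0"
    using assms by (intro has_integral_0_cbox_imp_0[of a b "\<lambda>x. norm (f x - g x)"])
      (auto intro!: continuous_intros simp: box_real)
  then show ?thesis by simp
qed

lemma continuous_on_if_has_integral:
  fixes F F' :: "real \<Rightarrow> complex"
  assumes "\<And>x. x \<in> {a..b} \<Longrightarrow> (F' has_integral (F x - F a)) {a..x}"
  shows "continuous_on {a..b} F"
proof (cases "a \<le> b")
  case True
  then have "continuous_on {a..b} (\<lambda>x. F a + integral {a..x} F')"
    using assms[of b] by (intro continuous_intros indefinite_integral_continuous_1) (auto simp: has_integral_integrable)
  moreover have "F a + integral {a..x} F' = F x" if "x \<in> {a..b}" for x
    using integral_unique[OF assms[OF that]] by simp
  ultimately show ?thesis by (subst continuous_on_cong[OF refl, symmetric]) auto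
qed auto

lemma absolutely_integrable_mult_continuous:
  fixes f g :: "real \<Rightarrow> complex"
  assumes "f absolutely_integrable_on {a..b}" "continuous_on {a..b} g"
  shows "(\<lambda>x. f x * g x) absolutely_integrable_on {a..b}" "(\<lambda>x. g x * f x) absolutely_integrable_on {a..b}"
proof -
  have "bounded (g ` {a..b})"
    using assms(2) compact_continuous_image compact_imp_bounded by blast
  moreover have "g \<in> borel_measurable (lebesgue_on {a..b})"
    using assms(2) by (intro continuous_imp_measurable_on_sets_lebesgue) auto
  ultimately show 1: "(\<lambda>x. g x * f x) absolutely_integrable_on {a..b}"
    using absolutely_integrable_bounded_measurable_product[of "(*)" g "{a..b}" f] assms(1)
      bounded_bilinear_mult bilinear_conv_bounded_bilinear by auto
  then show "(\<lambda>x. f x * g x) absolutely_integrable_on {a..b}"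
    by (simp add: mult.commute)
qed

lemma has_integral_le_norm:
  fixes f :: "real \<Rightarrow> complex"
  assumes "(f has_integral I) {s..t}" "(g has_integral J) {s..t}"
    "\<And>x. x \<in> {s..t} \<Longrightarrow> norm (f x) \<le> g x"
  shows "norm I \<le> J"
  using integral_norm_bound_integral[of f "{s..t}" g] assms by (auto simp: has_integral_iff)

lemma integral_linear_combination:
  fixes f g :: "real \<Rightarrow> complex"
  assumes "f integrable_on S" "g integrable_on S"
  shows "integral S (\<lambda>x. f x + c * g x) = integral S f + c * integral S g"
  using assms by (subst Henstock_Kurzweil_Integration.integral_add) (auto intro: integrable_on_mult_right)

text \<open>This says that \<open>F\<close> is absolutely continuous on \<open>[a,b]\<close> with derivative \<open>F'\<close> almost everywhere. The
  integral form is the one in which Sobolev derivatives are given, and it is stable under linear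
  operations without any appeal to differentiability.\<close>

definition primitive_on :: "real \<Rightarrow> real \<Rightarrow> (real \<Rightarrow> complex) \<Rightarrow> (real \<Rightarrow> complex) \<Rightarrow> bool" where
  "primitive_on a b F F' \<longleftrightarrow> F' absolutely_integrable_on {a..b} \<and>
     (\<forall>x\<in>{a..b}. (F' has_integral (F x - F a)) {a..x})"

lemma primitive_on_has_integral:
  assumes "primitive_on a b F F'" "a \<le> s" "s \<le> t" "t \<le> b"
  shows "(F' has_integral (F t - F s)) {s..t}"
proof -
  have i: "F' integrable_on {a..b}" using assms(1) set_lebesgue_integral_eq_integral(1)
    by (auto simp: primitive_on_def)
  have "F' integrable_on {a..t}" "F' integrable_on {s..t}"
    using i assms by (auto intro: integrable_subinterval_real)
  moreover have "integral {a..s} F' = F s - F a" "integral {a..t} F' = F t - F a"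
    using assms by (auto simp: primitive_on_def intro!: integral_unique)
  ultimately show ?thesis
    using Henstock_Kurzweil_Integration.integral_combine[of a s t F'] assms
    by (metis add_diff_cancel_left' diff_add_cancel diff_diff_eq2 has_integral_integral)
qed

lemma primitive_on_continuous:
  assumes "primitive_on a b F F'"
  shows "continuous_on {a..b} F"
  using assms by (auto simp: primitive_on_def intro: continuous_on_if_has_integral[of a b F'])

lemma primitive_on_norm_diff_le:
  assumes "primitive_on a b F F'" "a \<le> s" "s \<le> t" "t \<le> b"
  shows "norm (F t - F s) \<le> integral {s..t} (\<lambda>x. norm (F' x))"
proof -
  have "F' absolutely_integrable_on {s..t}"
    using assms by (auto simp: primitive_on_def intro: absolutely_integrable_on_subinterval)
  then have "norm (integral {s..t} F') \<le> integral {s..t} (\<lambda>x. norm (F' x))"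
    by (intro integral_norm_bound_integral) (auto simp: absolutely_integrable_on_def)
  then show ?thesis
    using primitive_on_has_integral[OF assms] by (simp add: integral_unique)
qed

lemma primitive_on_cong:
  assumes "primitive_on a b F F'" "\<And>x. x \<in> {a..b} \<Longrightarrow> F x - F a = G x - G a"
  shows "primitive_on a b G F'"
  using assms by (simp add: primitive_on_def)

lemma primitive_on_integral:
  assumes "f absolutely_integrable_on {a..b}"
  shows "primitive_on a b (\<lambda>x. c + integral {a..x} f) f"
proof -
  have "f integrable_on {a..x}" if "x \<in> {a..b}" for x
    using integrable_subinterval_real[OF set_lebesgue_integral_eq_integral(1)[OF assms], of a x] that by auto
  then show ?thesis using assms by (auto simp: primitive_on_def has_integral_integral)
qed

lemma primitive_on_C1:
  assumes "\<And>x. (f has_vector_derivative f' x) (at x)" "continuous_on {a..b} f'"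
  shows "primitive_on a b f f'"
  unfolding primitive_on_def
proof (intro conjI ballI)
  show "f' absolutely_integrable_on {a..b}" by (intro absolutely_integrable_continuous_real assms)
  show "(f' has_integral f x - f a) {a..x}" if "x \<in> {a..b}" for x
    using that assms(1) by (intro fundamental_theorem_of_calculus) (auto intro: has_vector_derivative_at_within)
qed

lemma primitive_on_linear_combination:
  assumes "primitive_on a b F F'" "primitive_on a b G G'"
  shows "primitive_on a b (\<lambda>x. F x + c * G x) (\<lambda>x. F' x + c * G' x)"
  unfolding primitive_on_def
proof (intro conjI ballI)
  show "(\<lambda>x. F' x + c * G' x) absolutely_integrable_on {a..b}"
    using assms by (intro set_integral_add set_integrable_mult_right) (auto simp: primitive_on_def)
  fix x assume "x \<in> {a..b}"
  then have "((\<lambda>x. F' x + c * G' x) has_integral (F x - F a) + c * (G x - G a)) {a..x}"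
    using assms by (intro has_integral_add has_integral_mult_right) (auto simp: primitive_on_def)
  then show "((\<lambda>x. F' x + c * G' x) has_integral F x + c * G x - (F a + c * G a)) {a..x}"
    by (simp add: algebra_simps)
qed

lemma primitive_on_cnj:
  assumes "primitive_on a b F F'"
  shows "primitive_on a b (\<lambda>x. cnj (F x)) (\<lambda>x. cnj (F' x))"
  unfolding primitive_on_def
proof (intro conjI ballI)
  show "(\<lambda>x. cnj (F' x)) absolutely_integrable_on {a..b}"
    using assms absolutely_integrable_linear[OF _ bounded_linear_cnj, of "{a..b}" F']
    by (simp add: primitive_on_def o_def)
  fix x assume "x \<in> {a..b}"
  then show "((\<lambda>x. cnj (F' x)) has_integral cnj (F x) - cnj (F a)) {a..x}"
    using assms has_integral_linear[OF _ bounded_linear_cnj, of F' "F x - F a" "{a..x}"]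
    by (simp add: primitive_on_def o_def)
qed

lemma primitive_on_0: "primitive_on a b (\<lambda>x. 0) (\<lambda>x. 0)"
  by (simp add: primitive_on_def)

text \<open>The difference of the two derivatives has integral zero over every interval.\<close>

lemma primitive_on_unique:
  assumes F: "primitive_on a b F F'" and G: "primitive_on a b G G'"
    and eq: "\<And>x. x \<in> {a..b} \<Longrightarrow> F x = G x"
  shows "AE x in lebesgue_on {a<..<b}. F' x = G' x"
proof -
  have "AE x in lebesgue_on {a<..<b}. F' x + (- 1) * G' x = 0"
  proof (rule AE_zero_if_interval_integrals_zero)
    note P = primitive_on_linear_combination[OF F G, of "- 1"]
    then show "(\<lambda>x. F' x + (- 1) * G' x) absolutely_integrable_on {a..b}" by (simp only: primitive_on_def)
    fix c d assume cd: "a < c" "c < d" "d < b"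
    have "((\<lambda>x. F' x + (- 1) * G' x) has_integral (F d + (- 1) * G d - (F c + (- 1) * G c))) {c..d}"
      using cd by (intro primitive_on_has_integral[OF P]) auto
    then show "integral {c..d} (\<lambda>x. F' x + (- 1) * G' x) = 0"
      using cd eq by (simp add: integral_unique)
  qed
  then show ?thesis by simp
qed

text \<open>\<open>F\<close> is differentiable only almost everywhere, so the fundamental theorem of calculus does not apply
  to \<open>F G\<close>. Instead let \<open>H t\<close> be the difference of the two sides on \<open>[a,t]\<close>, let \<open>V\<close> be the variation
  of \<open>F\<close> and let \<open>K\<close> bound \<open>G'\<close>. Then \<open>\<bar>H t - H s\<bar> \<le> 3 K \<bar>t - s\<bar> \<bar>V t - V s\<bar>\<close>, which is
  \<open>o(t - s)\<close> because \<open>V\<close> is continuous. So \<open>H\<close> has derivative zero at every point and is constant.\<close>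

lemma integration_by_parts_Lipschitz:
  fixes F G :: "real \<Rightarrow> complex"
  assumes F: "primitive_on a b F F'" and G: "primitive_on a b G G'"
    and G': "continuous_on {a..b} G'" and ab: "a \<le> b"
  shows "((\<lambda>x. F' x * G x + F x * G' x) has_integral (F b * G b - F a * G a)) {a..b}"
proof -
  obtain K where K: "\<And>x. x \<in> {a..b} \<Longrightarrow> norm (G' x) \<le> K" "K > 0"
    using compact_imp_bounded[OF compact_continuous_image[OF G' compact_Icc]]
    unfolding bounded_pos by (metis imageI)
  let ?k = "\<lambda>x. F' x * G x + F x * G' x"
  note cont = primitive_on_continuous[OF F] primitive_on_continuous[OF G]
  have Fi: "F' absolutely_integrable_on {a..b}" using F by (simp add: primitive_on_def)
  have ka: "?k absolutely_integrable_on {a..b}"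
    by (intro set_integral_add absolutely_integrable_mult_continuous Fi cont
        absolutely_integrable_continuous_real continuous_intros G')
  have ki: "?k integrable_on {s..t}" if "a \<le> s" "t \<le> b" for s t
    using integrable_subinterval_real[OF set_lebesgue_integral_eq_integral(1)[OF ka]] that by auto
  have Fii: "F' integrable_on {s..t}" "(\<lambda>x. norm (F' x)) integrable_on {s..t}" if "a \<le> s" "t \<le> b" for s t
    using Fi that by (auto simp: absolutely_integrable_on_def intro: integrable_subinterval_real[of _ a b])
  define V where "V t = integral {a..t} (\<lambda>x. norm (F' x))" for t
  define H where "H t = integral {a..t} ?k - F t * G t" for t
  have V: "integral {s..t} (\<lambda>x. norm (F' x)) = V t - V s" if "a \<le> s" "s \<le> t" "t \<le> b" for s t
    using Henstock_Kurzweil_Integration.integral_combine[of a s t "\<lambda>x. norm (F' x)"] that Fii(2)[of a t]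
    by (simp add: V_def algebra_simps)
  have Gd: "norm (G t - G s) \<le> K * (t - s)" if "a \<le> s" "s \<le> t" "t \<le> b" for s t
    using has_integral_bound_real[OF _ finite.emptyI primitive_on_has_integral[OF G that], of K] K that
    by auto
  have Hd: "norm (H t - H s) \<le> 3 * K * (t - s) * (V t - V s)" if st: "a \<le> s" "s \<le> t" "t \<le> b" for s t
  proof -
    have Fd: "norm (F x - F s) \<le> V t - V s" if "x \<in> {s..t}" for x
    proof -
      have "norm (F x - F s) \<le> V x - V s"
        using primitive_on_norm_diff_le[OF F, of s x] V[of s x] st that by auto
      also have "V x \<le> V t" using V[of x t] st that Fii(2)[of x t]
        integral_nonneg[of "\<lambda>x. norm (F' x)" "{x..t}"] by auto
      finally show ?thesis by simp
    qed
    have Vst: "V s \<le> V t" using Fd[of s] st by simp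
    \<comment> \<open>Subtracting constants from \<open>F\<close> and \<open>G\<close> does not change \<open>H t - H s\<close>, so both may be taken
        to vanish at \<open>s\<close>; then \<open>\<integral>F' G\<close>, \<open>\<integral>F G'\<close> and \<open>F t G t\<close> are each at most \<open>K (t - s) (V t - V s)\<close>.\<close>
    have 1: "((\<lambda>x. ?k x - F' x * G s - F s * G' x) has_integral
       (integral {s..t} ?k - (F t - F s) * G s - F s * (G t - G s))) {s..t}"
      using primitive_on_has_integral[OF F st] primitive_on_has_integral[OF G st] ki[of s t] st
      by (intro has_integral_diff has_integral_mult_left has_integral_mult_right)
         (auto simp: has_integral_integral[symmetric])
    have 2: "((\<lambda>x. norm (F' x) * (K * (t - s)) + (V t - V s) * K) has_integral
       ((V t - V s) * (K * (t - s)) + (V t - V s) * K * (t - s))) {s..t}"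
      using Fii(2)[of s t] V[OF st] st
         has_integral_const_real[of "(V t - V s) * K" s t]
      by (intro has_integral_add has_integral_mult_left)
        (auto simp: has_integral_iff mult_ac)
    have "norm (integral {s..t} ?k - (F t - F s) * G s - F s * (G t - G s)) \<le>
        (V t - V s) * (K * (t - s)) + (V t - V s) * K * (t - s)"
    proof (rule has_integral_le_norm[OF 1 2])
      fix x assume x: "x \<in> {s..t}"
      have "norm (?k x - F' x * G s - F s * G' x) = norm (F' x * (G x - G s) + (F x - F s) * G' x)"
        by (simp add: algebra_simps)
      also have "\<dots> \<le> norm (F' x) * norm (G x - G s) + norm (F x - F s) * norm (G' x)"
        by (metis norm_mult norm_triangle_ineq)
      also have "norm (G x - G s) \<le> K * (t - s)"
        using Gd[of s x] x st K(2) by (smt (verit) atLeastAtMost_iff mult_left_mono)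
      also have "norm (F x - F s) * norm (G' x) \<le> (V t - V s) * K"
        using Fd[OF x] K(1)[of x] x st Vst by (intro mult_mono) auto
      finally show "norm (?k x - F' x * G s - F s * G' x) \<le> norm (F' x) * (K * (t - s)) + (V t - V s) * K"
        by (simp add: mult_left_mono)
    qed
    moreover have "norm ((F t - F s) * (G t - G s)) \<le> (V t - V s) * (K * (t - s))"
      unfolding norm_mult using Fd[of t] Gd[OF st] st
      using Vst by (intro mult_mono) auto
    moreover have "H t - H s = (integral {s..t} ?k - (F t - F s) * G s - F s * (G t - G s)) - (F t - F s) * (G t - G s)"
      using Henstock_Kurzweil_Integration.integral_combine[of a s t ?k] st ki[of a t]
      by (simp add: H_def algebra_simps)
    ultimately show ?thesis
      by (smt (verit, ccfv_SIG) norm_triangle_ineq4 mult.commute mult.assoc distrib_left distrib_right)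
  qed
  have contV: "continuous_on {a..b} V"
    unfolding V_def using Fii(2)[of a b] by (intro indefinite_integral_continuous_1) auto
  have "(H has_vector_derivative 0) (at s within {a..b})" if s: "s \<in> {a..b}" for s
    unfolding has_vector_derivative_def has_derivative_within
  proof (intro conjI)
    have "((\<lambda>t. 3 * K * \<bar>V t - V s\<bar>) \<longlongrightarrow> 3 * K * \<bar>V s - V s\<bar>) (at s within {a..b})"
      using contV s by (intro tendsto_intros) (auto simp: continuous_on_def)
    then have lim: "((\<lambda>t. 3 * K * \<bar>V t - V s\<bar>) \<longlongrightarrow> 0) (at s within {a..b})" by simp
    have "norm ((1 / norm (y - s)) *\<^sub>R (H y - (H s + (y - s) *\<^sub>R 0))) \<le> 3 * K * \<bar>V y - V s\<bar>"
      if y: "y \<in> {a..b}" "y \<noteq> s" for y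
    proof -
      have "norm (H y - H s) \<le> 3 * K * \<bar>y - s\<bar> * \<bar>V y - V s\<bar>"
      proof (cases "s \<le> y")
        case True
        then have "norm (H y - H s) \<le> 3 * K * \<bar>y - s\<bar> * (V y - V s)" using Hd[of s y] s y by auto
        also have "\<dots> \<le> 3 * K * \<bar>y - s\<bar> * \<bar>V y - V s\<bar>" using K(2) by (intro mult_left_mono) auto
        finally show ?thesis .
      next
        case False
        then have "norm (H s - H y) \<le> 3 * K * \<bar>y - s\<bar> * (V s - V y)" using Hd[of y s] s y by auto
        also have "\<dots> \<le> 3 * K * \<bar>y - s\<bar> * \<bar>V y - V s\<bar>" using K(2) by (intro mult_left_mono) auto
        finally show ?thesis by (simp add: norm_minus_commute)
      qed
      then have "norm (H y - H s) / \<bar>y - s\<bar> \<le> 3 * K * \<bar>V y - V s\<bar>"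
        using y by (simp add: pos_divide_le_eq mult_ac)
      then show ?thesis by simp
    qed
    then have ev: "\<forall>\<^sub>F y in at s within {a..b}. norm ((1 / norm (y - s)) *\<^sub>R (H y - (H s + (y - s) *\<^sub>R 0))) \<le> 3 * K * \<bar>V y - V s\<bar>"
      by (auto simp: eventually_at_filter)
    show "((\<lambda>y. (1 / norm (y - s)) *\<^sub>R (H y - (H s + (y - s) *\<^sub>R 0))) \<longlongrightarrow> 0) (at s within {a..b})"
      by (rule Lim_null_comparison[OF ev lim])
  qed (auto intro: bounded_linear_zero)
  then have "H b = H a"
    using has_derivative_zero_unique_strong_interval has_vector_derivative_zero_constant[of "{a..b}" H] ab
    by (metis atLeastAtMost_iff convex_real_interval(5) order_refl)
  then have "integral {a..b} ?k = F b * G b - F a * G a" by (simp add: H_def algebra_simps)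
  then show ?thesis using ki[of a b] by (simp add: has_integral_iff)
qed

section \<open>Jets of derivatives\<close>

lemma minus_one_power_cancel: "(- 1) ^ n * ((- 1) ^ n * z) = (z :: complex)"
  by (simp flip: mult.assoc power_mult_distrib)

text \<open>\<open>d 0, \<dots>, d m\<close> are successive derivatives, of which only the last may be discontinuous.\<close>

definition jet_on :: "real \<Rightarrow> real \<Rightarrow> nat \<Rightarrow> (nat \<Rightarrow> real \<Rightarrow> complex) \<Rightarrow> bool" where
  "jet_on a b m d \<longleftrightarrow> (\<forall>j<m. primitive_on a b (d j) (d (Suc j)))"

lemma jet_on_continuous: "jet_on a b m d \<Longrightarrow> j < m \<Longrightarrow> continuous_on {a..b} (d j)"
  by (auto simp: jet_on_def intro: primitive_on_continuous)

lemma jet_on_linear_combination: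
  "jet_on a b m d \<Longrightarrow> jet_on a b m e \<Longrightarrow> jet_on a b m (\<lambda>j x. d j x + c * e j x)"
  by (auto simp: jet_on_def intro: primitive_on_linear_combination)

lemma jet_on_cnj: "jet_on a b m d \<Longrightarrow> jet_on a b m (\<lambda>j x. cnj (d j x))"
  by (auto simp: jet_on_def intro: primitive_on_cnj)

lemma jet_on_sum:
  assumes "\<And>k. k \<in> A \<Longrightarrow> jet_on a b m (d k)"
  shows "jet_on a b m (\<lambda>j x. \<Sum>k\<in>A. c k * d k j x)"
  using assms
proof (induction A rule: infinite_finite_induct)
  case (insert k A)
  have "jet_on a b m (\<lambda>j x. (\<Sum>k\<in>A. c k * d k j x) + c k * d k j x)"
    using insert by (intro jet_on_linear_combination) auto
  then show ?case using insert by (simp add: add.commute)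
qed (auto simp: jet_on_def primitive_on_0)

text \<open>Below the top order the derivatives are continuous, so equality almost everywhere is equality; and
  a primitive determines its derivative almost everywhere. Alternating the two facts climbs from
  order \<open>0\<close> to order \<open>m\<close>.\<close>

lemma jet_on_unique:
  assumes d: "jet_on a b m d" and e: "jet_on a b m e" and "a < b"
    and eq: "AE x in lebesgue_on {a<..<b}. d 0 x = e 0 x"
  shows "\<And>j x. j < m \<Longrightarrow> x \<in> {a..b} \<Longrightarrow> d j x = e j x" "AE x in lebesgue_on {a<..<b}. d m x = e m x"
proof -
  have AE: "AE x in lebesgue_on {a<..<b}. d j x = e j x" if "j \<le> m" for j
    using that
  proof (induction j)
    case (Suc j)
    then have "d j x = e j x" if "x \<in> {a..b}" for x
      using that d e \<open>a < b\<close> by (intro continuous_eq_if_AE_eq[of a b]) (auto intro: jet_on_continuous)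
    then show ?case
      using Suc.prems d e by (intro primitive_on_unique[of a b "d j" _ "e j"]) (auto simp: jet_on_def)
  qed (rule eq)
  then show "AE x in lebesgue_on {a<..<b}. d m x = e m x" by blast
  show "d j x = e j x" if "j < m" "x \<in> {a..b}" for j x
    using that d e \<open>a < b\<close> AE[of j] by (intro continuous_eq_if_AE_eq[of a b]) (auto intro: jet_on_continuous)
qed

text \<open>For \<open>r = m\<close> this is the Green formula, for \<open>m = 2n\<close> and \<open>r = n\<close> it produces the Dirichlet form. A step
  that moves one derivative involves \<open>d (m - r)\<close> and \<open>e (Suc r)\<close>; as \<open>m \<ge> 2\<close>, they are not both of
  order \<open>m\<close>, so one of them is continuous.\<close>

lemma jets_integration_by_parts:
  assumes d: "jet_on a b m d" and e: "jet_on a b m e" and "a \<le> b" "m \<ge> 2" "r \<le> m"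
  shows "integral {a..b} (\<lambda>x. d m x * e 0 x) =
     (\<Sum>j<r. (- 1) ^ j * (d (m - 1 - j) b * e j b - d (m - 1 - j) a * e j a)) +
     (- 1) ^ r * integral {a..b} (\<lambda>x. d (m - r) x * e r x)"
  using \<open>r \<le> m\<close>
proof (induction r)
  case (Suc r)
  let ?k = "m - 1 - r"
  have k: "m - r = Suc ?k" "m - Suc r = ?k" "?k < m" "r < m" using Suc by auto
  have F: "primitive_on a b (d ?k) (d (Suc ?k))" and G: "primitive_on a b (e r) (e (Suc r))"
    using d[unfolded jet_on_def, rule_format, OF k(3)] e[unfolded jet_on_def, rule_format, OF k(4)] .
  have sum: "((\<lambda>x. d (Suc ?k) x * e r x + d ?k x * e (Suc r) x) has_integral (d ?k b * e r b - d ?k a * e r a)) {a..b}"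
  proof (cases "Suc r < m")
    case True
    show ?thesis by (rule integration_by_parts_Lipschitz[OF F G jet_on_continuous[OF e True] \<open>a \<le> b\<close>])
  next
    case False
    then have "Suc ?k < m" using k \<open>m \<ge> 2\<close> by linarith
    from integration_by_parts_Lipschitz[OF G F jet_on_continuous[OF d this] \<open>a \<le> b\<close>]
    show ?thesis by (simp add: mult.commute add.commute)
  qed
  have "(\<lambda>x. d (Suc ?k) x * e r x) absolutely_integrable_on {a..b}" "(\<lambda>x. d ?k x * e (Suc r) x) absolutely_integrable_on {a..b}"
    using F G jet_on_continuous[OF d \<open>?k < m\<close>] jet_on_continuous[OF e \<open>r < m\<close>]
    by (auto intro: absolutely_integrable_mult_continuous simp: primitive_on_def)
  from Henstock_Kurzweil_Integration.integral_add[OF this[THEN set_lebesgue_integral_eq_integral(1)]]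
  have "integral {a..b} (\<lambda>x. d (Suc ?k) x * e r x) = d ?k b * e r b - d ?k a * e r a - integral {a..b} (\<lambda>x. d ?k x * e (Suc r) x)"
    unfolding integral_unique[OF sum] by simp
  moreover have "integral {a..b} (\<lambda>x. d m x * e 0 x) =
     (\<Sum>j<r. (- 1) ^ j * (d (m - 1 - j) b * e j b - d (m - 1 - j) a * e j a)) +
     (- 1) ^ r * integral {a..b} (\<lambda>x. d (Suc ?k) x * e r x)"
    using Suc.IH Suc.prems unfolding k(1) by simp
  ultimately have "integral {a..b} (\<lambda>x. d m x * e 0 x) =
     (\<Sum>j<r. (- 1) ^ j * (d (m - 1 - j) b * e j b - d (m - 1 - j) a * e j a)) +
     (- 1) ^ r * (d ?k b * e r b - d ?k a * e r a - integral {a..b} (\<lambda>x. d ?k x * e (Suc r) x))"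
    by (simp only:)
  then show ?case
    unfolding sum.lessThan_Suc power_Suc k(2) by (simp only: right_diff_distrib) simp
qed simp

section \<open>Smooth functions with compact support\<close>

definition smooth :: "(real \<Rightarrow> complex) \<Rightarrow> bool" where
  "smooth f \<longleftrightarrow> (\<forall>k x. (vderiv ^^ k) f differentiable (at x))"

text \<open>Smoothness of a whole class of functions thus follows from a single derivative for each of its
  members; formulas for higher derivatives, such as the Leibniz rule, are avoided.\<close>

lemma smooth_if_closed_under_derivative:
  assumes "f \<in> S" and S: "\<And>g. g \<in> S \<Longrightarrow> \<exists>g'\<in>S. \<forall>x. (g has_vector_derivative g' x) (at x)"
  shows "smooth f"
proof -
  have "(vderiv ^^ k) f \<in> S" for k
  proof (induction k)
    case (Suc k)
    then obtain g where g: "g \<in> S" "\<And>x. ((vderiv ^^ k) f has_vector_derivative g x) (at x)"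
      using S by blast
    then have "(vderiv ^^ Suc k) f = g"
      by (auto simp: vderiv_def intro!: ext vector_derivative_at)
    then show ?case using g by simp
  qed (use assms in auto)
  then show ?thesis
    using S unfolding smooth_def by (meson differentiableI_vector)
qed

lemma smooth_has_vector_derivative:
  assumes "smooth f"
  shows "((vderiv ^^ k) f has_vector_derivative (vderiv ^^ Suc k) f x) (at x)"
  using assms by (simp add: smooth_def vderiv_def vector_derivative_works)

lemma smooth_continuous_on:
  assumes "smooth f"
  shows "continuous_on A ((vderiv ^^ k) f)"
  using smooth_has_vector_derivative[OF assms]
  by (meson continuous_at_imp_continuous_on has_vector_derivative_continuous)

lemma smooth_if_derivative_smooth:
  assumes "\<And>x. (f has_vector_derivative g x) (at x)" "smooth g"
  shows "smooth f"
proof (rule smooth_if_closed_under_derivative[of _ "insert f (range (\<lambda>k. (vderiv ^^ k) g))"])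
  fix h assume "h \<in> insert f (range (\<lambda>k. (vderiv ^^ k) g))"
  then consider "h = f" | k where "h = (vderiv ^^ k) g" by auto
  then show "\<exists>g'\<in>insert f (range (\<lambda>k. (vderiv ^^ k) g)). \<forall>x. (h has_vector_derivative g' x) (at x)"
  proof cases
    case 1
    have "(vderiv ^^ 0) g = g" by simp
    then show ?thesis using 1 assms(1) by (intro bexI[of _ g]) (metis, metis insert_iff rangeI)
  next
    case 2
    then show ?thesis using smooth_has_vector_derivative[OF assms(2), of k]
      by (intro bexI[of _ "(vderiv ^^ Suc k) g"]) blast+
  qed
qed auto

lemma vderiv_eqI:
  assumes "\<And>x. (f has_vector_derivative g x) (at x)"
  shows "vderiv f = g"
  using assms by (auto simp: vderiv_def intro!: vector_derivative_at)

lemma vderiv_linear_combination: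
  assumes "smooth f" "smooth g"
  shows "(vderiv ^^ k) (\<lambda>x. f x + c * g x) = (\<lambda>x. (vderiv ^^ k) f x + c * (vderiv ^^ k) g x)"
proof (induction k)
  case (Suc k)
  have "((\<lambda>x. (vderiv ^^ k) f x + c * (vderiv ^^ k) g x) has_vector_derivative
     (vderiv ^^ Suc k) f x + c * (vderiv ^^ Suc k) g x) (at x)" for x
    by (intro derivative_intros smooth_has_vector_derivative assms)
  then have "vderiv (\<lambda>x. (vderiv ^^ k) f x + c * (vderiv ^^ k) g x) =
     (\<lambda>x. (vderiv ^^ Suc k) f x + c * (vderiv ^^ Suc k) g x)"
    by (rule vderiv_eqI)
  then show ?case
    using Suc.IH by simp
qed auto

lemma smooth_linear_combination:
  assumes "smooth f" "smooth g"
  shows "smooth (\<lambda>x. f x + c * g x)"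
proof -
  have "(\<lambda>x. (vderiv ^^ k) f x + c * (vderiv ^^ k) g x) differentiable (at x)" for k x
    using assms by (intro derivative_intros) (auto simp: smooth_def)
  then show ?thesis by (simp add: smooth_def vderiv_linear_combination[OF assms])
qed

text \<open>The functions \<open>exp (- e / (x - c))\<close>, cut off to the left of \<open>c\<close>, generate the test functions below.
  The powers of \<open>1 / (x - c)\<close> appear in their derivatives, and with them the class is closed under
  differentiation.\<close>

inductive smooth_piece :: "(real \<Rightarrow> complex) \<Rightarrow> bool" where
  const: "smooth_piece (\<lambda>x. c)"
| flat: "e > 0 \<Longrightarrow> smooth_piece (\<lambda>x. if x > c then complex_of_real ((1 / (x - c)) ^ k * exp (- e / (x - c))) else 0)"
| add: "smooth_piece f \<Longrightarrow> smooth_piece g \<Longrightarrow> smooth_piece (\<lambda>x. f x + g x)"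
| mult: "smooth_piece f \<Longrightarrow> smooth_piece g \<Longrightarrow> smooth_piece (\<lambda>x. f x * g x)"
| reflect: "smooth_piece f \<Longrightarrow> smooth_piece (\<lambda>x. f (- x))"

text \<open>With \<open>y = e / (x - c)\<close> this is the decay of \<open>y\<^sup>k exp (- y)\<close> at infinity.\<close>

lemma flat_tendsto_0:
  fixes e :: real
  assumes "e > 0"
  shows "((\<lambda>x. (1 / (x - c)) ^ k * exp (- e / (x - c))) \<longlongrightarrow> 0) (at_right c)"
proof -
  have 1: "filterlim (\<lambda>x. e / (x - c)) at_top (at_right c)"
    using assms by real_asymp
  have "((\<lambda>y. y ^ k / exp y) \<longlongrightarrow> 0) (at_top :: real filter)"
    by (rule tendsto_power_div_exp_0)
  from filterlim_compose[OF this 1]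
  have "((\<lambda>x. (1 / e) ^ k * ((e / (x - c)) ^ k / exp (e / (x - c)))) \<longlongrightarrow> (1 / e) ^ k * 0) (at_right c)"
    by (intro tendsto_intros)
  moreover have "(1 / e) ^ k * ((e / (x - c)) ^ k / exp (e / (x - c))) = (1 / (x - c)) ^ k * exp (- e / (x - c))" for x
  proof -
    have "(1 / e) ^ k * (e / (x - c)) ^ k = (1 / (x - c)) ^ k"
      using assms by (simp flip: power_mult_distrib)
    then show ?thesis
      by (metis (no_types, opaque_lifting) divide_inverse exp_minus minus_divide_left mult.assoc)
  qed
  ultimately show ?thesis by simp
qed

lemma flat_has_vector_derivative:
  fixes e c :: real and k :: nat
  defines "\<beta> \<equiv> \<lambda>k x. if x > c then complex_of_real ((1 / (x - c)) ^ k * exp (- e / (x - c))) else 0"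
  assumes "e > 0"
  shows "(\<beta> k has_vector_derivative (- of_nat k * \<beta> (Suc k) x + complex_of_real e * \<beta> (Suc (Suc k)) x)) (at x)"
proof -
  consider "x > c" | "x < c" | "x = c" by linarith
  then show ?thesis
  proof cases
    case 1
    have "((\<lambda>x. (1 / (x - c)) ^ k * exp (- e / (x - c))) has_real_derivative
       (- real k * ((1 / (x - c)) ^ Suc k * exp (- e / (x - c))) + e * ((1 / (x - c)) ^ Suc (Suc k) * exp (- e / (x - c))))) (at x)"
    proof -
      have 1: "((\<lambda>x. 1 / (x - c)) has_real_derivative - ((1 / (x - c)) * (1 / (x - c)))) (at x)"
        using 1 by (auto intro!: derivative_eq_intros)
      have 2: "((\<lambda>y. y ^ k * exp (- e * y)) has_real_derivative
          (real k * y ^ (k - 1) * exp (- e * y) + y ^ k * (exp (- e * y) * - e))) (at y)" for y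
        by (auto intro!: derivative_eq_intros)
      have 3: "(real k * y ^ (k - 1) * exp (- e * y) + y ^ k * (exp (- e * y) * - e)) * - (y * y) =
         - real k * (y ^ Suc k * exp (- e * y)) + e * (y ^ Suc (Suc k) * exp (- e * y))" for y
        by (cases k) (simp_all add: algebra_simps)
      show ?thesis
        using DERIV_chain2[OF 2 1] unfolding 3 by simp
    qed
    then have "((\<lambda>x. complex_of_real ((1 / (x - c)) ^ k * exp (- e / (x - c)))) has_vector_derivative
       complex_of_real (- real k * ((1 / (x - c)) ^ Suc k * exp (- e / (x - c))) + e * ((1 / (x - c)) ^ Suc (Suc k) * exp (- e / (x - c))))) (at x)"
      by (intro has_vector_derivative_of_real) (simp add: has_real_derivative_iff_has_vector_derivative)
    then show ?thesis
    proof (rule has_vector_derivative_transform_within_open[of _ _ _ "{c<..}", THEN back_subst[of "\<lambda>d. (\<beta> k has_vector_derivative d) (at x)"]])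
      show "complex_of_real (- real k * ((1 / (x - c)) ^ Suc k * exp (- e / (x - c))) + e * ((1 / (x - c)) ^ Suc (Suc k) * exp (- e / (x - c)))) =
        - of_nat k * \<beta> (Suc k) x + complex_of_real e * \<beta> (Suc (Suc k)) x"
        using 1 by (simp add: \<beta>_def)
    qed (use 1 in \<open>auto simp: \<beta>_def\<close>)
  next
    case 2
    have "((\<lambda>x. 0 :: complex) has_vector_derivative 0) (at x)" by simp
    then have "(\<beta> k has_vector_derivative 0) (at x)"
      by (rule has_vector_derivative_transform_within_open[of _ _ _ "{..<c}"]) (use 2 in \<open>auto simp: \<beta>_def\<close>)
    then show ?thesis using 2 by (simp add: \<beta>_def)
  next
    case 3
    have r: "((\<lambda>y. (1 / (y - c)) *\<^sub>R \<beta> k y) \<longlongrightarrow> 0) (at_right c)"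
    proof -
      have "((\<lambda>x. complex_of_real ((1 / (x - c)) ^ Suc k * exp (- e / (x - c)))) \<longlongrightarrow> complex_of_real 0) (at_right c)"
        by (intro tendsto_of_real flat_tendsto_0 assms)
      then show ?thesis
        by (rule Lim_transform_eventually[THEN back_subst[of "\<lambda>l. (_ \<longlongrightarrow> l) _"]])
          (auto simp: \<beta>_def eventually_at_filter scaleR_conv_of_real)
    qed
    have l: "((\<lambda>y. (1 / (y - c)) *\<^sub>R \<beta> k y) \<longlongrightarrow> 0) (at_left c)"
      by (rule Lim_transform_eventually[of "\<lambda>_. 0"]) (auto simp: \<beta>_def eventually_at_filter)
    have "((\<lambda>y. (1 / (y - c)) *\<^sub>R (\<beta> k y - \<beta> k c)) \<longlongrightarrow> 0) (at c)"
      using l r by (simp add: filterlim_at_split \<beta>_def)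
    then have "((\<lambda>y. (1 / norm (y - c)) *\<^sub>R (\<beta> k y - (\<beta> k c + (y - c) *\<^sub>R 0))) \<longlongrightarrow> 0) (at c)"
      by (rule Lim_null_comparison[rotated, OF tendsto_norm_zero]) (simp add: eventually_at_filter)
    then have "(\<beta> k has_vector_derivative 0) (at c)"
      by (simp add: has_vector_derivative_def has_derivative_within)
    then show ?thesis using 3 by (simp add: \<beta>_def)
  qed
qed

lemma smooth_piece_derivative:
  assumes "smooth_piece f"
  shows "\<exists>g. smooth_piece g \<and> (\<forall>x. (f has_vector_derivative g x) (at x))"
  using assms
proof (induction rule: smooth_piece.induct)
  case (const c)
  then show ?case using smooth_piece.const[of 0] by (intro exI[of _ "\<lambda>_. 0"]) auto
next
  case (flat e c k)
  show ?case
    by (intro exI[of _ "\<lambda>x. - of_nat k * (if x > c then complex_of_real ((1 / (x - c)) ^ Suc k * exp (- e / (x - c))) else 0)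
       + complex_of_real e * (if x > c then complex_of_real ((1 / (x - c)) ^ Suc (Suc k) * exp (- e / (x - c))) else 0)"]
        conjI allI flat_has_vector_derivative smooth_piece.intros flat)
next
  case (add f g)
  then obtain f' g' where "smooth_piece f'" "\<And>x. (f has_vector_derivative f' x) (at x)"
    "smooth_piece g'" "\<And>x. (g has_vector_derivative g' x) (at x)" by blast
  then show ?case
    by (intro exI[of _ "\<lambda>x. f' x + g' x"]) (auto intro!: smooth_piece.intros derivative_intros)
next
  case (mult f g)
  then obtain f' g' where "smooth_piece f'" "\<And>x. (f has_vector_derivative f' x) (at x)"
    "smooth_piece g'" "\<And>x. (g has_vector_derivative g' x) (at x)" by blast
  with mult have "smooth_piece (\<lambda>x. f x * g' x + f' x * g x)"
    "\<And>x. ((\<lambda>x. f x * g x) has_vector_derivative (f x * g' x + f' x * g x)) (at x)"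
    by (auto intro: smooth_piece.add smooth_piece.mult has_vector_derivative_mult)
  then show ?case by blast
next
  case (reflect f)
  then obtain f' where f': "smooth_piece f'" "\<And>x. (f has_vector_derivative f' x) (at x)" by blast
  have "((\<lambda>x. f (- x)) has_vector_derivative (- 1) * f' (- x)) (at x)" for x
    using vector_diff_chain_at[of uminus "-1" x f "f' (- x)"] f'(2)[of "- x"]
    by (simp add: o_def has_vector_derivative_minus[OF has_vector_derivative_id])
  moreover have "smooth_piece (\<lambda>x. (- 1) * f' (- x))"
    by (intro smooth_piece.mult smooth_piece.const smooth_piece.reflect f')
  ultimately show ?case by blast
qed

lemma smooth_if_piece: "smooth_piece f \<Longrightarrow> smooth f"
  using smooth_if_closed_under_derivative[of f "Collect smooth_piece"] smooth_piece_derivative by blast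

lemma test_function_iff:
  "test_function a b f \<longleftrightarrow> smooth f \<and> (\<exists>c d. a < c \<and> d < b \<and> (\<forall>x. x \<notin> {c..d} \<longrightarrow> f x = 0))"
  by (simp add: test_function_def smooth_def)

text \<open>As \<open>e\<close> tends to \<open>0\<close> these functions increase to the indicator function of \<open>(c,d)\<close>, so that integrals
  over intervals are limits of integrals against test functions.\<close>

definition plateau :: "real \<Rightarrow> real \<Rightarrow> real \<Rightarrow> real \<Rightarrow> complex" where
  "plateau e c d x = (if c < x \<and> x < d then complex_of_real (exp (- e / (x - c)) * exp (- e / (d - x))) else 0)"

lemma test_function_plateau:
  assumes "a < c" "d < b" "e > 0"
  shows "test_function a b (plateau e c d)"
proof -
  let ?g = "\<lambda>x. (if x > c then complex_of_real ((1 / (x - c)) ^ 0 * exp (- e / (x - c))) else 0) *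
     (if - x > - d then complex_of_real ((1 / (- x - (- d))) ^ 0 * exp (- e / (- x - (- d)))) else 0) :: complex"
  have "smooth_piece ?g"
    by (intro smooth_piece.mult smooth_piece.flat smooth_piece.reflect[of "\<lambda>x. if x > - d then _ x else 0"] assms)
  moreover have "?g = plateau e c d"
    by (auto simp: plateau_def fun_eq_iff)
  ultimately have "smooth_piece (plateau e c d)" by simp
  then have "smooth (plateau e c d)" by (rule smooth_if_piece)
  moreover have "\<forall>x. x \<notin> {c..d} \<longrightarrow> plateau e c d x = 0" by (simp add: plateau_def)
  ultimately show ?thesis using assms by (auto simp: test_function_iff)
qed

text \<open>Dominated convergence: the plateau functions take values in \<open>[0,1]\<close> and converge pointwise to the
  indicator function of \<open>(c,d)\<close>.\<close>

lemma integral_plateau_tendsto: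
  fixes w :: "real \<Rightarrow> complex"
  assumes w: "w absolutely_integrable_on {a..b}" and "a < c" "c < d" "d < b"
  shows "(\<lambda>k. integral {a..b} (\<lambda>x. plateau (1 / real (Suc k)) c d x * w x)) \<longlonglongrightarrow> integral {c..d} w"
proof -
  let ?p = "\<lambda>k x. plateau (1 / real (Suc k)) c d x * w x"
  have int: "?p k integrable_on {a..b}" for k
  proof -
    have "continuous_on {a..b} (plateau (1 / real (Suc k)) c d)"
      using smooth_continuous_on[of _ _ 0] test_function_plateau[OF assms(2,4), of "1 / real (Suc k)"]
      by (simp add: test_function_iff)
    then show ?thesis
      by (intro set_lebesgue_integral_eq_integral(1) absolutely_integrable_mult_continuous w)
  qed
  have nw: "(\<lambda>x. norm (w x)) integrable_on {a..b}" using w by (simp add: absolutely_integrable_on_def)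
  have le: "norm (?p k x) \<le> norm (w x)" for k x
    by (auto simp: plateau_def norm_mult mult_le_one intro!: mult_left_le_one_le)
  have lim: "(\<lambda>k. ?p k x) \<longlonglongrightarrow> (if x \<in> {c<..<d} then w x else 0)" if "x \<in> {a..b}" for x
  proof (cases "x \<in> {c<..<d}")
    case True
    have "(\<lambda>k. complex_of_real (exp (- (1 / real (Suc k)) / (x - c)) * exp (- (1 / real (Suc k)) / (d - x))) * w x)
       \<longlonglongrightarrow> complex_of_real (exp (- 0 / (x - c)) * exp (- 0 / (d - x))) * w x"
      using True by (intro tendsto_intros LIMSEQ_Suc lim_1_over_n) auto
    then show ?thesis using True by (simp add: plateau_def)
  qed (auto simp: plateau_def)
  have "(\<lambda>k. integral {a..b} (?p k)) \<longlonglongrightarrow> integral {a..b} (\<lambda>x. if x \<in> {c<..<d} then w x else 0)"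
    using dominated_convergence(2)[OF int nw le lim] by simp
  also have "integral {a..b} (\<lambda>x. if x \<in> {c<..<d} then w x else 0) = integral {c<..<d} w"
    using assms by (subst integral_restrict_Int) (auto intro!: arg_cong2[of _ _ _ _ integral])
  also have "\<dots> = integral {c..d} w" by (simp add: integral_open_interval_real)
  finally show ?thesis .
qed

text \<open>The fundamental lemma of the calculus of variations.\<close>

lemma test_functions_separate:
  fixes w :: "real \<Rightarrow> complex"
  assumes w: "w absolutely_integrable_on {a..b}"
    and zero: "\<And>\<phi>. test_function a b \<phi> \<Longrightarrow> integral {a..b} (\<lambda>x. \<phi> x * w x) = 0"
  shows "AE x in lebesgue_on {a<..<b}. w x = 0"
proof (rule AE_zero_if_interval_integrals_zero[OF w])
  fix c d assume cd: "a < c" "c < d" "d < b"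
  have "(\<lambda>k. integral {a..b} (\<lambda>x. plateau (1 / real (Suc k)) c d x * w x)) = (\<lambda>k. 0)"
    using test_function_plateau[OF cd(1,3)] zero by (intro ext) simp
  then show "integral {c..d} w = 0"
    using integral_plateau_tendsto[OF w cd] by (simp add: LIMSEQ_const_iff)
qed

text \<open>The integrals of the plateau functions over \<open>(c,d)\<close> tend to \<open>d - c\<close>, so one of them is not zero
  and can be normalised.\<close>

lemma test_function_integral_1:
  assumes "a < b"
  obtains \<eta> where "test_function a b \<eta>" "integral {a..b} \<eta> = 1"
proof -
  define c d where "c = a + (b - a) / 3" and "d = a + 2 * (b - a) / 3"
  have cd: "a < c" "c < d" "d < b" using assms by (auto simp: c_def d_def field_simps)
  have "(\<lambda>k. integral {a..b} (\<lambda>x. plateau (1 / real (Suc k)) c d x * 1)) \<longlonglongrightarrow> integral {c..d} (\<lambda>x. 1 :: complex)"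
    by (rule integral_plateau_tendsto[OF _ cd]) simp
  moreover have "integral {c..d} (\<lambda>x. 1 :: complex) \<noteq> 0" using cd by simp
  ultimately have "(\<lambda>k. integral {a..b} (\<lambda>x. plateau (1 / real (Suc k)) c d x * 1)) \<noteq> (\<lambda>k. 0)"
    by (metis LIMSEQ_const_iff)
  then have "\<exists>k. integral {a..b} (plateau (1 / real (Suc k)) c d) \<noteq> 0"
    by (auto simp del: of_nat_Suc)
  then obtain k where k: "integral {a..b} (plateau (1 / real (Suc k)) c d) \<noteq> 0" ..
  let ?p = "plateau (1 / real (Suc k)) c d"
  have t: "test_function a b ?p" using cd by (intro test_function_plateau) auto
  let ?i = "1 / integral {a..b} ?p"
  have "smooth (\<lambda>x. 0)" using smooth_if_piece[OF smooth_piece.const] by simp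
  from smooth_linear_combination[OF this, of ?p ?i] t
  have "test_function a b (\<lambda>x. ?i * ?p x)" by (auto simp: test_function_iff)
  moreover have "integral {a..b} (\<lambda>x. ?i * ?p x) = 1" using k by simp
  ultimately show ?thesis by (rule that)
qed

lemma test_function_linear_combination:
  assumes "test_function a b f" "test_function a b g"
  shows "test_function a b (\<lambda>x. f x + c * g x)"
proof -
  obtain c1 d1 c2 d2 where "a < c1" "d1 < b" "\<And>x. x \<notin> {c1..d1} \<Longrightarrow> f x = 0"
    "a < c2" "d2 < b" "\<And>x. x \<notin> {c2..d2} \<Longrightarrow> g x = 0"
    using assms by (auto simp: test_function_iff)
  then have "a < min c1 c2" "max d1 d2 < b" "\<And>x. x \<notin> {min c1 c2..max d1 d2} \<Longrightarrow> f x + c * g x = 0"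
    by (auto simp: min_def max_def split: if_splits)
  then show ?thesis
    using assms smooth_linear_combination[of f g c] unfolding test_function_iff by blast
qed

text \<open>The primitive that vanishes to the left of the support is constant to the right of it, and the
  constant is the integral of \<open>\<theta>\<close>. So mean value zero is what keeps the support compact.\<close>

lemma test_function_primitive:
  assumes \<theta>: "test_function a b \<theta>" and zero: "integral {a..b} \<theta> = 0" and "a < b"
  obtains \<phi> where "test_function a b \<phi>" "vderiv \<phi> = \<theta>"
proof -
  obtain c0 d0 where cd0: "a < c0" "d0 < b" "\<And>x. x \<notin> {c0..d0} \<Longrightarrow> \<theta> x = 0"
    using \<theta> by (auto simp: test_function_iff)
  \<comment> \<open>The hypothesis allows \<open>c0 > d0\<close>; enlarging the interval makes \<open>c \<le> d\<close>.\<close>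
  define c d where "c = min c0 ((a + b) / 2)" and "d = max d0 ((a + b) / 2)"
  have "a < c" "c \<le> d" "d < b"
    using cd0 \<open>a < b\<close> by (auto simp: c_def d_def)
  moreover have "\<theta> x = 0" if "x \<notin> {c..d}" for x
    by (rule cd0(3)) (use that in \<open>auto simp: c_def d_def\<close>)
  ultimately have cd: "a < c" "c \<le> d" "d < b" "\<And>x. x \<notin> {c..d} \<Longrightarrow> \<theta> x = 0"
    by blast+
  have cont: "continuous_on A \<theta>" for A
    using smooth_continuous_on[of \<theta> A 0] \<theta> by (simp add: test_function_iff)
  have z: "integral {u..v} \<theta> = 0" if "v \<le> c \<or> d \<le> u" for u v
  proof -
    have "integral {u..v} \<theta> = integral {u..v} (\<lambda>x. 0)"
      by (rule integral_spike[of "{c, d}"]) (use cd that in auto)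
    then show ?thesis by simp
  qed
  have comb: "integral {u..v} \<theta> + integral {v..w} \<theta> = integral {u..w} \<theta>" if "u \<le> v" "v \<le> w" for u v w
    using that by (intro Henstock_Kurzweil_Integration.integral_combine integrable_continuous_real cont)
  define \<phi> where "\<phi> x = integral {c..x} \<theta>" for x
  have \<phi>: "\<phi> x = integral {u..x} \<theta>" if "u \<le> c" "u \<le> x" for u x
  proof (cases "c \<le> x")
    case True
    then show ?thesis using comb[of u c x] z[of c u] that by (simp add: \<phi>_def)
  next
    case False
    then show ?thesis using z[of x u] by (simp add: \<phi>_def)
  qed
  have der: "(\<phi> has_vector_derivative \<theta> x) (at x)" for x
  proof -
    define u where "u = min c x - 1"
    have "((\<lambda>y. integral {u..y} \<theta>) has_vector_derivative \<theta> x) (at x within {u..x+1})"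
      by (rule integral_has_vector_derivative) (auto simp: u_def cont)
    then have "((\<lambda>y. integral {u..y} \<theta>) has_vector_derivative \<theta> x) (at x)"
      by (subst (asm) at_within_interior) (auto simp: u_def interior_atLeastAtMost_real)
    then show ?thesis
    proof (rule has_vector_derivative_transform_within_open[of _ _ _ "{u<..}"])
      fix y assume "y \<in> {u<..}"
      then show "integral {u..y} \<theta> = \<phi> y" by (subst \<phi>[of u]) (auto simp: u_def)
    qed (auto simp: u_def)
  qed
  have "\<phi> x = 0" if "x \<notin> {c..d}" for x
  proof (cases "x < c")
    case False
    then have "d \<le> x" using that by auto
    then have "\<phi> x = integral {c..d} \<theta>"
      using comb[of c d x] z[of x d] cd by (simp add: \<phi>_def)
    also have "\<dots> = integral {a..b} \<theta>"
      using comb[of a c d] comb[of a d b] z[of c a] z[of b d] cd by simp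
    finally show ?thesis using zero by simp
  qed (simp add: \<phi>_def)
  moreover have "vderiv \<phi> = \<theta>" using der by (rule vderiv_eqI)
  moreover have "smooth \<phi>" using smooth_if_derivative_smooth[OF der] \<theta> by (simp add: test_function_iff)
  ultimately show ?thesis using cd by (intro that[of \<phi>]) (auto simp: test_function_iff)
qed

lemma test_function_derivatives_support:
  assumes "test_function a b \<phi>"
  obtains c d where "a < c" "d < b" "\<And>k x. x \<notin> {c..d} \<Longrightarrow> (vderiv ^^ k) \<phi> x = 0"
proof -
  obtain c d where cd: "a < c" "d < b" "\<And>x. x \<notin> {c..d} \<Longrightarrow> \<phi> x = 0"
    using assms by (auto simp: test_function_iff)
  have "(vderiv ^^ k) \<phi> x = 0" if "x \<notin> {c..d}" for k x
    using that
  proof (induction k arbitrary: x)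
    case (Suc k)
    have "((\<lambda>_. 0 :: complex) has_vector_derivative 0) (at x)" by simp
    then have "((vderiv ^^ k) \<phi> has_vector_derivative 0) (at x)"
      by (rule has_vector_derivative_transform_within_open[of _ _ _ "- {c..d}"]) (use Suc in auto)
    from vector_derivative_at[OF this] show ?case by (simp add: vderiv_def[of "(vderiv ^^ k) \<phi>"])
  qed (use cd in auto)
  then show ?thesis using cd that by blast
qed

lemma jet_on_test_function: "test_function a b \<phi> \<Longrightarrow> jet_on a b m (\<lambda>k. (vderiv ^^ k) \<phi>)"
  unfolding jet_on_def
  by (intro allI impI primitive_on_C1 smooth_has_vector_derivative smooth_continuous_on) (auto simp: test_function_iff)

lemma absolutely_integrable_smooth_mult:
  assumes "smooth \<phi>" "w absolutely_integrable_on {a..b}"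
  shows "(\<lambda>x. (vderiv ^^ k) \<phi> x * w x) absolutely_integrable_on {a..b}"
  by (intro absolutely_integrable_mult_continuous assms smooth_continuous_on)

text \<open>The lemma of du Bois-Reymond, by induction on the order. A test function \<open>\<psi>\<close> need not be a derivative
  of another one, but it is after subtracting \<open>(\<integral>\<psi>) \<eta>\<close>, where \<open>\<eta>\<close> is fixed with integral \<open>1\<close>. Inserting
  the primitive of \<open>\<psi> - (\<integral>\<psi>) \<eta>\<close> into the hypothesis of order \<open>m + 1\<close>, and integrating \<open>g\<close> by parts once,
  gives the hypothesis of order \<open>m\<close> with \<open>g\<close> replaced by one of its primitives; the correction by \<open>\<eta>\<close>
  only fixes the constant of integration \<open>C\<close>.\<close>

lemma weak_derivative_imp_jet:
  assumes "w absolutely_integrable_on {a..b}" "g absolutely_integrable_on {a..b}" and ab: "a < b"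
    and "\<And>\<phi>. test_function a b \<phi> \<Longrightarrow>
      integral {a..b} (\<lambda>x. (vderiv ^^ m) \<phi> x * w x) = (- 1) ^ m * integral {a..b} (\<lambda>x. \<phi> x * g x)"
  shows "\<exists>d. jet_on a b m d \<and> d m = g \<and> (AE x in lebesgue_on {a<..<b}. w x = d 0 x)"
  using assms
proof (induction m arbitrary: g)
  case 0
  have "AE x in lebesgue_on {a<..<b}. w x - g x = 0"
  proof (rule test_functions_separate)
    fix \<phi> assume "test_function a b \<phi>"
    then have "smooth \<phi>" by (simp add: test_function_iff)
    then have "(\<lambda>x. \<phi> x * w x) integrable_on {a..b}" "(\<lambda>x. \<phi> x * g x) integrable_on {a..b}"
      using absolutely_integrable_smooth_mult[of \<phi> a b _ 0] 0 set_lebesgue_integral_eq_integral(1) by auto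
    then have "integral {a..b} (\<lambda>x. \<phi> x * w x - \<phi> x * g x) = 0"
      using 0(4)[OF \<open>test_function a b \<phi>\<close>] by (subst Henstock_Kurzweil_Integration.integral_diff) auto
    then show "integral {a..b} (\<lambda>x. \<phi> x * (w x - g x)) = 0" by (simp add: algebra_simps)
  qed (use 0 in \<open>auto intro: set_integral_diff\<close>)
  then show ?case by (intro exI[of _ "\<lambda>_. g"]) (auto simp: jet_on_def)
next
  case (Suc m)
  obtain \<eta> where \<eta>: "test_function a b \<eta>" "integral {a..b} \<eta> = 1"
    using test_function_integral_1[OF ab] .
  define G where "G x = 0 + integral {a..x} g" for x
  have G: "primitive_on a b G g"
    unfolding G_def by (rule primitive_on_integral) (use Suc in auto)
  have Ga: "G absolutely_integrable_on {a..b}"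
    using primitive_on_continuous[OF G] by (rule absolutely_integrable_continuous_real)
  have int: "(\<lambda>x. (vderiv ^^ k) \<phi> x * u x) integrable_on {a..b}"
    if "test_function a b \<phi>" "u absolutely_integrable_on {a..b}" for k \<phi> u
    using absolutely_integrable_smooth_mult[of \<phi> a b u k] that set_lebesgue_integral_eq_integral(1)
    by (auto simp: test_function_iff)
  \<comment> \<open>The constant of integration that the correction by \<open>\<eta>\<close> leaves behind.\<close>
  define C where "C = (- 1) ^ m * integral {a..b} (\<lambda>x. (vderiv ^^ m) \<eta> x * w x) - integral {a..b} (\<lambda>x. \<eta> x * G x)"
  have "\<exists>d. jet_on a b m d \<and> d m = (\<lambda>x. C + G x) \<and> (AE x in lebesgue_on {a<..<b}. w x = d 0 x)"
  proof (rule Suc.IH)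
    fix \<psi> assume \<psi>: "test_function a b \<psi>"
    let ?i = "integral {a..b} \<psi>"
    define \<theta> where "\<theta> = (\<lambda>x. \<psi> x + (- ?i) * \<eta> x)"
    have \<theta>: "test_function a b \<theta>"
      unfolding \<theta>_def by (intro test_function_linear_combination \<psi> \<eta>)
    have cont: "continuous_on {a..b} \<psi>" "continuous_on {a..b} \<eta>" "continuous_on {a..b} \<theta>"
      using \<psi> \<eta> \<theta> smooth_continuous_on[of _ _ 0] by (auto simp: test_function_iff)
    have "integral {a..b} \<theta> = 0"
      unfolding \<theta>_def using cont \<eta>
      by (subst Henstock_Kurzweil_Integration.integral_add) (auto intro!: integrable_continuous_real continuous_intros)
    then obtain \<phi> where \<phi>: "test_function a b \<phi>" "vderiv \<phi> = \<theta>"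
      using test_function_primitive[OF \<theta> _ ab] by blast
    have "(vderiv ^^ Suc m) \<phi> = (vderiv ^^ m) \<theta>" by (simp add: funpow_swap1 flip: \<phi>(2))
    also have "\<dots> = (\<lambda>x. (vderiv ^^ m) \<psi> x + (- ?i) * (vderiv ^^ m) \<eta> x)"
      unfolding \<theta>_def using \<psi> \<eta> by (intro vderiv_linear_combination) (auto simp: test_function_iff)
    finally have "integral {a..b} (\<lambda>x. (vderiv ^^ Suc m) \<phi> x * w x) =
       integral {a..b} (\<lambda>x. (vderiv ^^ m) \<psi> x * w x + (- ?i) * ((vderiv ^^ m) \<eta> x * w x))"
      by (simp only: distrib_right mult.assoc)
    also have "\<dots> = integral {a..b} (\<lambda>x. (vderiv ^^ m) \<psi> x * w x) + (- ?i) * integral {a..b} (\<lambda>x. (vderiv ^^ m) \<eta> x * w x)"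
      by (intro integral_linear_combination int \<psi> \<eta> Suc.prems)
    finally have 1: "(- 1) ^ Suc m * integral {a..b} (\<lambda>x. \<phi> x * g x) =
       integral {a..b} (\<lambda>x. (vderiv ^^ m) \<psi> x * w x) - ?i * integral {a..b} (\<lambda>x. (vderiv ^^ m) \<eta> x * w x)"
      using Suc.prems(4)[OF \<phi>(1)] by simp
    have ends: "\<phi> a = 0" "\<phi> b = 0" using \<phi>(1) by (auto simp: test_function_iff)
    have "primitive_on a b \<phi> \<theta>"
      using smooth_has_vector_derivative[of \<phi> 0] \<phi> cont by (intro primitive_on_C1) (auto simp: test_function_iff)
    from integration_by_parts_Lipschitz[OF G this cont(3)]
    have "((\<lambda>x. g x * \<phi> x + G x * \<theta> x) has_integral 0) {a..b}" using ab ends by simp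
    then have "integral {a..b} (\<lambda>x. \<phi> x * g x + \<theta> x * G x) = 0" by (simp add: mult.commute integral_unique)
    then have "integral {a..b} (\<lambda>x. \<phi> x * g x) = - integral {a..b} (\<lambda>x. \<theta> x * G x)"
      using int[OF \<phi>(1) Suc.prems(2), of 0] int[OF \<theta> Ga, of 0]
      by (subst (asm) Henstock_Kurzweil_Integration.integral_add) (auto simp: eq_neg_iff_add_eq_0)
    also have "integral {a..b} (\<lambda>x. \<theta> x * G x) = integral {a..b} (\<lambda>x. \<psi> x * G x + (- ?i) * (\<eta> x * G x))"
      by (simp add: \<theta>_def algebra_simps)
    also have "\<dots> = integral {a..b} (\<lambda>x. \<psi> x * G x) + (- ?i) * integral {a..b} (\<lambda>x. \<eta> x * G x)"
      using int[OF \<psi> Ga, of 0] int[OF \<eta>(1) Ga, of 0] by (intro integral_linear_combination) auto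
    finally have 2: "integral {a..b} (\<lambda>x. \<phi> x * g x) = ?i * integral {a..b} (\<lambda>x. \<eta> x * G x) - integral {a..b} (\<lambda>x. \<psi> x * G x)"
      by simp
    have "integral {a..b} (\<lambda>x. \<psi> x * (C + G x)) = integral {a..b} (\<lambda>x. \<psi> x * G x + C * \<psi> x)"
      by (simp add: algebra_simps)
    also have "\<dots> = integral {a..b} (\<lambda>x. \<psi> x * G x) + C * ?i"
      using int[OF \<psi> Ga, of 0] cont by (intro integral_linear_combination) (auto intro: integrable_continuous_real)
    finally have 3: "integral {a..b} (\<lambda>x. \<psi> x * (C + G x)) = C * ?i + integral {a..b} (\<lambda>x. \<psi> x * G x)"
      by simp
    note sq = minus_one_power_cancel
    from 1 have "integral {a..b} (\<lambda>x. (vderiv ^^ m) \<psi> x * w x) =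
       ?i * integral {a..b} (\<lambda>x. (vderiv ^^ m) \<eta> x * w x) - (- 1) ^ m * integral {a..b} (\<lambda>x. \<phi> x * g x)"
      by (simp add: algebra_simps)
    also have "\<dots> = (- 1) ^ m * (C * ?i + integral {a..b} (\<lambda>x. \<psi> x * G x))"
      unfolding 2 C_def by (simp add: algebra_simps sq)
    finally show "integral {a..b} (\<lambda>x. (vderiv ^^ m) \<psi> x * w x) = (- 1) ^ m * integral {a..b} (\<lambda>x. \<psi> x * (C + G x))"
      unfolding 3 .
  qed (use Suc.prems Ga ab in \<open>auto intro: set_integral_add\<close>)
  then obtain d where d: "jet_on a b m d" "d m = (\<lambda>x. C + G x)" "AE x in lebesgue_on {a<..<b}. w x = d 0 x"
    by blast
  have "primitive_on a b (\<lambda>x. C + G x) g" by (rule primitive_on_cong[OF G]) simp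
  then have "jet_on a b (Suc m) (d(Suc m := g))"
    using d by (auto simp: jet_on_def less_Suc_eq)
  then show ?case using d(3) by auto
qed

section \<open>The space of square integrable functions\<close>

lemma borel_measurable_cnj [measurable (raw)]:
  "f \<in> borel_measurable M \<Longrightarrow> (\<lambda>x. cnj (f x)) \<in> borel_measurable M"
  by (rule measurable_compose[OF _ borel_measurable_continuous_onI]) (auto intro!: continuous_intros)

lemma L2_measurable: "f \<in> L2 a b \<Longrightarrow> f \<in> borel_measurable (lebesgue_on {a<..<b})"
  by (simp add: L2_def)

lemma L2_integrable_square: "f \<in> L2 a b \<Longrightarrow> integrable (lebesgue_on {a<..<b}) (\<lambda>x. (cmod (f x))\<^sup>2)"
  by (simp add: L2_def)

text \<open>Because \<open>\<bar>f g\<bar> \<le> \<bar>f\<bar>\<^sup>2 + \<bar>g\<bar>\<^sup>2\<close>.\<close>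

lemma L2_integrable_mult:
  assumes "f \<in> L2 a b" "g \<in> L2 a b"
  shows "integrable (lebesgue_on {a<..<b}) (\<lambda>x. f x * cnj (g x))"
proof (rule Bochner_Integration.integrable_bound)
  show "integrable (lebesgue_on {a<..<b}) (\<lambda>x. (cmod (f x))\<^sup>2 + (cmod (g x))\<^sup>2)"
    using assms by (intro Bochner_Integration.integrable_add L2_integrable_square)
  note [measurable] = L2_measurable[OF assms(1)] L2_measurable[OF assms(2)]
  show "(\<lambda>x. f x * cnj (g x)) \<in> borel_measurable (lebesgue_on {a<..<b})"
    by measurable
  have "s * t \<le> s\<^sup>2 + t\<^sup>2" if "s \<ge> 0" "t \<ge> 0" for s t :: real
    using sum_squares_bound[of s t] mult_nonneg_nonneg[OF that] by linarith
  then show "AE x in lebesgue_on {a<..<b}. norm (f x * cnj (g x)) \<le> norm ((cmod (f x))\<^sup>2 + (cmod (g x))\<^sup>2)"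
    by (auto simp: norm_mult)
qed

lemma L2_continuous:
  assumes "continuous_on {a..b} f"
  shows "f \<in> L2 a b"
proof -
  have "f \<in> borel_measurable (lebesgue_on {a<..<b})"
    by (intro continuous_imp_measurable_on_sets_lebesgue continuous_on_subset[OF assms]) auto
  moreover have "(\<lambda>x. (cmod (f x))\<^sup>2) absolutely_integrable_on {a..b}"
    by (intro absolutely_integrable_continuous_real continuous_intros assms)
  then have "(\<lambda>x. (cmod (f x))\<^sup>2) absolutely_integrable_on {a<..<b}"
    by (simp only: absolutely_integrable_on_Icc_iff_Ioo)
  then have "integrable (lebesgue_on {a<..<b}) (\<lambda>x. (cmod (f x))\<^sup>2)"
    by (simp add: set_integrable_def integrable_restrict_space)
  ultimately show ?thesis by (simp add: L2_def)
qed

lemma L2_0: "(\<lambda>x. 0) \<in> L2 a b"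
  by (intro L2_continuous continuous_intros)

lemma L2_1: "(\<lambda>x. 1) \<in> L2 a b"
  by (intro L2_continuous continuous_intros)

text \<open>The interval is bounded, so the constant \<open>1\<close> is square integrable and can be paired with \<open>f\<close>.\<close>

lemma L2_absolutely_integrable:
  assumes "f \<in> L2 a b"
  shows "f absolutely_integrable_on {a..b}"
proof -
  have "integrable (lebesgue_on {a<..<b}) f"
    using L2_integrable_mult[OF assms L2_1] by simp
  then have "f absolutely_integrable_on {a<..<b}"
    by (simp add: set_integrable_def integrable_restrict_space)
  then show ?thesis by (simp add: absolutely_integrable_on_Icc_iff_Ioo)
qed

lemma L2_cmult: "f \<in> L2 a b \<Longrightarrow> (\<lambda>x. c * f x) \<in> L2 a b"
  by (auto simp: L2_def norm_mult power_mult_distrib)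

lemma L2_cnj: "f \<in> L2 a b \<Longrightarrow> (\<lambda>x. cnj (f x)) \<in> L2 a b"
  by (auto simp: L2_def)

lemma L2_add:
  assumes "f \<in> L2 a b" "g \<in> L2 a b"
  shows "(\<lambda>x. f x + g x) \<in> L2 a b"
proof -
  note [measurable] = L2_measurable[OF assms(1)] L2_measurable[OF assms(2)]
  have "integrable (lebesgue_on {a<..<b}) (\<lambda>x. (cmod (f x + g x))\<^sup>2)"
  proof (rule Bochner_Integration.integrable_bound)
    show "integrable (lebesgue_on {a<..<b}) (\<lambda>x. 2 * (cmod (f x))\<^sup>2 + 2 * (cmod (g x))\<^sup>2)"
      using assms by (intro Bochner_Integration.integrable_add integrable_mult_right L2_integrable_square)
    have "(cmod (z + w))\<^sup>2 \<le> 2 * (cmod z)\<^sup>2 + 2 * (cmod w)\<^sup>2" for z w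
    proof -
      have "(cmod (z + w))\<^sup>2 \<le> (cmod z + cmod w)\<^sup>2" by (intro power_mono norm_triangle_ineq) auto
      also have "\<dots> \<le> 2 * (cmod z)\<^sup>2 + 2 * (cmod w)\<^sup>2"
        using sum_squares_bound[of "cmod z" "cmod w"] by (simp add: power2_sum)
      finally show ?thesis .
    qed
    then show "AE x in lebesgue_on {a<..<b}. norm ((cmod (f x + g x))\<^sup>2) \<le> norm (2 * (cmod (f x))\<^sup>2 + 2 * (cmod (g x))\<^sup>2)"
      by auto
  qed measurable
  then show ?thesis by (simp add: L2_def)
qed

lemma L2_diff:
  assumes "f \<in> L2 a b" "g \<in> L2 a b"
  shows "(\<lambda>x. f x - g x) \<in> L2 a b"
  using L2_add[OF assms(1) L2_cmult[OF assms(2), of "-1"]] by simp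

lemma L2_cong_on:
  assumes "f \<in> L2 a b" "\<And>x. x \<in> {a<..<b} \<Longrightarrow> f x = g x"
  shows "g \<in> L2 a b"
proof -
  have "g \<in> borel_measurable (lebesgue_on {a<..<b})"
    using L2_measurable[OF assms(1)] assms(2) by (subst measurable_cong[of _ _ f]) auto
  moreover have "integrable (lebesgue_on {a<..<b}) (\<lambda>x. (cmod (g x))\<^sup>2)"
    using L2_integrable_square[OF assms(1)] assms(2) by (subst Bochner_Integration.integrable_cong[of _ _ _ "\<lambda>x. (cmod (f x))\<^sup>2"]) auto
  ultimately show ?thesis by (simp add: L2_def)
qed

lemma has_integral_L2_inner:
  assumes "f \<in> L2 a b" "g \<in> L2 a b"
  shows "((\<lambda>x. f x * cnj (g x)) has_integral L2_inner a b f g) {a..b}"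
proof -
  have "((\<lambda>x. f x * cnj (g x)) has_integral L2_inner a b f g) {a<..<b}"
    unfolding L2_inner_def by (rule has_integral_integral_lebesgue_on[OF L2_integrable_mult[OF assms]]) auto
  then show ?thesis by (simp add: has_integral_Icc_iff_Ioo)
qed

lemma L2_inner_linear_combination_left:
  assumes "f \<in> L2 a b" "g \<in> L2 a b" "h \<in> L2 a b"
  shows "L2_inner a b (\<lambda>x. f x + c * g x) h = L2_inner a b f h + c * L2_inner a b g h"
proof -
  have "((\<lambda>x. f x * cnj (h x) + c * (g x * cnj (h x))) has_integral L2_inner a b f h + c * L2_inner a b g h) {a..b}"
    using assms by (intro has_integral_add has_integral_mult_right has_integral_L2_inner)
  then show ?thesis
    using has_integral_L2_inner[OF L2_add[OF assms(1) L2_cmult[OF assms(2), of c]] assms(3)]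
    by (auto simp: distrib_right mult.assoc dest: has_integral_unique)
qed

lemma L2_inner_diff_left:
  assumes "f \<in> L2 a b" "g \<in> L2 a b" "h \<in> L2 a b"
  shows "L2_inner a b (\<lambda>x. f x - g x) h = L2_inner a b f h - L2_inner a b g h"
  using L2_inner_linear_combination_left[OF assms, of "-1"] by simp

lemma L2_inner_cnj: "L2_inner a b g f = cnj (L2_inner a b f g)"
  unfolding L2_inner_def by (subst Bochner_Integration.integral_cnj[symmetric]) (simp add: mult.commute)

lemma L2_inner_cmult_left: "L2_inner a b (\<lambda>x. c * f x) g = c * L2_inner a b f g"
  by (simp add: L2_inner_def mult.assoc)

lemma L2_inner_cmult_right: "L2_inner a b f (\<lambda>x. c * g x) = cnj c * L2_inner a b f g"
  by (metis L2_inner_cmult_left L2_inner_cnj complex_cnj_mult)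

lemma L2_inner_cong:
  assumes "L2_eq a b f f'" "L2_eq a b g g'" "f \<in> L2 a b" "f' \<in> L2 a b" "g \<in> L2 a b" "g' \<in> L2 a b"
  shows "L2_inner a b f g = L2_inner a b f' g'"
  unfolding L2_inner_def
proof (rule integral_cong_AE)
  note [measurable] = assms(3-6)[THEN L2_measurable]
  show "(\<lambda>x. f x * cnj (g x)) \<in> borel_measurable (lebesgue_on {a<..<b})"
     "(\<lambda>x. f' x * cnj (g' x)) \<in> borel_measurable (lebesgue_on {a<..<b})" by (measurable, measurable)
  show "AE x in lebesgue_on {a<..<b}. f x * cnj (g x) = f' x * cnj (g' x)"
    using assms(1,2) unfolding L2_eq_def by eventually_elim simp
qed

lemma L2_eq_sym: "L2_eq a b f g \<Longrightarrow> L2_eq a b g f"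
  unfolding L2_eq_def by (rule eventually_mono) auto

lemma L2_eq_refl [simp]: "L2_eq a b f f"
  by (simp add: L2_eq_def)

lemma L2_eq_trans:
  assumes "L2_eq a b f g" "L2_eq a b g h" shows "L2_eq a b f h"
  using assms unfolding L2_eq_def by eventually_elim simp

lemma L2_eq_cmult: "L2_eq a b f g \<Longrightarrow> L2_eq a b (\<lambda>x. c * f x) (\<lambda>x. c * g x)"
  unfolding L2_eq_def by (rule eventually_mono) auto

lemma L2_norm_nonneg [simp]: "0 \<le> L2_norm a b f"
  by (simp add: L2_norm_def)

lemma L2_inner_self: "L2_inner a b f f = complex_of_real ((L2_norm a b f)\<^sup>2)"
proof -
  have "L2_inner a b f f = integral\<^sup>L (lebesgue_on {a<..<b}) (\<lambda>x. complex_of_real ((cmod (f x))\<^sup>2))"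
    unfolding L2_inner_def by (simp only: complex_norm_square)
  then show ?thesis
    by (simp only: integral_complex_of_real) (simp only: L2_norm_def real_sqrt_pow2 integral_nonneg_AE zero_le_power2 AE_I2)
qed

lemma L2_Cauchy_Schwarz:
  assumes "f \<in> L2 a b" "g \<in> L2 a b"
  shows "cmod (L2_inner a b f g) \<le> L2_norm a b f * L2_norm a b g"
proof -
  let ?M = "lebesgue_on {a<..<b}"
  note [measurable] = L2_measurable[OF assms(1)] L2_measurable[OF assms(2)]
  have fg: "integrable ?M (\<lambda>x. cmod (f x) * cmod (g x))"
    using integrable_norm[OF L2_integrable_mult[OF assms]] by (simp add: norm_mult)
  have sq: "(\<integral>\<^sup>+x. (ennreal (cmod (h x)))\<^sup>2 \<partial>?M) = ennreal ((L2_norm a b h)\<^sup>2)" if "h \<in> L2 a b" for h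
    using nn_integral_eq_integral[OF L2_integrable_square[OF that]] by (simp add: L2_norm_def ennreal_power)
  have "(\<integral>\<^sup>+x. ennreal (cmod (f x)) * ennreal (cmod (g x)) \<partial>?M)\<^sup>2 \<le>
     (\<integral>\<^sup>+x. (ennreal (cmod (f x)))\<^sup>2 \<partial>?M) * (\<integral>\<^sup>+x. (ennreal (cmod (g x)))\<^sup>2 \<partial>?M)"
    using L2_measurable[OF assms(1)] L2_measurable[OF assms(2)] by (intro Cauchy_Schwarz_nn_integral) simp_all
  also have "(\<integral>\<^sup>+x. ennreal (cmod (f x)) * ennreal (cmod (g x)) \<partial>?M) = ennreal (\<integral>x. cmod (f x) * cmod (g x) \<partial>?M)"
    using nn_integral_eq_integral[OF fg] by (simp add: ennreal_mult)
  finally have "(\<integral>x. cmod (f x) * cmod (g x) \<partial>?M)\<^sup>2 \<le> (L2_norm a b f * L2_norm a b g)\<^sup>2"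
    by (simp only: sq assms) (simp add: ennreal_power power_mult_distrib flip: ennreal_mult)
  then have "(\<integral>x. cmod (f x) * cmod (g x) \<partial>?M) \<le> L2_norm a b f * L2_norm a b g"
    by (rule power2_le_imp_le) simp
  moreover have "cmod (L2_inner a b f g) \<le> (\<integral>x. cmod (f x * cnj (g x)) \<partial>?M)"
    unfolding L2_inner_def by (rule integral_norm_bound)
  ultimately show ?thesis by (simp add: norm_mult)
qed

text \<open>The top derivative of a Sobolev jet is square integrable and the others are continuous, so all of
  them are absolutely integrable and the jet consists of primitives in the sense above.\<close>

lemma sobolev_jet_iff:
  "sobolev_jet a b m f d \<longleftrightarrow> f \<in> L2 a b \<and> d m \<in> L2 a b \<and> L2_eq a b f (d 0) \<and> jet_on a b m d"
proof -
  have "primitive_on a b (d j) (d (Suc j))"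
    if "\<forall>j<m. \<forall>x\<in>{a..b}. (d (Suc j) has_integral (d j x - d j a)) {a..x}" "d m \<in> L2 a b" "j < m" for j
  proof -
    have "d (Suc j) absolutely_integrable_on {a..b}"
    proof (cases "Suc j = m")
      case True
      then show ?thesis using that by (simp add: L2_absolutely_integrable)
    next
      case False
      then have "continuous_on {a..b} (d (Suc j))"
        using that by (intro continuous_on_if_has_integral[of _ _ "d (Suc (Suc j))"]) auto
      then show ?thesis by (rule absolutely_integrable_continuous_real)
    qed
    then show ?thesis using that by (simp add: primitive_on_def)
  qed
  then show ?thesis
    unfolding sobolev_jet_def jet_on_def by (auto simp: primitive_on_def)
qed

lemma sobolev_jet_linear_combination:
  assumes "sobolev_jet a b m f d" "sobolev_jet a b m g e"
  shows "sobolev_jet a b m (\<lambda>x. f x + c * g x) (\<lambda>j x. d j x + c * e j x)"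
  using assms unfolding sobolev_jet_iff
  by (auto intro: L2_add L2_cmult jet_on_linear_combination simp: L2_eq_def elim: eventually_elim2)

lemma sobolev_deriv_eq:
  assumes jet: "sobolev_jet a b m f d" and ab: "a < b"
  shows "\<And>j x. j < m \<Longrightarrow> x \<in> {a..b} \<Longrightarrow> sobolev_deriv a b m f j x = d j x"
    and "L2_eq a b (sobolev_deriv a b m f m) (d m)"
proof -
  have jet': "sobolev_jet a b m f (sobolev_deriv a b m f)"
    unfolding sobolev_deriv_def by (rule someI[of "sobolev_jet a b m f", OF jet])
  have "L2_eq a b (sobolev_deriv a b m f 0) (d 0)"
    using jet jet' L2_eq_trans L2_eq_sym unfolding sobolev_jet_iff by blast
  then show "\<And>j x. j < m \<Longrightarrow> x \<in> {a..b} \<Longrightarrow> sobolev_deriv a b m f j x = d j x"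
    and "L2_eq a b (sobolev_deriv a b m f m) (d m)"
    using jet_on_unique[of a b m "sobolev_deriv a b m f" d] jet jet' ab
    unfolding sobolev_jet_iff L2_eq_def by blast+
qed

lemma sobolev_jet_sobolev_deriv:
  "f \<in> sobolev_space a b m \<Longrightarrow> sobolev_jet a b m f (sobolev_deriv a b m f)"
  using someI_ex[of "sobolev_jet a b m f"] by (simp add: sobolev_space_def sobolev_deriv_def)

section \<open>The initial value problem\<close>

text \<open>The \<open>k\<close>-fold primitive of \<open>h\<close> based at \<open>a\<close>; the constant added by the integration number \<open>k\<close> is
  \<open>y k\<close>.\<close>

primrec iterated_integral :: "real \<Rightarrow> (nat \<Rightarrow> complex) \<Rightarrow> (real \<Rightarrow> complex) \<Rightarrow> nat \<Rightarrow> real \<Rightarrow> complex" where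
  "iterated_integral a y h 0 = h"
| "iterated_integral a y h (Suc k) = (\<lambda>x. y k + integral {a..x} (iterated_integral a y h k))"

lemma iterated_integral_absolutely_integrable:
  assumes "h absolutely_integrable_on {a..b}"
  shows "iterated_integral a y h k absolutely_integrable_on {a..b}"
proof (induction k)
  case (Suc k)
  from primitive_on_continuous[OF primitive_on_integral[OF this]] show ?case
    by (auto intro: absolutely_integrable_continuous_real)
qed (use assms in auto)

lemma primitive_on_iterated_integral:
  assumes "h absolutely_integrable_on {a..b}"
  shows "primitive_on a b (iterated_integral a y h (Suc k)) (iterated_integral a y h k)"
  using primitive_on_integral[OF iterated_integral_absolutely_integrable[OF assms]] by simp

lemma iterated_integral_integrable:
  assumes "h absolutely_integrable_on {a..b}" "x \<in> {a..b}"
  shows "iterated_integral a y h k integrable_on {a..x}"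
  using iterated_integral_absolutely_integrable[OF assms(1)] assms(2) set_lebesgue_integral_eq_integral(1)
    integrable_subinterval_real[of "iterated_integral a y h k" a b a x] by auto

lemma iterated_integral_linear_combination:
  assumes "g absolutely_integrable_on {a..b}" "f absolutely_integrable_on {a..b}" "x \<in> {a..b}"
  shows "iterated_integral a (\<lambda>k. y k + c * z k) (\<lambda>x. g x + c * f x) k x = iterated_integral a y g k x + c * iterated_integral a z f k x"
  using assms(3)
proof (induction k arbitrary: x)
  case (Suc k)
  have "integral {a..x} (iterated_integral a (\<lambda>k. y k + c * z k) (\<lambda>x. g x + c * f x) k) =
    integral {a..x} (\<lambda>x. iterated_integral a y g k x + c * iterated_integral a z f k x)"
    using Suc by (intro Henstock_Kurzweil_Integration.integral_cong) auto
  also have "\<dots> = integral {a..x} (iterated_integral a y g k) + c * integral {a..x} (iterated_integral a z f k)"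
    using Suc assms by (intro integral_linear_combination iterated_integral_integrable) auto
  finally show ?case by (simp add: algebra_simps)
qed simp

lemma power_over_fact_has_real_derivative:
  "((\<lambda>t. C * (t - a) ^ Suc n / fact (Suc n)) has_real_derivative C * (t - a) ^ n / fact n) (at t within S)"
proof -
  have 1: "((\<lambda>t. t - a) has_real_derivative 1) (at t within S)"
    by (auto intro!: derivative_eq_intros)
  have 2: "((\<lambda>t. C / fact (Suc n) * (t - a) ^ Suc n) has_real_derivative C / fact (Suc n) * ((1 + of_nat n) * (1 * (t - a) ^ n))) (at t within S)"
    by (rule DERIV_cmult[OF DERIV_power_Suc[OF 1]])
  have "C / fact (Suc n) * ((1 + of_nat n) * (1 * (t - a) ^ n)) = C * (t - a) ^ n / fact n"
    by (simp add: divide_simps)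
  then show ?thesis using 2 by (simp only: times_divide_eq_left)
qed

lemma iterated_integral_bound:
  assumes "continuous_on {a..b} f" and "\<And>x. x \<in> {a..b} \<Longrightarrow> norm (f x) \<le> C * (x - a) ^ p / fact p" and "x \<in> {a..b}"
  shows "norm (iterated_integral a (\<lambda>_. 0) f k x) \<le> C * (x - a) ^ (p + k) / fact (p + k)"
  using assms(3)
proof (induction k arbitrary: x)
  case (Suc k)
  have f: "f absolutely_integrable_on {a..b}" using assms(1) by (rule absolutely_integrable_continuous_real)
  have "((\<lambda>t. C * (t - a) ^ Suc (p + k) / fact (Suc (p + k))) has_real_derivative C * (t - a) ^ (p + k) / fact (p + k)) (at t within {a..x})" for t
    by (rule power_over_fact_has_real_derivative)
  then have "((\<lambda>t. C * (t - a) ^ (p + k) / fact (p + k)) has_integral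
     (C * (x - a) ^ Suc (p + k) / fact (Suc (p + k)) - C * (a - a) ^ Suc (p + k) / fact (Suc (p + k)))) {a..x}"
    using Suc.prems by (intro fundamental_theorem_of_calculus) (auto simp: has_real_derivative_iff_has_vector_derivative)
  then have 1: "((\<lambda>t. C * (t - a) ^ (p + k) / fact (p + k)) has_integral (C * (x - a) ^ Suc (p + k) / fact (Suc (p + k)))) {a..x}"
    by simp
  have 2: "(iterated_integral a (\<lambda>_. 0) f k has_integral iterated_integral a (\<lambda>_. 0) f (Suc k) x) {a..x}"
    using iterated_integral_integrable[OF f Suc.prems] by (simp add: has_integral_integral)
  have "norm (iterated_integral a (\<lambda>_. 0) f (Suc k) x) \<le> C * (x - a) ^ Suc (p + k) / fact (Suc (p + k))"
    by (rule has_integral_le_norm[OF 2 1]) (use Suc in auto)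
  then show ?case by simp
qed (use assms in auto)

lemma iterated_integral_continuous:
  assumes "continuous_on {a..b} f"
  shows "continuous_on {a..b} (iterated_integral a y f k)"
proof (cases k)
  case (Suc l)
  then show ?thesis
    using primitive_on_continuous[OF primitive_on_iterated_integral[OF absolutely_integrable_continuous_real[OF assms]]] by blast
qed (use assms in auto)

text \<open>The \<open>m\<close>-fold integration operator \<open>J\<close> satisfies \<open>\<bar>J\<^sup>N f\<bar> \<le> C (x - a)\<^sup>m\<^sup>N / (m N)!\<close>, so the Picard
  iterates \<open>s (N + 1) = F + c J (s N)\<close> converge uniformly by comparison with the exponential series,
  whatever the size of \<open>c\<close>.\<close>

lemma volterra_equation_solvable:
  assumes F: "continuous_on {a..b} F" and "m \<ge> 1"
  obtains f where "continuous_on {a..b} f" "\<And>x. x \<in> {a..b} \<Longrightarrow> f x = F x + c * iterated_integral a (\<lambda>_. 0) f m x"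
proof -
  let ?J = "\<lambda>f. iterated_integral a (\<lambda>_. 0) f m"
  \<comment> \<open>The Picard iterates, starting from \<open>0\<close>; increments satisfy \<open>s (N + 2) - s (N + 1) = c J (s (N + 1) - s N)\<close>.\<close>
  define s where "s = rec_nat (\<lambda>x. 0) (\<lambda>_ g x. F x + c * ?J g x)"
  have s: "s 0 = (\<lambda>x. 0)" "s (Suc N) = (\<lambda>x. F x + c * ?J (s N) x)" for N by (simp_all add: s_def)
  have cont: "continuous_on {a..b} (s N)" for N
    by (induction N) (auto simp: s intro!: continuous_intros F iterated_integral_continuous)
  have Jdiff: "?J g x - ?J f x = ?J (\<lambda>x. g x - f x) x" if "continuous_on {a..b} f" "continuous_on {a..b} g" "x \<in> {a..b}" for f g x
    using iterated_integral_linear_combination[of a b g f x "\<lambda>_. 0" "- 1" "\<lambda>_. 0" m] that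
    by (simp add: absolutely_integrable_continuous_real)
  obtain C where C: "\<And>x. x \<in> {a..b} \<Longrightarrow> norm (s 1 x - s 0 x) \<le> C" "C > 0"
  proof -
    have "bounded ((\<lambda>x. s 1 x - s 0 x) ` {a..b})"
      by (intro compact_imp_bounded compact_continuous_image continuous_intros cont) auto
    then show ?thesis using that unfolding bounded_pos by fastforce
  qed
  have bound: "norm (s (Suc N) x - s N x) \<le> (C * norm c ^ N) * (x - a) ^ (N * m) / fact (N * m)" if "x \<in> {a..b}" for N x
    using that
  proof (induction N arbitrary: x)
    case 0
    then show ?case using C by simp
  next
    case (Suc N)
    have "s (Suc (Suc N)) x - s (Suc N) x = c * (?J (s (Suc N)) x - ?J (s N) x)"
      by (simp add: s(2)[of "Suc N"] s(2)[of N] algebra_simps)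
    also have "\<dots> = c * ?J (\<lambda>x. s (Suc N) x - s N x) x"
      using Jdiff[OF cont cont Suc.prems] by simp
    finally have "norm (s (Suc (Suc N)) x - s (Suc N) x) = norm c * norm (?J (\<lambda>x. s (Suc N) x - s N x) x)"
      by (simp add: norm_mult)
    also have "\<dots> \<le> norm c * ((C * norm c ^ N) * (x - a) ^ (N * m + m) / fact (N * m + m))"
      by (intro mult_left_mono iterated_integral_bound[of a b] continuous_intros cont Suc) auto
    finally show ?case by (simp add: algebra_simps)
  qed
  define M where "M N = C * ((norm c * (b - a) ^ m) ^ N / fact N)" for N :: nat
  have "norm (s (Suc N) x - s N x) \<le> M N" if "x \<in> {a..b}" for N x
  proof -
    have "norm (s (Suc N) x - s N x) \<le> (C * norm c ^ N) * (x - a) ^ (N * m) / fact (N * m)"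
      by (rule bound[OF that])
    also have "\<dots> \<le> (C * norm c ^ N) * (b - a) ^ (N * m) / fact N"
      using that C(2) \<open>m \<ge> 1\<close> by (intro frac_le mult_left_mono power_mono fact_mono mult_nonneg_nonneg) auto
    also have "\<dots> = M N" by (simp add: M_def power_mult_distrib power_mult[symmetric] mult.commute)
    finally show ?thesis .
  qed
  moreover have "summable M"
    unfolding M_def by (intro summable_mult) (use summable_exp_generic[of "norm c * (b - a) ^ m"] in \<open>simp add: divide_inverse_commute\<close>)
  ultimately have "uniform_limit {a..b} (\<lambda>N x. \<Sum>i<N. s (Suc i) x - s i x) (\<lambda>x. suminf (\<lambda>i. s (Suc i) x - s i x)) sequentially"
    by (rule Weierstrass_m_test)
  then obtain f where lim: "uniform_limit {a..b} s f sequentially"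
    by (auto simp: sum_lessThan_telescope[of "\<lambda>i. s i _"] s(1))
  have f: "continuous_on {a..b} f"
    by (rule uniform_limit_theorem[OF _ lim]) (auto simp: cont)
  have "f x = F x + c * ?J f x" if x: "x \<in> {a..b}" for x
  proof -
    have "(\<lambda>N. ?J (s N) x) \<longlonglongrightarrow> ?J f x"
    proof (rule metric_LIMSEQ_I)
      fix e :: real assume "e > 0"
      \<comment> \<open>\<open>J\<close> multiplies the uniform norm by at most \<open>(x - a)\<^sup>m / m!\<close>; the summand \<open>1\<close> makes \<open>K\<close> positive also at \<open>x = a\<close>.\<close>
      define K where "K = (x - a) ^ m / fact m + 1"
      have K: "K > 0" using x unfolding K_def by (intro add_nonneg_pos divide_nonneg_pos) auto
      have "\<forall>\<^sub>F N in sequentially. \<forall>x\<in>{a..b}. dist (s N x) (f x) < e / K"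
        using lim K \<open>e > 0\<close> by (auto simp: uniform_limit_iff)
      then obtain N0 where N0: "\<And>N x. N \<ge> N0 \<Longrightarrow> x \<in> {a..b} \<Longrightarrow> dist (s N x) (f x) < e / K"
        unfolding eventually_sequentially by blast
      have "dist (?J (s N) x) (?J f x) < e" if "N \<ge> N0" for N
      proof -
        have "dist (?J (s N) x) (?J f x) = norm (?J (\<lambda>x. s N x - f x) x)"
          by (simp add: dist_norm Jdiff[OF f cont x])
        also have "\<dots> \<le> (e / K) * (x - a) ^ (0 + m) / fact (0 + m)"
          using N0[OF that] by (intro iterated_integral_bound[of a b] continuous_intros f cont x) (auto simp: dist_norm less_imp_le)
        also have "\<dots> < (e / K) * K"
        proof -
          have "(x - a) ^ m / fact m < K" by (simp add: K_def)
          from mult_strict_left_mono[OF this, of "e / K"] show ?thesis using K \<open>e > 0\<close> by simp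
        qed
        finally show ?thesis using K by simp
      qed
      then show "\<exists>N0. \<forall>N\<ge>N0. dist (?J (s N) x) (?J f x) < e" by blast
    qed
    then have "(\<lambda>N. F x + c * ?J (s N) x) \<longlonglongrightarrow> F x + c * ?J f x" by (intro tendsto_intros)
    moreover have "(\<lambda>N. s (Suc N) x) \<longlonglongrightarrow> f x"
      by (rule LIMSEQ_Suc[OF tendsto_uniform_limitI[OF lim x]])
    ultimately show ?thesis by (intro LIMSEQ_unique[of "\<lambda>N. s (Suc N) x"]) (simp_all add: s)
  qed
  then show ?thesis using f that by blast
qed

lemma jet_with_top_derivative:
  assumes h: "h absolutely_integrable_on {a..b}"
  obtains d where "jet_on a b m d" "d m = h" "\<And>j. j < m \<Longrightarrow> d j a = y j"
    "d 0 = iterated_integral a (\<lambda>k. y (m - 1 - k)) h m"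
proof -
  define d where "d j = iterated_integral a (\<lambda>k. y (m - 1 - k)) h (m - j)" for j
  have "jet_on a b m d"
    unfolding jet_on_def
  proof (intro allI impI)
    fix j assume "j < m"
    then have "m - j = Suc (m - Suc j)" by simp
    then show "primitive_on a b (d j) (d (Suc j))"
      unfolding d_def using primitive_on_iterated_integral[OF h] by metis
  qed
  moreover have "d j a = y j" if "j < m" for j
  proof -
    have "m - j = Suc (m - Suc j)" "m - 1 - (m - Suc j) = j" using that by auto
    then show ?thesis by (simp add: d_def)
  qed
  ultimately show ?thesis by (intro that[of d]) (auto simp: d_def)
qed

text \<open>If the top derivative is \<open>g + c f\<close>, then the function itself is the \<open>m\<close>-fold primitive of \<open>g + c f\<close>
  with the given initial values. Requiring that it equals \<open>f\<close> is a Volterra equation for \<open>f\<close>.\<close>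

lemma cauchy_problem_solvable:
  assumes g: "g absolutely_integrable_on {a..b}" and "m \<ge> 1"
  obtains d where "jet_on a b m d" "\<And>x. x \<in> {a..b} \<Longrightarrow> d m x = c * d 0 x + g x" "\<And>j. j < m \<Longrightarrow> d j a = y j"
proof -
  let ?y = "\<lambda>k. y (m - 1 - k)"
  obtain m' where m': "m = Suc m'" using \<open>m \<ge> 1\<close> by (cases m) auto
  have "continuous_on {a..b} (iterated_integral a ?y g m)"
    unfolding m' using primitive_on_continuous[OF primitive_on_iterated_integral[OF g]] by blast
  from volterra_equation_solvable[OF this \<open>m \<ge> 1\<close>, of c] obtain f where
    f: "continuous_on {a..b} f" "\<And>x. x \<in> {a..b} \<Longrightarrow> f x = iterated_integral a ?y g m x + c * iterated_integral a (\<lambda>_. 0) f m x"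
    by blast
  have fa: "f absolutely_integrable_on {a..b}" using f(1) by (rule absolutely_integrable_continuous_real)
  have h: "(\<lambda>x. g x + c * f x) absolutely_integrable_on {a..b}"
    by (intro set_integral_add set_integrable_mult_right g fa)
  obtain d where d: "jet_on a b m d" "d m = (\<lambda>x. g x + c * f x)" "\<And>j. j < m \<Longrightarrow> d j a = y j"
    "d 0 = iterated_integral a ?y (\<lambda>x. g x + c * f x) m"
    using jet_with_top_derivative[OF h] by blast
  have "d 0 x = f x" if "x \<in> {a..b}" for x
    using iterated_integral_linear_combination[OF g fa that, of ?y c "\<lambda>_. 0" m] f(2)[OF that] by (simp add: d)
  then show ?thesis using d by (intro that[of d]) (auto simp: d(2))
qed

section \<open>Linear systems\<close>

notation vec_index (infixl "$v" 90)

lemma mat_inverse_if_kernel_trivial: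
  fixes A :: "complex mat"
  assumes A: "A \<in> carrier_mat n n"
    and ker: "\<And>v. v \<in> carrier_vec n \<Longrightarrow> A *\<^sub>v v = 0\<^sub>v n \<Longrightarrow> v = 0\<^sub>v n"
  shows "\<exists>B\<in>carrier_mat n n. mat_inverse A = Some B \<and> B * A = 1\<^sub>m n \<and> A * B = 1\<^sub>m n"
proof -
  have "Determinant.det A \<noteq> 0"
    using det_0_iff_vec_prod_zero[OF A] ker by blast
  from det_non_zero_imp_unit[OF A this] have "mat_inverse A \<noteq> None"
    using mat_inverse(1)[OF A] by fastforce
  then obtain B where "mat_inverse A = Some B" by blast
  then show ?thesis using mat_inverse(2)[OF A] by blast
qed

text \<open>Uniqueness implies existence for square systems; this turns the uniqueness results for boundary
  value problems into solvability.\<close>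

lemma linear_system_solvable:
  fixes M :: "nat \<Rightarrow> nat \<Rightarrow> complex"
  assumes "\<And>c. (\<And>i. i < n \<Longrightarrow> (\<Sum>k<n. M i k * c k) = 0) \<Longrightarrow> \<forall>k<n. c k = 0"
  shows "\<exists>c. \<forall>i<n. (\<Sum>k<n. M i k * c k) = y i"
proof -
  define A where "A = Matrix.mat n n (\<lambda>(i, k). M i k)"
  have A: "A \<in> carrier_mat n n" by (simp add: A_def)
  have Av: "(A *\<^sub>v v) $v i = (\<Sum>k<n. M i k * v $v k)" if "v \<in> carrier_vec n" "i < n" for v i
    using that by (simp add: A_def scalar_prod_def lessThan_atLeast0)
  have "v = 0\<^sub>v n" if v: "v \<in> carrier_vec n" "A *\<^sub>v v = 0\<^sub>v n" for v
  proof -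
    have "(\<Sum>k<n. M i k * v $v k) = 0" if "i < n" for i
      using Av[OF v(1) that] v that by simp
    then have "\<forall>k<n. v $v k = 0" by (rule assms)
    then show ?thesis using v(1) by (intro eq_vecI) auto
  qed
  then obtain B where B: "B \<in> carrier_mat n n" "A * B = 1\<^sub>m n"
    using mat_inverse_if_kernel_trivial[OF A] by blast
  define w where "w = B *\<^sub>v Matrix.vec n y"
  have w: "w \<in> carrier_vec n" using B by (simp add: w_def)
  have "A *\<^sub>v w = Matrix.vec n y"
    unfolding w_def by (subst assoc_mult_mat_vec[symmetric, OF A B(1)]) (auto simp: B)
  then have "(\<Sum>k<n. M i k * w $v k) = y i" if "i < n" for i
    using Av[OF w that] that by simp
  then show ?thesis by blast
qed

lemma cscalar_prod_eq_sum:
  fixes v w :: "complex Matrix.vec"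
  assumes "v \<in> carrier_vec m" "w \<in> carrier_vec m"
  shows "v \<bullet>c w = (\<Sum>i<m. v $v i * cnj (w $v i))"
  using assms by (simp add: scalar_prod_def lessThan_atLeast0)

lemma cscalar_prod_unit_vec:
  fixes v :: "complex Matrix.vec"
  assumes "v \<in> carrier_vec m" "i < m"
  shows "v \<bullet>c unit_vec m i = v $v i"
proof -
  have "v \<bullet>c unit_vec m i = (\<Sum>j<m. v $v j * cnj (unit_vec m i $v j))"
    using assms by (simp add: cscalar_prod_eq_sum[of _ m])
  also have "\<dots> = (\<Sum>j<m. if j = i then v $v j else 0)"
    by (intro sum.cong) (auto simp: unit_vec_def)
  finally show ?thesis using assms by simp
qed

section \<open>The Dirichlet problem\<close>

lemma has_integral_cmod_square:
  assumes "continuous_on {a..b} (f :: real \<Rightarrow> complex)"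
  shows "((\<lambda>x. f x * cnj (f x)) has_integral complex_of_real (integral {a..b} (\<lambda>x. (cmod (f x))\<^sup>2))) {a..b}"
proof -
  have "((\<lambda>x. (cmod (f x))\<^sup>2) has_integral integral {a..b} (\<lambda>x. (cmod (f x))\<^sup>2)) {a..b}"
    by (intro integrable_integral integrable_continuous_real continuous_intros assms)
  from has_integral_linear[OF this bounded_linear_of_real[where 'a = complex]] show ?thesis
    by (simp only: o_def complex_norm_square)
qed

lemma dirichlet_form:
  assumes d: "jet_on a b (2 * n) d" and "a \<le> b" "n \<ge> 1"
    and bc: "\<And>j. j < n \<Longrightarrow> d j a = 0" "\<And>j. j < n \<Longrightarrow> d j b = 0"
  shows "integral {a..b} (\<lambda>x. d (2 * n) x * cnj (d 0 x)) =
     (- 1) ^ n * complex_of_real (integral {a..b} (\<lambda>x. (cmod (d n x))\<^sup>2))"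
proof -
  have "continuous_on {a..b} (d n)" using d \<open>n \<ge> 1\<close> by (intro jet_on_continuous) auto
  from integral_unique[OF has_integral_cmod_square[OF this]]
  have "integral {a..b} (\<lambda>x. d (2 * n - n) x * cnj (d n x)) = complex_of_real (integral {a..b} (\<lambda>x. (cmod (d n x))\<^sup>2))"
    by simp
  then show ?thesis
    using jets_integration_by_parts[OF d jet_on_cnj[OF d] \<open>a \<le> b\<close>, of n] \<open>n \<ge> 1\<close> bc by simp
qed

text \<open>For a solution with zero boundary values the Dirichlet form gives
  \<open>\<parallel>d n\<parallel>\<^sup>2 = c \<parallel>d 0\<parallel>\<^sup>2\<close>. Since \<open>c \<le> 0\<close>, the \<open>n\<close>-th derivative vanishes, and integrating from \<open>a\<close>, where the
  lower derivatives vanish, so does the function. The value \<open>c = 0\<close> is included on purpose: it is the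
  case of polynomials.\<close>

lemma dirichlet_problem_unique:
  assumes d: "jet_on a b (2 * n) d" and "a < b" "n \<ge> 1" "c \<le> (0::real)"
    and eq: "\<And>x. x \<in> {a..b} \<Longrightarrow> d (2 * n) x = (- 1) ^ n * complex_of_real c * d 0 x"
    and bc: "\<And>j. j < n \<Longrightarrow> d j a = 0" "\<And>j. j < n \<Longrightarrow> d j b = 0"
    and "j < 2 * n" "x \<in> {a..b}"
  shows "d j x = 0"
proof -
  have cont: "continuous_on {a..b} (d j)" if "j < 2 * n" for j using d that by (rule jet_on_continuous)
  have c0: "continuous_on {a..b} (d 0)" and cn: "continuous_on {a..b} (d n)" using cont \<open>n \<ge> 1\<close> by auto
  have "((\<lambda>x. (- 1) ^ n * complex_of_real c * (d 0 x * cnj (d 0 x))) has_integral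
      (- 1) ^ n * complex_of_real c * complex_of_real (integral {a..b} (\<lambda>x. (cmod (d 0 x))\<^sup>2))) {a..b}"
    by (intro has_integral_mult_right has_integral_cmod_square c0)
  then have "((\<lambda>x. d (2 * n) x * cnj (d 0 x)) has_integral
      (- 1) ^ n * complex_of_real c * complex_of_real (integral {a..b} (\<lambda>x. (cmod (d 0 x))\<^sup>2))) {a..b}"
    by (rule has_integral_eq[rotated]) (simp add: eq mult.assoc)
  from integral_unique[OF this] dirichlet_form[OF d _ \<open>n \<ge> 1\<close> bc] \<open>a < b\<close>
  have "complex_of_real c * complex_of_real (integral {a..b} (\<lambda>x. (cmod (d 0 x))\<^sup>2)) =
     complex_of_real (integral {a..b} (\<lambda>x. (cmod (d n x))\<^sup>2))" by simp
  then have "integral {a..b} (\<lambda>x. (cmod (d n x))\<^sup>2) = c * integral {a..b} (\<lambda>x. (cmod (d 0 x))\<^sup>2)"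
    by (metis of_real_eq_iff of_real_mult)
  moreover have "integral {a..b} (\<lambda>x. (cmod (d 0 x))\<^sup>2) \<ge> 0" "integral {a..b} (\<lambda>x. (cmod (d n x))\<^sup>2) \<ge> 0"
    by (intro integral_nonneg integrable_continuous_real continuous_intros c0 cn; simp)+
  ultimately have "integral {a..b} (\<lambda>x. (cmod (d n x))\<^sup>2) = 0"
    using mult_nonpos_nonneg[OF \<open>c \<le> 0\<close>] by (metis order_antisym)
  moreover have cn2: "continuous_on {a..b} (\<lambda>x. (cmod (d n x))\<^sup>2)" by (intro continuous_intros cn)
  ultimately have "((\<lambda>x. (cmod (d n x))\<^sup>2) has_integral 0) {a..b}"
    using integrable_integral[OF integrable_continuous_real[OF cn2]] by simp
  then have dn: "d n x = 0" if "x \<in> {a..b}" for x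
    using has_integral_0_cbox_imp_0[of a b "\<lambda>x. (cmod (d n x))\<^sup>2" x] cn2 \<open>a < b\<close> that by auto
  \<comment> \<open>Descend from order \<open>n\<close> to order \<open>0\<close>.\<close>
  have d0: "d (n - k) x = 0" if "x \<in> {a..b}" "k \<le> n" for k x
    using that
  proof (induction k arbitrary: x)
    case (Suc k)
    have S: "n - k = Suc (n - Suc k)" using Suc by simp
    have "primitive_on a b (d (n - Suc k)) (d (n - k))"
      using d Suc.prems unfolding S jet_on_def by auto
    then have "(d (n - k) has_integral (d (n - Suc k) x - d (n - Suc k) a)) {a..x}"
      using Suc.prems by (simp add: primitive_on_def)
    moreover have "(d (n - k) has_integral 0) {a..x}"
      by (rule has_integral_is_0) (use Suc in auto)
    ultimately show ?case using bc(1)[of "n - Suc k"] Suc.prems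
      by (auto dest: has_integral_unique)
  qed (simp add: dn)
  have "AE x in lebesgue_on {a<..<b}. d 0 x = 0"
    using d0[of _ n] by (intro AE_I2) simp
  moreover have "jet_on a b (2 * n) (\<lambda>j x. 0)" by (simp add: jet_on_def primitive_on_0)
  ultimately show ?thesis
    using jet_on_unique(1)[OF d _ \<open>a < b\<close> _ \<open>j < 2 * n\<close> \<open>x \<in> {a..b}\<close>] by blast
qed

text \<open>Start with a solution \<open>p\<close> of the inhomogeneous equation that has the right data at \<open>a\<close>, and add a
  combination of the \<open>n\<close> solutions \<open>e k\<close> of the homogeneous equation whose only non-zero initial value
  at \<open>a\<close> is the \<open>(n + k)\<close>-th derivative. Matching the data at \<open>b\<close> is a square linear system for the
  coefficients, and a solution of the homogeneous system is a solution of the homogeneous Dirichlet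
  problem.\<close>

lemma dirichlet_problem_solvable:
  assumes h: "h absolutely_integrable_on {a..b}" and "a < b" "n \<ge> 1" "c \<le> (0::real)"
  shows "\<exists>d. jet_on a b (2 * n) d \<and>
    (\<forall>x\<in>{a..b}. d (2 * n) x = (- 1) ^ n * (complex_of_real c * d 0 x + h x)) \<and>
    (\<forall>j<n. d j a = \<alpha> j \<and> d j b = \<beta> j)"
proof -
  let ?c = "(- 1) ^ n * complex_of_real c"
  have n2: "2 * n \<ge> 1" using \<open>n \<ge> 1\<close> by simp
  have ends: "a \<in> {a..b}" "b \<in> {a..b}" using \<open>a < b\<close> by auto
  have "(\<lambda>x. (- 1) ^ n * h x) absolutely_integrable_on {a..b}" using h by (rule set_integrable_mult_right)
  from cauchy_problem_solvable[OF this n2, of ?c "\<lambda>j. if j < n then \<alpha> j else 0"]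
  obtain p where p: "jet_on a b (2 * n) p" "\<And>x. x \<in> {a..b} \<Longrightarrow> p (2 * n) x = ?c * p 0 x + (- 1) ^ n * h x"
    "\<And>j. j < 2 * n \<Longrightarrow> p j a = (if j < n then \<alpha> j else 0)" by blast
  have "\<forall>k. \<exists>e. jet_on a b (2 * n) e \<and> (\<forall>x\<in>{a..b}. e (2 * n) x = ?c * e 0 x) \<and> (\<forall>j<2 * n. e j a = (if j = n + k then 1 else 0))" (is "\<forall>k. ?P k")
  proof
    fix k
    from cauchy_problem_solvable[OF absolutely_integrable_zero n2, of a b ?c "\<lambda>j. if j = n + k then 1 else 0"]
    show "?P k"
      by (metis add.right_neutral)
  qed
  then obtain e where e: "\<And>k. jet_on a b (2 * n) (e k)" "\<And>k x. x \<in> {a..b} \<Longrightarrow> e k (2 * n) x = ?c * e k 0 x"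
    "\<And>k j. j < 2 * n \<Longrightarrow> e k j a = (if j = n + k then 1 else 0)" by metis
  have "\<exists>\<gamma>. \<forall>i<n. (\<Sum>k<n. e k i b * \<gamma> k) = \<beta> i - p i b"
  proof (rule linear_system_solvable)
    fix \<gamma> assume 0: "\<And>i. i < n \<Longrightarrow> (\<Sum>k<n. e k i b * \<gamma> k) = 0"
    let ?E = "\<lambda>j x. \<Sum>k<n. \<gamma> k * e k j x"
    have E: "?E j x = 0" if "j < 2 * n" "x \<in> {a..b}" for j x
    proof (rule dirichlet_problem_unique[OF _ \<open>a < b\<close> \<open>n \<ge> 1\<close> \<open>c \<le> 0\<close>, where d = ?E])
      show "jet_on a b (2 * n) ?E" by (intro jet_on_sum e)
      show "?E (2 * n) x = ?c * ?E 0 x" if "x \<in> {a..b}" for x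
        unfolding sum_distrib_left e(2)[OF that] by (simp add: mult_ac)
      show "?E j a = 0" if "j < n" for j using that by (simp add: e(3))
      show "?E j b = 0" if "j < n" for j using 0[OF that] by (simp add: mult.commute)
    qed (use that in auto)
    show "\<forall>k<n. \<gamma> k = 0"
    proof (intro allI impI)
      fix k assume "k < n"
      have "?E (n + k) a = (\<Sum>i<n. if i = k then \<gamma> i else 0)"
        using \<open>k < n\<close> by (intro sum.cong) (auto simp: e(3))
      then show "\<gamma> k = 0" using E[of "n + k" a] ends \<open>k < n\<close> by simp
    qed
  qed
  then obtain \<gamma> where \<gamma>: "\<And>i. i < n \<Longrightarrow> (\<Sum>k<n. e k i b * \<gamma> k) = \<beta> i - p i b" by blast
  define d where "d = (\<lambda>j x. p j x + 1 * (\<Sum>k<n. \<gamma> k * e k j x))"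
  have "jet_on a b (2 * n) d"
    unfolding d_def by (intro jet_on_linear_combination p jet_on_sum e)
  moreover have "d (2 * n) x = (- 1) ^ n * (complex_of_real c * d 0 x + h x)" if "x \<in> {a..b}" for x
    unfolding d_def p(2)[OF that] e(2)[OF that] by (simp add: algebra_simps sum_distrib_left)
  moreover have "d j a = \<alpha> j" "d j b = \<beta> j" if "j < n" for j
    using that \<gamma>[OF that] by (simp_all add: d_def p(3) e(3) mult.commute)
  ultimately show ?thesis by blast
qed

text \<open>The \<open>j\<close>-th derivative of \<open>(x - a)\<^sup>r / r!\<close>.\<close>

definition taylor_monomial :: "real \<Rightarrow> nat \<Rightarrow> nat \<Rightarrow> real \<Rightarrow> complex" where
  "taylor_monomial a r j x = (if j \<le> r then complex_of_real ((x - a) ^ (r - j) / fact (r - j)) else 0)"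

lemma taylor_monomial_at_base: "taylor_monomial a r j a = (if j = r then 1 else 0)"
  by (auto simp: taylor_monomial_def)

lemma jet_on_taylor_monomial: "jet_on a b m (taylor_monomial a r)"
  unfolding jet_on_def
proof (intro allI impI primitive_on_C1)
  fix j x
  consider "j < r" | "j = r" | "r < j" by linarith
  then show "(taylor_monomial a r j has_vector_derivative taylor_monomial a r (Suc j) x) (at x)"
  proof cases
    case 1
    then have S: "r - j = Suc (r - Suc j)" by simp
    have "((\<lambda>t. 1 * (t - a) ^ (r - j) / fact (r - j)) has_real_derivative 1 * (x - a) ^ (r - Suc j) / fact (r - Suc j)) (at x)"
      unfolding S by (rule power_over_fact_has_real_derivative)
    then have "((\<lambda>t. complex_of_real (1 * (t - a) ^ (r - j) / fact (r - j))) has_vector_derivative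
        complex_of_real (1 * (x - a) ^ (r - Suc j) / fact (r - Suc j))) (at x)"
      by (rule has_vector_derivative_of_real)
    then show ?thesis using 1 by (simp add: taylor_monomial_def[abs_def])
  next
    case 2
    then show ?thesis by (simp add: taylor_monomial_def[abs_def])
  next
    case 3
    then show ?thesis by (simp add: taylor_monomial_def[abs_def])
  qed
next
  fix j
  show "continuous_on {a..b} (taylor_monomial a r (Suc j))"
    unfolding taylor_monomial_def[abs_def] by (cases "Suc j \<le> r") (auto intro!: continuous_intros)
qed

text \<open>The case \<open>r = n - 1\<close> is Taylor's formula for polynomials of degree less than \<open>n\<close>; the case
  \<open>r = 2n - 1\<close> gives the derivatives of order at least \<open>n\<close> of polynomials of degree less than \<open>2n\<close>.\<close>

lemma T1_mat_mult_vec: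
  assumes "v \<in> carrier_vec n" "j < n" "r \<ge> n - 1"
  shows "(T1_mat a b n *\<^sub>v v) $v j = (\<Sum>k<n. v $v k * taylor_monomial a (r - k) (r - j) b)"
proof -
  have "(T1_mat a b n *\<^sub>v v) $v j = (\<Sum>k<n. (if j \<ge> k then complex_of_real ((b - a) ^ (j - k) / fact (j - k)) else 0) * v $v k)"
    using assms by (simp add: T1_mat_def scalar_prod_def lessThan_atLeast0)
  also have "\<dots> = (\<Sum>k<n. v $v k * taylor_monomial a (r - k) (r - j) b)"
  proof (intro sum.cong refl)
    fix k assume "k \<in> {..<n}"
    then have "r - j \<le> r - k \<longleftrightarrow> k \<le> j" "k \<le> j \<Longrightarrow> (r - k) - (r - j) = j - k" using assms by auto
    then show "(if j \<ge> k then complex_of_real ((b - a) ^ (j - k) / fact (j - k)) else 0) * v $v k = v $v k * taylor_monomial a (r - k) (r - j) b"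
      by (simp add: taylor_monomial_def)
  qed
  finally show ?thesis .
qed

lemma T2_mat_mult_vec:
  assumes "v \<in> carrier_vec n" "j < n"
  shows "(T2_mat a b n *\<^sub>v v) $v j = (\<Sum>k<n. v $v k * taylor_monomial a (2 * n - 1 - k) (n - Suc j) b)"
proof -
  have "(T2_mat a b n *\<^sub>v v) $v j = (\<Sum>k<n. complex_of_real ((b - a) ^ (n + j - k) / fact (n + j - k)) * v $v k)"
    using assms by (simp add: T2_mat_def scalar_prod_def lessThan_atLeast0)
  also have "\<dots> = (\<Sum>k<n. v $v k * taylor_monomial a (2 * n - 1 - k) (n - Suc j) b)"
  proof (intro sum.cong refl)
    fix k assume "k \<in> {..<n}"
    then have "n - Suc j \<le> 2 * n - 1 - k" "2 * n - 1 - k - (n - Suc j) = n + j - k" using assms by auto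
    then show "complex_of_real ((b - a) ^ (n + j - k) / fact (n + j - k)) * v $v k = v $v k * taylor_monomial a (2 * n - 1 - k) (n - Suc j) b"
      by (simp add: taylor_monomial_def)
  qed
  finally show ?thesis .
qed

text \<open>Reading indices backwards, the entries of \<open>T\<^sub>2 v\<close> are the first \<open>n\<close> derivatives at \<open>b\<close> of the
  polynomial of degree less than \<open>2n\<close> that vanishes to order \<open>n\<close> at \<open>a\<close> and has the entries of \<open>v\<close> as
  remaining derivatives there. If \<open>T\<^sub>2 v = 0\<close>, this polynomial solves the homogeneous Dirichlet problem.\<close>

lemma T2_mat_inverse:
  assumes "a < b" "n \<ge> 1"
  shows "\<exists>B\<in>carrier_mat n n. mat_inverse (T2_mat a b n) = Some B \<and> B * T2_mat a b n = 1\<^sub>m n \<and> T2_mat a b n * B = 1\<^sub>m n"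
proof (rule mat_inverse_if_kernel_trivial)
  show "T2_mat a b n \<in> carrier_mat n n" by (simp add: T2_mat_def)
  fix v assume v: "v \<in> carrier_vec n" "T2_mat a b n *\<^sub>v v = 0\<^sub>v n"
  let ?d = "\<lambda>j x. \<Sum>k<n. v $v k * taylor_monomial a (2 * n - 1 - k) j x"
  have zero: "?d j x = 0" if "j < 2 * n" "x \<in> {a..b}" for j x
  proof (rule dirichlet_problem_unique[where c = 0 and d = ?d])
    show "jet_on a b (2 * n) ?d" by (intro jet_on_sum jet_on_taylor_monomial)
    show "?d (2 * n) x = (- 1) ^ n * complex_of_real 0 * ?d 0 x" for x
      by (auto simp: taylor_monomial_def intro!: sum.neutral)
    show "?d j a = 0" if "j < n" for j
      using that by (auto simp: taylor_monomial_at_base intro!: sum.neutral)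
    show "?d j b = 0" if "j < n" for j
    proof -
      have "n - Suc (n - Suc j) = j" "n - Suc j < n" using that by auto
      then show ?thesis using T2_mat_mult_vec[OF v(1), of "n - Suc j" a b] v(2) by simp
    qed
  qed (use that assms in auto)
  show "v = 0\<^sub>v n"
  proof (rule eq_vecI)
    fix k assume "k < dim_vec (0\<^sub>v n)"
    then have k: "k < n" by simp
    have "?d (2 * n - 1 - k) a = (\<Sum>i<n. if i = k then v $v i else 0)"
      using k by (intro sum.cong) (auto simp: taylor_monomial_at_base)
    then show "v $v k = 0\<^sub>v n $v k" using zero[of "2 * n - 1 - k" a] k \<open>a < b\<close> by simp
  qed (use v in auto)
qed

section \<open>The adjoint of the minimal operator\<close>

definition maximal_operator :: "real \<Rightarrow> real \<Rightarrow> nat \<Rightarrow> L2_op" where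
  "maximal_operator a b n = {(f, g). f \<in> sobolev_space a b (2 * n) \<and> g \<in> L2 a b \<and>
     L2_eq a b g (\<lambda>x. (-1) ^ n * sobolev_deriv a b (2 * n) f (2 * n) x)}"

text \<open>Any Sobolev jet may be used in place of the chosen one.\<close>

lemma maximal_operator_iff:
  assumes "a < b"
  shows "(f, g) \<in> maximal_operator a b n \<longleftrightarrow>
     (\<exists>d. sobolev_jet a b (2 * n) f d \<and> g \<in> L2 a b \<and> L2_eq a b g (\<lambda>x. (- 1) ^ n * d (2 * n) x))"
proof
  assume *: "(f, g) \<in> maximal_operator a b n"
  then have "sobolev_jet a b (2 * n) f (sobolev_deriv a b (2 * n) f)"
    by (auto simp: maximal_operator_def intro: sobolev_jet_sobolev_deriv)
  then show "\<exists>d. sobolev_jet a b (2 * n) f d \<and> g \<in> L2 a b \<and> L2_eq a b g (\<lambda>x. (- 1) ^ n * d (2 * n) x)"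
    using * by (auto simp: maximal_operator_def)
next
  assume "\<exists>d. sobolev_jet a b (2 * n) f d \<and> g \<in> L2 a b \<and> L2_eq a b g (\<lambda>x. (- 1) ^ n * d (2 * n) x)"
  then obtain d where d: "sobolev_jet a b (2 * n) f d" "g \<in> L2 a b" "L2_eq a b g (\<lambda>x. (- 1) ^ n * d (2 * n) x)"
    by blast
  have "L2_eq a b g (\<lambda>x. (- 1) ^ n * sobolev_deriv a b (2 * n) f (2 * n) x)"
    using L2_eq_trans[OF d(3) L2_eq_cmult[OF L2_eq_sym[OF sobolev_deriv_eq(2)[OF d(1) assms]]]] .
  then show "(f, g) \<in> maximal_operator a b n"
    using d by (auto simp: maximal_operator_def sobolev_space_def)
qed

lemma maximal_operatorD:
  assumes "(f, g) \<in> maximal_operator a b n" "a < b"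
  shows "f \<in> L2 a b" "g \<in> L2 a b"
  using assms maximal_operator_iff[OF assms(2)] by (auto simp: sobolev_jet_iff)

lemma Domain_maximal_operator:
  assumes "a < b"
  shows "Domain (maximal_operator a b n) = sobolev_space a b (2 * n)"
proof (rule subset_antisym; rule subsetI)
  fix f assume "f \<in> sobolev_space a b (2 * n)"
  then have "sobolev_jet a b (2 * n) f (sobolev_deriv a b (2 * n) f)" by (rule sobolev_jet_sobolev_deriv)
  then have "(f, \<lambda>x. (- 1) ^ n * sobolev_deriv a b (2 * n) f (2 * n) x) \<in> maximal_operator a b n"
    using maximal_operator_iff[OF assms] L2_cmult by (auto simp: sobolev_jet_iff)
  then show "f \<in> Domain (maximal_operator a b n)" by blast
qed (auto simp: maximal_operator_def)

lemma maximal_operator_linear_combination: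
  assumes "(f, f') \<in> maximal_operator a b n" "(g, g') \<in> maximal_operator a b n" "a < b"
  shows "(\<lambda>x. f x + c * g x, \<lambda>x. f' x + c * g' x) \<in> maximal_operator a b n"
proof -
  obtain d e where d: "sobolev_jet a b (2 * n) f d" "f' \<in> L2 a b" "L2_eq a b f' (\<lambda>x. (- 1) ^ n * d (2 * n) x)"
    and e: "sobolev_jet a b (2 * n) g e" "g' \<in> L2 a b" "L2_eq a b g' (\<lambda>x. (- 1) ^ n * e (2 * n) x)"
    using assms maximal_operator_iff by blast
  have "sobolev_jet a b (2 * n) (\<lambda>x. f x + c * g x) (\<lambda>j x. d j x + c * e j x)"
    by (rule sobolev_jet_linear_combination[OF d(1) e(1)])
  moreover have "L2_eq a b (\<lambda>x. f' x + c * g' x) (\<lambda>x. (- 1) ^ n * (d (2 * n) x + c * e (2 * n) x))"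
    using d(3) e(3) unfolding L2_eq_def by eventually_elim (simp add: algebra_simps)
  ultimately show ?thesis
    using maximal_operator_iff[OF assms(3)] L2_add[OF d(2) L2_cmult[OF e(2)]] by blast
qed

lemma test_function_L2: "test_function a b \<phi> \<Longrightarrow> (vderiv ^^ k) \<phi> \<in> L2 a b"
  by (intro L2_continuous smooth_continuous_on) (simp add: test_function_iff)

text \<open>The duality between an operator and its adjoint extends to the closure by continuity of the inner
  product.\<close>

lemma L2_closure_adjoint:
  assumes T: "\<And>u v. (u, v) \<in> T \<Longrightarrow> u \<in> L2 a b \<and> v \<in> L2 a b \<and> L2_inner a b v f = L2_inner a b u g"
    and f: "f \<in> L2 a b" "g \<in> L2 a b" and uv: "(u, v) \<in> L2_closure a b T"
  shows "L2_inner a b v f = L2_inner a b u g"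
proof -
  obtain U V where U: "\<And>k::nat. (U k, V k) \<in> T" "(\<lambda>k. L2_norm a b (\<lambda>x. U k x - u x)) \<longlonglongrightarrow> 0"
    "(\<lambda>k. L2_norm a b (\<lambda>x. V k x - v x)) \<longlonglongrightarrow> 0" and uv: "u \<in> L2 a b" "v \<in> L2 a b"
    using uv by (auto simp: L2_closure_def)
  have lim: "(\<lambda>k. L2_inner a b (W k) h) \<longlonglongrightarrow> L2_inner a b w h"
    if "(\<lambda>k. L2_norm a b (\<lambda>x. W k x - w x)) \<longlonglongrightarrow> 0" "\<And>k. W k \<in> L2 a b" "w \<in> L2 a b" "h \<in> L2 a b" for W w h
  proof (rule LIM_zero_cancel, rule Lim_null_comparison)
    show "\<forall>\<^sub>F k in sequentially. norm (L2_inner a b (W k) h - L2_inner a b w h) \<le> L2_norm a b (\<lambda>x. W k x - w x) * L2_norm a b h"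
      using that L2_Cauchy_Schwarz[OF L2_diff] by (intro always_eventually allI) (simp flip: L2_inner_diff_left)
    show "(\<lambda>k. L2_norm a b (\<lambda>x. W k x - w x) * L2_norm a b h) \<longlonglongrightarrow> 0"
      using tendsto_mult_right[OF that(1), of "L2_norm a b h"] by simp
  qed
  have "(\<lambda>k. L2_inner a b (V k) f) \<longlonglongrightarrow> L2_inner a b v f"
    by (rule lim) (use T[OF U(1)] U uv f in auto)
  moreover have "(\<lambda>k. L2_inner a b (U k) g) \<longlonglongrightarrow> L2_inner a b u g"
    by (rule lim) (use T[OF U(1)] U uv f in auto)
  moreover have "(\<lambda>k. L2_inner a b (V k) f) = (\<lambda>k. L2_inner a b (U k) g)"
    using T[OF U(1)] by auto
  ultimately show ?thesis using LIMSEQ_unique by metis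
qed

lemma subset_L2_closure:
  assumes "(u, v) \<in> T" "u \<in> L2 a b" "v \<in> L2 a b"
  shows "(u, v) \<in> L2_closure a b T"
  unfolding L2_closure_def mem_Collect_eq prod.case
  by (intro conjI exI[of _ "\<lambda>_. u"] exI[of _ "\<lambda>_. v"]) (use assms in \<open>auto simp: L2_norm_def\<close>)

lemma test_function_duality:
  assumes jet: "sobolev_jet a b (2 * n) f d" and "a < b" "n \<ge> 1" and \<phi>: "test_function a b \<phi>"
  shows "L2_inner a b ((vderiv ^^ (2 * n)) \<phi>) f = L2_inner a b \<phi> (d (2 * n))"
proof -
  obtain c e where "a < c" "e < b" "\<And>k x. x \<notin> {c..e} \<Longrightarrow> (vderiv ^^ k) \<phi> x = 0"
    using test_function_derivatives_support[OF \<phi>] by blast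
  then have ends: "(vderiv ^^ k) \<phi> a = 0" "(vderiv ^^ k) \<phi> b = 0" for k by auto
  note d = jet[unfolded sobolev_jet_iff]
  have d0: "d 0 \<in> L2 a b" using d \<open>n \<ge> 1\<close> by (intro L2_continuous jet_on_continuous) auto
  have \<phi>L: "(vderiv ^^ k) \<phi> \<in> L2 a b" for k by (rule test_function_L2[OF \<phi>])
  have "integral {a..b} (\<lambda>x. (vderiv ^^ (2 * n)) \<phi> x * cnj (d 0 x)) = integral {a..b} (\<lambda>x. \<phi> x * cnj (d (2 * n) x))"
    using jets_integration_by_parts[OF jet_on_test_function[OF \<phi>, of "2 * n"] jet_on_cnj[of a b "2 * n" d], of "2 * n"]
      d \<open>a < b\<close> \<open>n \<ge> 1\<close> by (simp add: ends)
  then have "L2_inner a b ((vderiv ^^ (2 * n)) \<phi>) (d 0) = L2_inner a b \<phi> (d (2 * n))"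
    using has_integral_L2_inner[OF \<phi>L d0, of "2 * n"] has_integral_L2_inner[OF \<phi>L, of "d (2 * n)" 0] d
    by (simp add: integral_unique)
  moreover have "L2_inner a b ((vderiv ^^ (2 * n)) \<phi>) f = L2_inner a b ((vderiv ^^ (2 * n)) \<phi>) (d 0)"
    using d d0 \<phi>L by (intro L2_inner_cong) auto
  ultimately show ?thesis by simp
qed

text \<open>That the adjoint is contained in the maximal operator is the lemma of du Bois-Reymond of order \<open>2n\<close>,
  applied to the complex conjugates because the inner product is antilinear in the second argument. The
  converse is integration by parts against test functions, extended to the closure.\<close>

lemma adjoint_minimal_operator:
  assumes ab: "a < b" and n: "n \<ge> 1"
  shows "L2_adjoint a b (minimal_operator a b n) = maximal_operator a b n"
proof (rule subset_antisym; rule subrelI)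
  fix f g assume fg: "(f, g) \<in> L2_adjoint a b (minimal_operator a b n)"
  then have L: "f \<in> L2 a b" "g \<in> L2 a b" by (auto simp: L2_adjoint_def)
  define s :: complex where "s = (- 1) ^ n"
  have s: "s * s = 1" "cnj s = s" by (simp_all add: s_def flip: power_mult_distrib)
  have "\<exists>d. jet_on a b (2 * n) d \<and> d (2 * n) = (\<lambda>x. s * cnj (g x)) \<and> (AE x in lebesgue_on {a<..<b}. cnj (f x) = d 0 x)"
  proof (rule weak_derivative_imp_jet[OF _ _ ab])
    show "(\<lambda>x. cnj (f x)) absolutely_integrable_on {a..b}" "(\<lambda>x. s * cnj (g x)) absolutely_integrable_on {a..b}"
      using L by (intro L2_absolutely_integrable L2_cmult L2_cnj; simp)+
    fix \<phi> assume \<phi>: "test_function a b \<phi>"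
    note \<phi>L = test_function_L2[OF \<phi>]
    have "(\<phi>, \<lambda>x. s * (vderiv ^^ (2 * n)) \<phi> x) \<in> minimal_operator a b n"
      unfolding minimal_operator_def using \<phi> \<phi>L[of 0] L2_cmult[OF \<phi>L]
      by (intro subset_L2_closure) (auto simp: s_def)
    then have "L2_inner a b (\<lambda>x. s * (vderiv ^^ (2 * n)) \<phi> x) f = L2_inner a b \<phi> g"
      using fg by (auto simp: L2_adjoint_def)
    then have "s * L2_inner a b ((vderiv ^^ (2 * n)) \<phi>) f = L2_inner a b \<phi> g"
      by (simp add: L2_inner_cmult_left)
    then have "L2_inner a b ((vderiv ^^ (2 * n)) \<phi>) f = s * L2_inner a b \<phi> g"
      by (metis mult.assoc mult_1 s(1))
    moreover have "((\<lambda>x. \<phi> x * (s * cnj (g x))) has_integral s * L2_inner a b \<phi> g) {a..b}"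
      using has_integral_mult_right[OF has_integral_L2_inner[OF \<phi>L[of 0] L(2)], of s] by (simp add: mult_ac)
    ultimately show "integral {a..b} (\<lambda>x. (vderiv ^^ (2 * n)) \<phi> x * cnj (f x)) = (- 1) ^ (2 * n) * integral {a..b} (\<lambda>x. \<phi> x * (s * cnj (g x)))"
      using has_integral_L2_inner[OF \<phi>L[of "2 * n"] L(1)] by (simp add: integral_unique)
  qed
  then obtain d where d: "jet_on a b (2 * n) d" "d (2 * n) = (\<lambda>x. s * cnj (g x))" "AE x in lebesgue_on {a<..<b}. cnj (f x) = d 0 x"
    by blast
  have "sobolev_jet a b (2 * n) f (\<lambda>j x. cnj (d j x))"
    unfolding sobolev_jet_iff
  proof (intro conjI L)
    show "(\<lambda>x. cnj (d (2 * n) x)) \<in> L2 a b" using L2_cmult[OF L(2), of s] by (simp add: d(2) s)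
    show "L2_eq a b f (\<lambda>x. cnj (d 0 x))"
      unfolding L2_eq_def using d(3) by eventually_elim (metis complex_cnj_cnj)
    show "jet_on a b (2 * n) (\<lambda>j x. cnj (d j x))" by (rule jet_on_cnj[OF d(1)])
  qed
  moreover have "L2_eq a b g (\<lambda>x. (- 1) ^ n * cnj (d (2 * n) x))"
    by (simp add: d(2) s mult.assoc[symmetric] flip: s_def)
  ultimately show "(f, g) \<in> maximal_operator a b n"
    unfolding maximal_operator_iff[OF ab] using L by blast
next
  fix f g assume "(f, g) \<in> maximal_operator a b n"
  then obtain d where d: "sobolev_jet a b (2 * n) f d" "g \<in> L2 a b" "L2_eq a b g (\<lambda>x. (- 1) ^ n * d (2 * n) x)"
    using maximal_operator_iff[OF ab] by blast
  then have L: "f \<in> L2 a b" "d (2 * n) \<in> L2 a b" by (auto simp: sobolev_jet_iff)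
  have "L2_inner a b v f = L2_inner a b u g" if "(u, v) \<in> minimal_operator a b n" for u v
  proof (rule L2_closure_adjoint[OF _ L(1) d(2) that[unfolded minimal_operator_def]])
    fix u v assume "(u, v) \<in> {(f, (\<lambda>x. (-1) ^ n * (vderiv ^^ (2 * n)) f x)) | f. test_function a b f}"
    then have u: "test_function a b u" and v: "v = (\<lambda>x. (-1) ^ n * (vderiv ^^ (2 * n)) u x)" by auto
    note uL = test_function_L2[OF u]
    have "L2_inner a b v f = (- 1) ^ n * L2_inner a b u (d (2 * n))"
      unfolding v L2_inner_cmult_left by (simp add: test_function_duality[OF d(1) ab n u])
    also have "\<dots> = L2_inner a b u (\<lambda>x. (- 1) ^ n * d (2 * n) x)" by (simp add: L2_inner_cmult_right)
    also have "\<dots> = L2_inner a b u g"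
      using uL[of 0] L d by (intro L2_inner_cong L2_eq_sym[OF d(3)] L2_cmult) auto
    finally show "u \<in> L2 a b \<and> v \<in> L2 a b \<and> L2_inner a b v f = L2_inner a b u g"
      using uL[of 0] L2_cmult[OF uL] by (simp add: v)
  qed
  then show "(f, g) \<in> L2_adjoint a b (minimal_operator a b n)"
    using L d by (auto simp: L2_adjoint_def)
qed

section \<open>The boundary triplet\<close>

text \<open>The boundary maps in terms of a jet. Since \<open>d j\<close> for \<open>j < 2n\<close> is determined by the function, this
  replaces the derivatives chosen in the definition of the boundary maps by those of any convenient
  jet.\<close>

definition boundary_values :: "real \<Rightarrow> real \<Rightarrow> nat \<Rightarrow> (nat \<Rightarrow> real \<Rightarrow> complex) \<Rightarrow> complex Matrix.vec" where
  "boundary_values a b n d = Matrix.vec (2 * n) (\<lambda>i. if i < n then d i a else d (i - n) b)"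

definition conormal_values :: "real \<Rightarrow> real \<Rightarrow> nat \<Rightarrow> (nat \<Rightarrow> real \<Rightarrow> complex) \<Rightarrow> complex Matrix.vec" where
  "conormal_values a b n d = Matrix.vec (2 * n) (\<lambda>i. if i < n then (- 1) ^ (n - Suc i) * d (2 * n - Suc i) a
     else (- 1) ^ (n - (i - n)) * d (2 * n - Suc (i - n)) b)"

lemma boundary_values_carrier [simp]: "boundary_values a b n d \<in> carrier_vec (2 * n)"
  "conormal_values a b n d \<in> carrier_vec (2 * n)"
  by (auto simp: boundary_values_def conormal_values_def)

lemma Gamma_eq_boundary_values:
  assumes jet: "sobolev_jet a b (2 * n) f d" and ab: "a < b"
  shows "Gamma0 a b n f = boundary_values a b n d" "Gamma1 a b n f = conormal_values a b n d"
proof -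
  note eq = sobolev_deriv_eq(1)[OF jet ab]
  show "Gamma0 a b n f = boundary_values a b n d"
    unfolding Gamma0_def boundary_values_def using ab by (intro eq_vecI) (auto simp: eq)
  show "Gamma1 a b n f = conormal_values a b n d"
  proof (rule eq_vecI)
    fix i assume "i < dim_vec (conormal_values a b n d)"
    then have i: "i < 2 * n" by (simp add: conormal_values_def)
    show "Gamma1 a b n f $v i = conormal_values a b n d $v i"
    proof (cases "i < n")
      case True
      then show ?thesis using i ab by (simp add: Gamma1_def conormal_values_def eq)
    next
      case False
      define l where "l = i - n"
      have l: "l < n" "i = n + l" using False i by (auto simp: l_def)
      then have "n - l = Suc (n - Suc l)" by auto
      then show ?thesis using l ab by (simp add: Gamma1_def conormal_values_def Let_def eq)
    qed
  qed (simp add: Gamma1_def conormal_values_def)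
qed

lemma sum_lessThan_double: "(\<Sum>i<2 * n. f i) = (\<Sum>i<n. f i + f (n + i))" for f :: "nat \<Rightarrow> complex"
proof -
  have "(\<Sum>i<2 * n. f i) = (\<Sum>i<n. f i) + (\<Sum>i=n..<n+n. f i)"
    by (simp add: lessThan_atLeast0 sum.atLeastLessThan_concat mult_2)
  also have "(\<Sum>i=n..<n+n. f i) = (\<Sum>i<n. f (n + i))"
    using sum.shift_bounds_nat_ivl[of f 0 n n] by (simp add: lessThan_atLeast0 add.commute)
  finally show ?thesis by (simp add: sum.distrib)
qed

text \<open>The terms with index \<open>j\<close> and \<open>2n - 1 - j\<close> of the Green formula pair the same two derivatives with
  opposite roles: for \<open>j < n\<close> the first belongs to \<open>\<Gamma>\<^sub>1 f \<cdot> \<Gamma>\<^sub>0 g\<close>, the second to \<open>\<Gamma>\<^sub>0 f \<cdot> \<Gamma>\<^sub>1 g\<close>.\<close>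

lemma boundary_form_algebra:
  fixes D E :: "nat \<Rightarrow> real \<Rightarrow> complex"
  shows "(- 1) ^ n * (\<Sum>j<2 * n. (- 1) ^ j * (D (2 * n - 1 - j) b * cnj (E j b) - D (2 * n - 1 - j) a * cnj (E j a))) =
    conormal_values a b n D \<bullet>c boundary_values a b n E - boundary_values a b n D \<bullet>c conormal_values a b n E"
proof -
  let ?Y = "\<lambda>j. (- 1) ^ j * (D (2 * n - 1 - j) b * cnj (E j b) - D (2 * n - 1 - j) a * cnj (E j a))"
  let ?X = "\<lambda>i. conormal_values a b n D $v i * cnj (boundary_values a b n E $v i) - boundary_values a b n D $v i * cnj (conormal_values a b n E $v i)"
  have "(\<Sum>j<2 * n. ?Y j) = (\<Sum>j<n. ?Y j) + (\<Sum>j<n. ?Y (n + j))"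
    by (simp only: sum_lessThan_double sum.distrib)
  also have "(\<Sum>j<n. ?Y (n + j)) = (\<Sum>j<n. ?Y (n + (n - Suc j)))"
    by (rule sum.nat_diff_reindex[symmetric])
  finally have eq: "(\<Sum>j<2 * n. ?Y j) = (\<Sum>j<n. ?Y j) + (\<Sum>j<n. ?Y (n + (n - Suc j)))" .
  have "(- 1) ^ n * (\<Sum>j<2 * n. ?Y j) = (\<Sum>j<n. (- 1) ^ n * (?Y j + ?Y (n + (n - Suc j))))"
    unfolding eq by (simp only: distrib_left sum.distrib sum_distrib_left)
  also have "\<dots> = (\<Sum>i<n. ?X i + ?X (n + i))"
  proof (intro sum.cong refl)
    fix j assume "j \<in> {..<n}"
    \<comment> \<open>Write \<open>n = j + k + 1\<close>; then \<open>2n - 1 - j = j + 2k + 1\<close>, and all signs reduce to \<open>(-1)\<^sup>k\<close>.\<close>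
    then obtain k where k: "n = Suc (j + k)" by (auto dest: less_imp_Suc_add)
    have ix: "2 * n - 1 - j = Suc (j + 2 * k)" "n + (n - Suc j) = Suc (j + 2 * k)" "2 * n - 1 - Suc (j + 2 * k) = j" "n - Suc j = k" "n - j = Suc k" "2 * n - Suc j = Suc (j + 2 * k)"
      using k by auto
    have sg: "(- 1) ^ n * (- 1) ^ j = - ((- 1) ^ k :: complex)" "(- 1) ^ n * (- 1) ^ (Suc (j + 2 * k)) = ((- 1) ^ k :: complex)"
      by (simp_all add: k power_add power_mult)
    have lt: "j < n" "n + j < 2 * n" "\<not> n + j < n" using k by auto
    have "(- 1) ^ n * (?Y j + ?Y (n + (n - Suc j))) =
      - ((- 1) ^ k) * (D (Suc (j + 2 * k)) b * cnj (E j b) - D (Suc (j + 2 * k)) a * cnj (E j a)) +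
      (- 1) ^ k * (D j b * cnj (E (Suc (j + 2 * k)) b) - D j a * cnj (E (Suc (j + 2 * k)) a))"
      unfolding ix(1,2,3) distrib_left mult.assoc[symmetric] sg ..
    also have "\<dots> = ?X j + ?X (n + j)"
      using lt by (simp add: conormal_values_def boundary_values_def ix(4,5,6)) (simp add: algebra_simps)
    finally show "(- 1) ^ n * (?Y j + ?Y (n + (n - Suc j))) = ?X j + ?X (n + j)" .
  qed
  also have "\<dots> = (\<Sum>i<2 * n. ?X i)" by (simp only: sum_lessThan_double)
  also have "\<dots> = conormal_values a b n D \<bullet>c boundary_values a b n E - boundary_values a b n D \<bullet>c conormal_values a b n E"
    by (simp add: cscalar_prod_eq_sum[of _ "2 * n"] sum_subtractf)
  finally show ?thesis .
qed

lemma green_identity: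
  assumes "(f, f') \<in> maximal_operator a b n" "(g, g') \<in> maximal_operator a b n" "a < b" "n \<ge> 1"
  shows "L2_inner a b f' g - L2_inner a b f g' =
     Gamma1 a b n f \<bullet>c Gamma0 a b n g - Gamma0 a b n f \<bullet>c Gamma1 a b n g"
proof -
  obtain d e where d: "sobolev_jet a b (2 * n) f d" "f' \<in> L2 a b" "L2_eq a b f' (\<lambda>x. (- 1) ^ n * d (2 * n) x)"
    and e: "sobolev_jet a b (2 * n) g e" "g' \<in> L2 a b" "L2_eq a b g' (\<lambda>x. (- 1) ^ n * e (2 * n) x)"
    using assms maximal_operator_iff by blast
  note d' = d(1)[unfolded sobolev_jet_iff] and e' = e(1)[unfolded sobolev_jet_iff]
  have L: "d 0 \<in> L2 a b" "e 0 \<in> L2 a b" using d' e' \<open>n \<ge> 1\<close> by (auto intro!: L2_continuous jet_on_continuous)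
  let ?S = "\<Sum>j<2 * n. (- 1) ^ j * (d (2 * n - 1 - j) b * cnj (e j b) - d (2 * n - 1 - j) a * cnj (e j a))"
  have "integral {a..b} (\<lambda>x. d (2 * n) x * cnj (e 0 x)) =
     ?S +
     integral {a..b} (\<lambda>x. d 0 x * cnj (e (2 * n) x))"
    using jets_integration_by_parts[of a b "2 * n" d "\<lambda>j x. cnj (e j x)" "2 * n"] d' e' jet_on_cnj assms by simp
  moreover have "integral {a..b} (\<lambda>x. d (2 * n) x * cnj (e 0 x)) = L2_inner a b (d (2 * n)) (e 0)"
    "integral {a..b} (\<lambda>x. d 0 x * cnj (e (2 * n) x)) = L2_inner a b (d 0) (e (2 * n))"
    using d' e' L by (auto intro!: integral_unique has_integral_L2_inner)
  ultimately have "L2_inner a b (d (2 * n)) (e 0) = ?S + L2_inner a b (d 0) (e (2 * n))"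
    by (simp only:)
  then have "(- 1) ^ n * L2_inner a b (d (2 * n)) (e 0) - (- 1) ^ n * L2_inner a b (d 0) (e (2 * n)) =
     (- 1) ^ n * ?S"
    by (simp add: algebra_simps)
  moreover have "L2_inner a b f' g = (- 1) ^ n * L2_inner a b (d (2 * n)) (e 0)"
    unfolding L2_inner_cmult_left[symmetric] using d d' e e' L by (intro L2_inner_cong L2_cmult) auto
  moreover have "L2_inner a b f g' = (- 1) ^ n * L2_inner a b (d 0) (e (2 * n))"
  proof -
    have "L2_inner a b f g' = L2_inner a b (d 0) (\<lambda>x. (- 1) ^ n * e (2 * n) x)"
      using d d' e e' L by (intro L2_inner_cong L2_cmult) auto
    then show ?thesis by (simp add: L2_inner_cmult_right)
  qed
  ultimately show ?thesis
    unfolding Gamma_eq_boundary_values[OF d(1) \<open>a < b\<close>] Gamma_eq_boundary_values[OF e(1) \<open>a < b\<close>]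
    by (simp only: boundary_form_algebra)
qed

lemma boundary_value_problem_solvable:
  assumes h: "h \<in> L2 a b" and ab: "a < b" and n: "n \<ge> 1" and c: "c \<le> (0::real)" and y: "y \<in> carrier_vec (2 * n)"
  obtains f where "(f, \<lambda>x. complex_of_real c * f x + h x) \<in> maximal_operator a b n" "Gamma0 a b n f = y"
proof -
  obtain d where d: "jet_on a b (2 * n) d" "\<And>x. x \<in> {a..b} \<Longrightarrow> d (2 * n) x = (- 1) ^ n * (complex_of_real c * d 0 x + h x)"
    "\<And>j. j < n \<Longrightarrow> d j a = y $v j" "\<And>j. j < n \<Longrightarrow> d j b = y $v (n + j)"
    using dirichlet_problem_solvable[OF L2_absolutely_integrable[OF h] ab n c, of "\<lambda>j. y $v j" "\<lambda>j. y $v (n + j)"] by blast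
  have d0: "d 0 \<in> L2 a b" using d(1) n by (intro L2_continuous jet_on_continuous) auto
  have gL: "(\<lambda>x. complex_of_real c * d 0 x + h x) \<in> L2 a b" by (intro L2_add L2_cmult d0 h)
  have top: "d (2 * n) \<in> L2 a b"
    by (rule L2_cong_on[OF L2_cmult[OF gL]]) (use d(2) in auto)
  have jet: "sobolev_jet a b (2 * n) (d 0) d" using d0 top d(1) by (simp add: sobolev_jet_iff)
  note sq = minus_one_power_cancel
  have "L2_eq a b (\<lambda>x. complex_of_real c * d 0 x + h x) (\<lambda>x. (- 1) ^ n * d (2 * n) x)"
    unfolding L2_eq_def by (intro AE_I2) (simp add: d(2) sq)
  then have "(d 0, \<lambda>x. complex_of_real c * d 0 x + h x) \<in> maximal_operator a b n"
    unfolding maximal_operator_iff[OF ab] using jet gL by blast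
  moreover have "Gamma0 a b n (d 0) = y"
    unfolding Gamma_eq_boundary_values[OF jet ab] boundary_values_def
    using y d(3,4) by (intro eq_vecI) auto
  ultimately show ?thesis by (rule that)
qed

text \<open>The pair \<open>(\<Gamma>\<^sub>0 f, \<Gamma>\<^sub>1 f)\<close> lists, up to signs, all derivatives of order less than \<open>2n\<close> at both ends.
  These are the Dirichlet data for the equation of order \<open>4n\<close>.\<close>

lemma boundary_maps_surjective:
  assumes ab: "a < b" and n: "n \<ge> 1" and h: "h\<^sub>0 \<in> carrier_vec (2 * n)" "h\<^sub>1 \<in> carrier_vec (2 * n)"
  obtains f where "f \<in> sobolev_space a b (2 * n)" "Gamma0 a b n f = h\<^sub>0" "Gamma1 a b n f = h\<^sub>1"
proof -
  have n2: "2 * n \<ge> 1" using n by simp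
  \<comment> \<open>The entry \<open>l\<close> of either half of \<open>\<Gamma>\<^sub>1\<close> involves the derivative of order \<open>j = 2n - 1 - l\<close>.\<close>
  define \<alpha> where "\<alpha> = (\<lambda>j. if j < n then h\<^sub>0 $v j else (- 1) ^ (j - n) * h\<^sub>1 $v (2 * n - Suc j))"
  define \<beta> where "\<beta> = (\<lambda>j. if j < n then h\<^sub>0 $v (n + j) else (- 1) ^ Suc (j - n) * h\<^sub>1 $v (n + (2 * n - Suc j)))"
  obtain d where d': "jet_on a b (2 * (2 * n)) d" "\<And>j. j < 2 * n \<Longrightarrow> d j a = \<alpha> j" "\<And>j. j < 2 * n \<Longrightarrow> d j b = \<beta> j"
    using dirichlet_problem_solvable[OF absolutely_integrable_zero ab n2 order_refl, of \<alpha> \<beta>] by blast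
  note d = d'[unfolded \<alpha>_def \<beta>_def]
  have cont: "d j \<in> L2 a b" if "j \<le> 2 * n" for j
    using that n by (intro L2_continuous jet_on_continuous[OF d(1)]) auto
  have jet: "sobolev_jet a b (2 * n) (d 0) d"
    unfolding sobolev_jet_iff using cont d(1) by (auto simp: jet_on_def)
  note sq = minus_one_power_cancel
  have "Gamma0 a b n (d 0) = h\<^sub>0"
    unfolding Gamma_eq_boundary_values[OF jet ab] boundary_values_def
    using h d(2,3) by (intro eq_vecI) auto
  moreover have "Gamma1 a b n (d 0) = h\<^sub>1"
    unfolding Gamma_eq_boundary_values[OF jet ab]
  proof (rule eq_vecI)
    fix i assume "i < dim_vec h\<^sub>1"
    then have i: "i < 2 * n" using h by simp
    show "conormal_values a b n (d) $v i = h\<^sub>1 $v i"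
    proof (cases "i < n")
      case True
      then have "2 * n - Suc i < 2 * n" "\<not> 2 * n - Suc i < n" "2 * n - Suc i - n = n - Suc i" "2 * n - Suc (2 * n - Suc i) = i" by auto
      then show ?thesis using i True by (simp add: conormal_values_def d(2) sq)
    next
      case False
      define l where "l = i - n"
      have l: "l < n" "i = n + l" using False i by (auto simp: l_def)
      then have ix: "2 * n - Suc l < 2 * n" "\<not> 2 * n - Suc l < n" "Suc (2 * n - Suc l - n) = n - l" "2 * n - Suc (2 * n - Suc l) = l" by auto
      have "conormal_values a b n d $v i = (- 1) ^ (n - l) * d (2 * n - Suc l) b"
        using l by (simp add: conormal_values_def)
      also have "\<dots> = (- 1) ^ (n - l) * ((- 1) ^ (n - l) * h\<^sub>1 $v (n + l))"
        using ix by (simp only: d(3)[OF ix(1)] ix if_False)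
      finally show ?thesis using l by (simp add: sq)
    qed
  qed (use h in \<open>simp add: conormal_values_def\<close>)
  ultimately show ?thesis using jet that by (auto simp: sobolev_space_def)
qed

lemma Gamma_linear_combination:
  assumes "f \<in> sobolev_space a b (2 * n)" "g \<in> sobolev_space a b (2 * n)" "a < b"
  shows "Gamma0 a b n (\<lambda>x. f x + c * g x) = Gamma0 a b n f + c \<cdot>\<^sub>v Gamma0 a b n g"
    "Gamma1 a b n (\<lambda>x. f x + c * g x) = Gamma1 a b n f + c \<cdot>\<^sub>v Gamma1 a b n g"
proof -
  obtain d e where d: "sobolev_jet a b (2 * n) f d" and e: "sobolev_jet a b (2 * n) g e"
    using assms by (auto simp: sobolev_space_def)
  note de = sobolev_jet_linear_combination[OF d e, of c]
  show "Gamma0 a b n (\<lambda>x. f x + c * g x) = Gamma0 a b n f + c \<cdot>\<^sub>v Gamma0 a b n g"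
    "Gamma1 a b n (\<lambda>x. f x + c * g x) = Gamma1 a b n f + c \<cdot>\<^sub>v Gamma1 a b n g"
    unfolding Gamma_eq_boundary_values[OF de assms(3)] Gamma_eq_boundary_values[OF d assms(3)] Gamma_eq_boundary_values[OF e assms(3)]
    by (auto simp: boundary_values_def conormal_values_def algebra_simps intro!: eq_vecI)
qed

lemma Gamma_cong:
  assumes "f \<in> sobolev_space a b (2 * n)" "g \<in> sobolev_space a b (2 * n)" "L2_eq a b f g" "a < b"
  shows "Gamma0 a b n f = Gamma0 a b n g" "Gamma1 a b n f = Gamma1 a b n g"
proof -
  obtain d where d: "sobolev_jet a b (2 * n) f d" using assms by (auto simp: sobolev_space_def)
  have "sobolev_jet a b (2 * n) g d"
    using d assms L2_eq_trans[OF L2_eq_sym[OF assms(3)]] by (auto simp: sobolev_jet_iff sobolev_space_def)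
  then show "Gamma0 a b n f = Gamma0 a b n g" "Gamma1 a b n f = Gamma1 a b n g"
    using Gamma_eq_boundary_values d assms(4) by metis+
qed

lemma boundary_triplet_maximal_operator:
  assumes ab: "a < b" and n: "n \<ge> 1"
  shows "boundary_triplet a b (maximal_operator a b n) (2 * n) (Gamma0 a b n) (Gamma1 a b n)"
proof -
  have zero: "(\<lambda>x. 0) \<in> sobolev_space a b (2 * n)"
    unfolding sobolev_space_def by (auto simp: sobolev_jet_iff jet_on_def primitive_on_0 L2_continuous intro!: exI[of _ "\<lambda>j x. 0"])
  have "Gamma0 a b n (\<lambda>x. 0) = 0\<^sub>v (2 * n)" "Gamma1 a b n (\<lambda>x. 0) = 0\<^sub>v (2 * n)"
  proof -
    have "sobolev_jet a b (2 * n) (\<lambda>x. 0) (\<lambda>j x. 0)"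
      by (auto simp: sobolev_jet_iff jet_on_def primitive_on_0 L2_continuous)
    then show "Gamma0 a b n (\<lambda>x. 0) = 0\<^sub>v (2 * n)" "Gamma1 a b n (\<lambda>x. 0) = 0\<^sub>v (2 * n)"
      using Gamma_eq_boundary_values ab by (auto simp: boundary_values_def conormal_values_def intro!: eq_vecI)
  qed
  note z = this
  have carr: "Gamma0 a b n f \<in> carrier_vec (2 * n)" "Gamma1 a b n f \<in> carrier_vec (2 * n)" for f
    by (simp_all add: Gamma0_def Gamma1_def)
  have add: "Gamma0 a b n (\<lambda>x. f x + g x) = Gamma0 a b n f + Gamma0 a b n g"
    "Gamma1 a b n (\<lambda>x. f x + g x) = Gamma1 a b n f + Gamma1 a b n g"
    if "f \<in> sobolev_space a b (2 * n)" "g \<in> sobolev_space a b (2 * n)" for f g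
    using Gamma_linear_combination[OF that ab, of 1] by simp_all
  have scale: "Gamma0 a b n (\<lambda>x. c * f x) = c \<cdot>\<^sub>v Gamma0 a b n f"
    "Gamma1 a b n (\<lambda>x. c * f x) = c \<cdot>\<^sub>v Gamma1 a b n f"
    if "f \<in> sobolev_space a b (2 * n)" for f c
    using Gamma_linear_combination[OF zero that ab, of c] carr[of f] by (simp_all add: z)
  show ?thesis
    unfolding boundary_triplet_def Domain_maximal_operator[OF ab]
  proof (intro conjI ballI allI impI)
    fix \<Gamma> f g assume "\<Gamma> \<in> {Gamma0 a b n, Gamma1 a b n}" "f \<in> sobolev_space a b (2 * n)" "g \<in> sobolev_space a b (2 * n)" "L2_eq a b f g"
    then show "\<Gamma> f = \<Gamma> g" using Gamma_cong ab by blast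
  next
    fix h\<^sub>0 h\<^sub>1 :: "complex Matrix.vec" assume "h\<^sub>0 \<in> carrier_vec (2 * n)" "h\<^sub>1 \<in> carrier_vec (2 * n)"
    then show "\<exists>f\<in>sobolev_space a b (2 * n). Gamma0 a b n f = h\<^sub>0 \<and> Gamma1 a b n f = h\<^sub>1"
      using boundary_maps_surjective[OF ab n] by metis
  qed (use carr add scale green_identity[OF _ _ ab n] in auto)
qed

text \<open>As \<open>(A\<^sub>0 f, f) \<ge> 0\<close> and \<open>x < 0\<close>, we have \<open>- x \<parallel>f\<parallel>\<^sup>2 \<le> ((A\<^sub>0 - x) f, f)\<close>, and the right hand side is
  estimated by the Cauchy-Schwarz inequality.\<close>

lemma dirichlet_operator_bounded_below:
  assumes fg: "(f, g) \<in> maximal_operator a b n" and 0: "Gamma0 a b n f = 0\<^sub>v (2 * n)"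
    and ab: "a < b" and n: "n \<ge> 1" and x: "x < 0"
  shows "L2_norm a b f \<le> L2_norm a b (\<lambda>t. g t - complex_of_real x * f t) / (- x)"
proof -
  obtain d where d: "sobolev_jet a b (2 * n) f d" "g \<in> L2 a b" "L2_eq a b g (\<lambda>x. (- 1) ^ n * d (2 * n) x)"
    using fg maximal_operator_iff[OF ab] by blast
  note d' = d(1)[unfolded sobolev_jet_iff]
  have L: "d 0 \<in> L2 a b" using d' n by (auto intro!: L2_continuous jet_on_continuous)
  have bv: "boundary_values a b n d = 0\<^sub>v (2 * n)" using 0 Gamma_eq_boundary_values[OF d(1) ab] by simp
  have bc: "d j a = 0" "d j b = 0" if "j < n" for j
    using arg_cong[OF bv, of "\<lambda>v. v $v j"] arg_cong[OF bv, of "\<lambda>v. v $v (n + j)"] that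
    by (simp_all add: boundary_values_def)
  define q where "q = integral {a..b} (\<lambda>x. (cmod (d n x))\<^sup>2)"
  have "q \<ge> 0"
    unfolding q_def using d' n
    by (intro integral_nonneg integrable_continuous_real continuous_intros jet_on_continuous[of a b "2 * n"]) auto
  note sq = minus_one_power_cancel
  have "L2_inner a b (d (2 * n)) (d 0) = (- 1) ^ n * complex_of_real q"
    using dirichlet_form[of a b n d] bc ab n d' integral_unique[OF has_integral_L2_inner[of "d (2 * n)" a b "d 0"]] L
    by (simp add: q_def)
  moreover have "L2_inner a b g f = (- 1) ^ n * L2_inner a b (d (2 * n)) (d 0)"
    unfolding L2_inner_cmult_left[symmetric] using d d' L by (intro L2_inner_cong L2_cmult) auto
  ultimately have gf: "L2_inner a b g f = complex_of_real q" by (simp add: sq)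
  let ?r = "\<lambda>t. g t - complex_of_real x * f t" and ?N = "L2_norm a b f"
  have fL: "f \<in> L2 a b" using d' by simp
  have rL: "?r \<in> L2 a b" by (intro L2_diff L2_cmult d(2) fL)
  have "L2_inner a b ?r f = complex_of_real (q - x * ?N\<^sup>2)"
    using L2_inner_diff_left[OF d(2) L2_cmult[OF fL] fL, of "complex_of_real x"]
    by (simp add: gf L2_inner_cmult_left L2_inner_self)
  then have "\<bar>q - x * ?N\<^sup>2\<bar> \<le> L2_norm a b ?r * ?N"
    using L2_Cauchy_Schwarz[OF rL fL] by (simp only: norm_of_real)
  then have "- x * ?N\<^sup>2 \<le> L2_norm a b ?r * ?N" using \<open>q \<ge> 0\<close> by linarith
  then have "(- x * ?N) * ?N \<le> L2_norm a b ?r * ?N" by (simp add: power2_eq_square mult.assoc)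
  then have "- x * ?N \<le> L2_norm a b ?r"
    using mult_right_le_imp_le[of "- x * ?N" ?N "L2_norm a b ?r"] L2_norm_nonneg[of a b f]
    by (cases "?N = 0") simp_all
  then show ?thesis using x by (simp add: field_simps)
qed

lemma negative_axis_in_resolvent_set:
  assumes ab: "a < b" and n: "n \<ge> 1" and x: "x < 0"
  shows "complex_of_real x \<in> resolvent_set a b (ker_extension (maximal_operator a b n) (2 * n) (Gamma0 a b n))"
  unfolding resolvent_set_def mem_Collect_eq
proof (intro conjI ballI)
  let ?A0 = "ker_extension (maximal_operator a b n) (2 * n) (Gamma0 a b n)"
  fix h assume "h \<in> L2 a b"
  from boundary_value_problem_solvable[OF this ab n, of x "0\<^sub>v (2 * n)"] x obtain f
    where f: "(f, \<lambda>t. complex_of_real x * f t + h t) \<in> maximal_operator a b n" "Gamma0 a b n f = 0\<^sub>v (2 * n)"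
    by auto
  then show "\<exists>(f, g)\<in>?A0. L2_eq a b (\<lambda>t. g t - complex_of_real x * f t) h"
    by (intro bexI[of _ "(f, \<lambda>t. complex_of_real x * f t + h t)"]) (auto simp: ker_extension_def)
next
  show "\<exists>C. \<forall>(f, g)\<in>ker_extension (maximal_operator a b n) (2 * n) (Gamma0 a b n).
      L2_norm a b f \<le> C * L2_norm a b (\<lambda>t. g t - complex_of_real x * f t)"
    using dirichlet_operator_bounded_below[OF _ _ ab n x]
    by (intro exI[of _ "1 / (- x)"]) (auto simp: ker_extension_def)
qed

section \<open>Symmetric relations and strong resolvent limits\<close>

text \<open>Relations rather than matrices, since the Weyl function is given by its graph and the competitors
  for its limit are arbitrary self-adjoint relations.\<close>

definition symmetric_rel :: "nat \<Rightarrow> (complex Matrix.vec \<times> complex Matrix.vec) set \<Rightarrow> bool" where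
  "symmetric_rel m R \<longleftrightarrow> R \<subseteq> carrier_vec m \<times> carrier_vec m \<and>
     (\<forall>(f, g)\<in>R. \<forall>(h, k)\<in>R. g \<bullet>c h = f \<bullet>c k)"

lemma symmetric_relD:
  assumes "symmetric_rel m R" "(f, g) \<in> R" "(h, k) \<in> R"
  shows "f \<in> carrier_vec m" "g \<in> carrier_vec m" "g \<bullet>c h = f \<bullet>c k"
  using assms by (auto simp: symmetric_rel_def)

text \<open>Let \<open>u = f - f'\<close> and \<open>v = g - g'\<close>. By symmetry \<open>(v, u)\<close> is real, so the imaginary part of
  \<open>(r, u) = (v, u) - \<zeta> (u, u)\<close> is \<open>- Im \<zeta> \<parallel>u\<parallel>\<^sup>2\<close>, and its modulus is at most \<open>\<parallel>u\<parallel> \<Sum> \<bar>r j\<bar>\<close>.\<close>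

lemma symmetric_rel_estimate:
  assumes sym: "symmetric_rel m R" and R: "(f, g) \<in> R" "(f', g') \<in> R" and "Im \<zeta> \<noteq> 0" "i < m"
    and r: "\<And>j. j < m \<Longrightarrow> (g $v j - g' $v j) - \<zeta> * (f $v j - f' $v j) = r j"
  shows "cmod (f $v i - f' $v i) \<le> (\<Sum>j<m. cmod (r j)) / \<bar>Im \<zeta>\<bar>"
proof -
  note c = symmetric_relD[OF sym R(1,1)] symmetric_relD[OF sym R(2,2)] symmetric_relD[OF sym R] symmetric_relD[OF sym R(2,1)]
  let ?u = "\<lambda>j. f $v j - f' $v j" and ?v = "\<lambda>j. g $v j - g' $v j"
  have "(\<Sum>j<m. ?v j * cnj (?u j)) = (\<Sum>j<m. ?u j * cnj (?v j))"
    using c by (simp add: cscalar_prod_eq_sum[of _ m] algebra_simps sum.distrib sum_subtractf)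
  also have "\<dots> = cnj (\<Sum>j<m. ?v j * cnj (?u j))" by (simp add: mult.commute)
  finally have "Im (\<Sum>j<m. ?v j * cnj (?u j)) = 0"
    by (metis Reals_cnj_iff complex_is_Real_iff)
  moreover have "(\<Sum>j<m. r j * cnj (?u j)) = (\<Sum>j<m. ?v j * cnj (?u j)) - \<zeta> * (\<Sum>j<m. ?u j * cnj (?u j))"
    unfolding sum_distrib_left sum_subtractf[symmetric]
    by (intro sum.cong) (simp_all add: r[symmetric] algebra_simps)
  moreover have "(\<Sum>j<m. ?u j * cnj (?u j)) = complex_of_real (\<Sum>j<m. (cmod (?u j))\<^sup>2)"
    by (simp only: complex_norm_square of_real_sum)
  ultimately have "Im (\<Sum>j<m. r j * cnj (?u j)) = - Im \<zeta> * (\<Sum>j<m. (cmod (?u j))\<^sup>2)" by simp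
  then have 1: "\<bar>Im \<zeta>\<bar> * (\<Sum>j<m. (cmod (?u j))\<^sup>2) \<le> cmod (\<Sum>j<m. r j * cnj (?u j))"
    using abs_Im_le_cmod[of "\<Sum>j<m. r j * cnj (?u j)"] by (simp add: abs_mult sum_nonneg)
  define N where "N = sqrt (\<Sum>j<m. (cmod (?u j))\<^sup>2)"
  have N: "(\<Sum>j<m. (cmod (?u j))\<^sup>2) = N\<^sup>2" "N \<ge> 0" by (auto simp: N_def sum_nonneg)
  have le: "cmod (?u j) \<le> N" if "j < m" for j
    unfolding N_def using that
    by (intro real_le_rsqrt member_le_sum[of j "{..<m}" "\<lambda>j. (cmod (?u j))\<^sup>2"]) auto
  have "cmod (\<Sum>j<m. r j * cnj (?u j)) \<le> (\<Sum>j<m. cmod (r j) * N)"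
    by (intro sum_norm_le) (auto simp: norm_mult intro!: mult_left_mono le simp del: complex_cnj_diff)
  with 1 N have "\<bar>Im \<zeta>\<bar> * N * N \<le> (\<Sum>j<m. cmod (r j)) * N"
    by (simp add: sum_distrib_right power2_eq_square mult.assoc)
  then have "\<bar>Im \<zeta>\<bar> * N \<le> (\<Sum>j<m. cmod (r j))"
    using N(2) by (cases "N = 0") (auto simp: sum_nonneg)
  then have "N \<le> (\<Sum>j<m. cmod (r j)) / \<bar>Im \<zeta>\<bar>" using \<open>Im \<zeta> \<noteq> 0\<close> by (simp add: field_simps)
  then show ?thesis using le[OF \<open>i < m\<close>] by linarith
qed

lemma symmetric_rel_resolvent_unique:
  assumes sym: "symmetric_rel m R" and "(f, g) \<in> R" "(f', g') \<in> R" and "Im \<zeta> \<noteq> 0"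
    and eq: "g - \<zeta> \<cdot>\<^sub>v f = g' - \<zeta> \<cdot>\<^sub>v f'"
  shows "f = f'"
proof (rule eq_vecI)
  have c: "f \<in> carrier_vec m" "g \<in> carrier_vec m" "f' \<in> carrier_vec m" "g' \<in> carrier_vec m"
    using symmetric_relD[OF sym] assms by blast+
  then show "dim_vec f = dim_vec f'" by simp
  fix i assume "i < dim_vec f'"
  then have i: "i < m" using c by simp
  have "(g $v j - g' $v j) - \<zeta> * (f $v j - f' $v j) = 0" if "j < m" for j
    using arg_cong[OF eq, of "\<lambda>v. v $v j"] c that by (simp add: algebra_simps)
  from symmetric_rel_estimate[OF assms(1-4) i this] show "f $v i = f' $v i" by simp
qed

definition total_symmetric_rel :: "nat \<Rightarrow> (complex Matrix.vec \<times> complex Matrix.vec) set \<Rightarrow> bool" where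
  "total_symmetric_rel m R \<longleftrightarrow> symmetric_rel m R \<and> carrier_vec m \<subseteq> Domain R"

text \<open>If \<open>(h, k)\<close> is in the adjoint and \<open>(h, k')\<close> in the relation, then \<open>k\<close> and \<open>k'\<close> have the same inner
  product with every vector.\<close>

lemma total_symmetric_rel_self_adjoint:
  assumes "total_symmetric_rel m R"
  shows "self_adjoint_rel m R"
  unfolding self_adjoint_rel_def
proof (rule subset_antisym; rule subrelI)
  note sym = assms[unfolded total_symmetric_rel_def, THEN conjunct1]
  show "(h, k) \<in> rel_adjoint m R" if "(h, k) \<in> R" for h k
    using symmetric_relD[OF sym] that by (auto simp: rel_adjoint_def)
  fix h k
  assume hk: "(h, k) \<in> rel_adjoint m R"
  then obtain k' where k': "(h, k') \<in> R"
    using assms by (auto simp: rel_adjoint_def total_symmetric_rel_def)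
  have c: "k \<in> carrier_vec m" "k' \<in> carrier_vec m"
    using hk symmetric_relD[OF sym k' k'] by (auto simp: rel_adjoint_def)
  have "k = k'"
  proof (rule eq_vecI)
    fix i assume "i < dim_vec k'"
    then have i: "i < m" using c by simp
    then obtain g where g: "(unit_vec m i, g) \<in> R"
      using assms unit_vec_carrier[of m i] unfolding total_symmetric_rel_def by blast
    have "unit_vec m i \<bullet>c k = unit_vec m i \<bullet>c k'"
      using hk g symmetric_relD(3)[OF sym g k'] by (auto simp: rel_adjoint_def)
    then have "conjugate (k \<bullet>c unit_vec m i) = conjugate (k' \<bullet>c unit_vec m i)"
      using c by (simp add: cscalar_prod_eq_sum[of _ m] mult.commute)
    then show "k $v i = k' $v i" using c i by (simp add: cscalar_prod_unit_vec)
  qed (use c in auto)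
  then show "(h, k) \<in> R" using k' by simp
qed

text \<open>A symmetric relation defined on the whole space is automatically single valued and linear: the
  entries of \<open>g\<close> are the inner products of \<open>f\<close> with the vectors related to the unit vectors.\<close>

lemma total_symmetric_rel_graph:
  assumes "total_symmetric_rel m R"
  obtains B where "B \<in> carrier_mat m m" "R = mat_graph m B"
proof -
  note sym = assms[unfolded total_symmetric_rel_def, THEN conjunct1]
  have "\<forall>i. \<exists>g. i < m \<longrightarrow> (unit_vec m i, g) \<in> R"
    using assms unit_vec_carrier[of m] unfolding total_symmetric_rel_def by blast
  then obtain G where G: "\<And>i. i < m \<Longrightarrow> (unit_vec m i, G i) \<in> R" by metis
  have Gc: "G i \<in> carrier_vec m" if "i < m" for i using symmetric_relD[OF sym G[OF that] G[OF that]] by simp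
  define B where "B = Matrix.mat m m (\<lambda>(i, j). cnj (G i $v j))"
  have B: "B \<in> carrier_mat m m" by (simp add: B_def)
  have gB: "g = B *\<^sub>v f" if "(f, g) \<in> R" for f g
  proof (rule eq_vecI)
    note c = symmetric_relD[OF sym that that]
    show "dim_vec g = dim_vec (B *\<^sub>v f)" using c B by simp
    fix i assume "i < dim_vec (B *\<^sub>v f)"
    then have i: "i < m" using B by simp
    have "g $v i = g \<bullet>c unit_vec m i" using c i by (simp add: cscalar_prod_unit_vec)
    also have "\<dots> = f \<bullet>c G i" by (rule symmetric_relD(3)[OF sym that G[OF i]])
    also have "\<dots> = (B *\<^sub>v f) $v i"
      using c i Gc[OF i] by (simp add: cscalar_prod_eq_sum[of _ m] B_def scalar_prod_def lessThan_atLeast0 mult.commute)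
    finally show "g $v i = (B *\<^sub>v f) $v i" .
  qed
  have "R = mat_graph m B"
  proof (rule subset_antisym; rule subrelI)
    show "(f, g) \<in> mat_graph m B" if "(f, g) \<in> R" for f g
      using gB[OF that] symmetric_relD[OF sym that that] by (auto simp: mat_graph_def)
    fix f g
    assume "(f, g) \<in> mat_graph m B"
    then have "f \<in> carrier_vec m" "g = B *\<^sub>v f" by (auto simp: mat_graph_def)
    moreover from this obtain g' where "(f, g') \<in> R" using assms by (auto simp: total_symmetric_rel_def)
    ultimately show "(f, g) \<in> R" using gB by simp
  qed
  then show ?thesis using that B by blast
qed

text \<open>The resolvent is defined by a description operator; injectivity of \<open>R - \<zeta>\<close> makes the description
  unique, and in finite dimension it also gives surjectivity.\<close>

lemma rel_resolvent_in_rel: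
  assumes R: "total_symmetric_rel m R" and "Im \<zeta> \<noteq> 0" and h: "h \<in> carrier_vec m"
  shows "\<exists>g. (rel_resolvent R \<zeta> h, g) \<in> R \<and> g - \<zeta> \<cdot>\<^sub>v rel_resolvent R \<zeta> h = h"
proof -
  note sym = R[unfolded total_symmetric_rel_def, THEN conjunct1]
  obtain B where B: "B \<in> carrier_mat m m" "R = mat_graph m B"
    using total_symmetric_rel_graph[OF R] .
  let ?A = "B - \<zeta> \<cdot>\<^sub>m 1\<^sub>m m"
  have A: "?A \<in> carrier_mat m m" using B by auto
  have Av: "?A *\<^sub>v v = B *\<^sub>v v - \<zeta> \<cdot>\<^sub>v v" if "v \<in> carrier_vec m" for v
  proof -
    have "(\<zeta> \<cdot>\<^sub>m 1\<^sub>m m) *\<^sub>v v = \<zeta> \<cdot>\<^sub>v v"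
      using that by (intro eq_vecI) auto
    then show ?thesis using B that by (subst minus_mult_distrib_mat_vec[of _ m m]) auto
  qed
  have graph: "(v, B *\<^sub>v v) \<in> R" if "v \<in> carrier_vec m" for v using B that by (auto simp: mat_graph_def)
  have "v = 0\<^sub>v m" if v: "v \<in> carrier_vec m" "?A *\<^sub>v v = 0\<^sub>v m" for v
  proof (rule symmetric_rel_resolvent_unique[OF sym graph[OF v(1)] graph[OF zero_carrier_vec] \<open>Im \<zeta> \<noteq> 0\<close>])
    show "B *\<^sub>v v - \<zeta> \<cdot>\<^sub>v v = B *\<^sub>v 0\<^sub>v m - \<zeta> \<cdot>\<^sub>v 0\<^sub>v m"
      using v Av[OF v(1)] B by (intro eq_vecI) (auto simp: scalar_prod_def)
  qed
  then obtain C where C: "C \<in> carrier_mat m m" "?A * C = 1\<^sub>m m"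
    using mat_inverse_if_kernel_trivial[OF A] by blast
  define f where "f = C *\<^sub>v h"
  have f: "f \<in> carrier_vec m" using C h by (simp add: f_def)
  have "?A *\<^sub>v f = h"
    unfolding f_def by (subst assoc_mult_mat_vec[symmetric, OF A C(1) h]) (use C h in auto)
  then have ex: "(f, B *\<^sub>v f) \<in> R" "B *\<^sub>v f - \<zeta> \<cdot>\<^sub>v f = h" using Av[OF f] graph[OF f] by auto
  have "\<exists>g. (rel_resolvent R \<zeta> h, g) \<in> R \<and> g - \<zeta> \<cdot>\<^sub>v rel_resolvent R \<zeta> h = h"
    unfolding rel_resolvent_def
  proof (rule theI[of "\<lambda>f. \<exists>g. (f, g) \<in> R \<and> g - \<zeta> \<cdot>\<^sub>v f = h" f])
    show "\<exists>g. (f, g) \<in> R \<and> g - \<zeta> \<cdot>\<^sub>v f = h" using ex by blast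
    show "x = f" if "\<exists>g. (x, g) \<in> R \<and> g - \<zeta> \<cdot>\<^sub>v x = h" for x
      using that ex symmetric_rel_resolvent_unique[OF sym _ ex(1) \<open>Im \<zeta> \<noteq> 0\<close>] by fastforce
  qed
  then show ?thesis .
qed

text \<open>If \<open>f\<^sub>0 = (R\<^sub>0 - \<zeta>)\<^sup>-\<^sup>1 h\<close> and \<open>(f\<^sub>0, K x) \<in> R x\<close> approximates \<open>(f\<^sub>0, g\<^sub>0) \<in> R\<^sub>0\<close>, then applying \<open>R x - \<zeta>\<close>
  to the difference of the resolvents at \<open>h\<close> gives \<open>g\<^sub>0 - K x\<close>, which tends to \<open>0\<close>.\<close>

lemma has_strong_resolvent_limitI:
  assumes R: "\<forall>\<^sub>F x in F. total_symmetric_rel m (R x)" and R\<^sub>0: "total_symmetric_rel m R\<^sub>0"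
    and lim: "\<And>h k. (h, k) \<in> R\<^sub>0 \<Longrightarrow> \<exists>K. (\<forall>\<^sub>F x in F. (h, K x) \<in> R x) \<and>
       (\<forall>i<m. ((\<lambda>x. K x $v i) \<longlongrightarrow> k $v i) F)"
  shows "has_strong_resolvent_limit m R R\<^sub>0 F"
  unfolding has_strong_resolvent_limit_def
proof (intro conjI allI impI ballI)
  show "\<forall>\<^sub>F x in F. self_adjoint_rel m (R x)"
    using R
  proof (rule eventually_mono)
    show "self_adjoint_rel m (R x)" if "total_symmetric_rel m (R x)" for x
      using that by (rule total_symmetric_rel_self_adjoint)
  qed
  show "self_adjoint_rel m R\<^sub>0" by (rule total_symmetric_rel_self_adjoint[OF R\<^sub>0])
  fix \<zeta> :: complex and h :: "complex Matrix.vec" and i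
  assume \<zeta>: "Im \<zeta> \<noteq> 0" and h: "h \<in> carrier_vec m" and i: "i < m"
  define f\<^sub>0 where "f\<^sub>0 = rel_resolvent R\<^sub>0 \<zeta> h"
  obtain g\<^sub>0 where g\<^sub>0: "(f\<^sub>0, g\<^sub>0) \<in> R\<^sub>0" "g\<^sub>0 - \<zeta> \<cdot>\<^sub>v f\<^sub>0 = h"
    using rel_resolvent_in_rel[OF R\<^sub>0 \<zeta> h] by (auto simp: f\<^sub>0_def)
  have c0: "f\<^sub>0 \<in> carrier_vec m" "g\<^sub>0 \<in> carrier_vec m"
    using R\<^sub>0 g\<^sub>0 by (auto simp: total_symmetric_rel_def symmetric_rel_def)
  obtain K where K: "\<forall>\<^sub>F x in F. (f\<^sub>0, K x) \<in> R x" "\<And>i. i < m \<Longrightarrow> ((\<lambda>x. K x $v i) \<longlongrightarrow> g\<^sub>0 $v i) F"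
    using lim[OF g\<^sub>0(1)] by blast
  let ?e = "\<lambda>x. (\<Sum>j<m. cmod (g\<^sub>0 $v j - K x $v j)) / \<bar>Im \<zeta>\<bar>"
  have e: "(?e \<longlongrightarrow> (\<Sum>j<m. cmod (g\<^sub>0 $v j - g\<^sub>0 $v j)) / \<bar>Im \<zeta>\<bar>) F"
    using \<zeta> by (intro tendsto_intros K) auto
  have "\<forall>\<^sub>F x in F. cmod (rel_resolvent (R x) \<zeta> h $v i - f\<^sub>0 $v i) \<le> ?e x"
    using R K(1)
  proof eventually_elim
    case (elim x)
    let ?f = "rel_resolvent (R x) \<zeta> h"
    obtain g where g: "(?f, g) \<in> R x" "g - \<zeta> \<cdot>\<^sub>v ?f = h"
      using rel_resolvent_in_rel[OF elim(1) \<zeta> h] by blast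
    have sym: "symmetric_rel m (R x)" using elim by (simp add: total_symmetric_rel_def)
    show ?case
    proof (rule symmetric_rel_estimate[OF sym g(1) elim(2) \<zeta> i])
      fix j assume "j < m"
      then show "g $v j - K x $v j - \<zeta> * (?f $v j - f\<^sub>0 $v j) = g\<^sub>0 $v j - K x $v j"
        using arg_cong[OF g(2), of "\<lambda>v. v $v j"] arg_cong[OF g\<^sub>0(2), of "\<lambda>v. v $v j"]
          symmetric_relD[OF sym g(1) g(1)] c0 by (simp add: algebra_simps)
    qed
  qed
  then have "((\<lambda>x. rel_resolvent (R x) \<zeta> h $v i - f\<^sub>0 $v i) \<longlongrightarrow> 0) F"
    by (rule Lim_null_comparison) (use e in simp)
  then show "((\<lambda>x. rel_resolvent (R x) \<zeta> h $v i) \<longlongrightarrow> rel_resolvent R\<^sub>0 \<zeta> h $v i) F"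
    unfolding f\<^sub>0_def by (rule LIM_zero_cancel)
qed

text \<open>An element \<open>(f, g)\<close> of \<open>R\<^sub>1\<close> is recovered from \<open>h = g - \<i> f\<close> through the resolvent, which is the same
  for \<open>R\<^sub>0\<close>; so \<open>R\<^sub>1 \<subseteq> R\<^sub>0\<close>. Taking adjoints reverses the inclusion.\<close>

lemma strong_resolvent_limit_unique:
  assumes lim0: "has_strong_resolvent_limit m R R\<^sub>0 F" and R\<^sub>0: "total_symmetric_rel m R\<^sub>0"
    and lim1: "has_strong_resolvent_limit m R R\<^sub>1 F" and F: "F \<noteq> bot"
  shows "R\<^sub>1 = R\<^sub>0"
proof
  note sym0 = R\<^sub>0[unfolded total_symmetric_rel_def, THEN conjunct1]
  have sa: "rel_adjoint m R\<^sub>1 = R\<^sub>1" "rel_adjoint m R\<^sub>0 = R\<^sub>0"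
    using lim0 lim1 by (auto simp: has_strong_resolvent_limit_def self_adjoint_rel_def)
  have sym1: "symmetric_rel m R\<^sub>1"
    using sa(1) unfolding symmetric_rel_def rel_adjoint_def by fastforce
  show sub: "R\<^sub>1 \<subseteq> R\<^sub>0"
  proof clarify
    fix f g assume fg: "(f, g) \<in> R\<^sub>1"
    have c: "f \<in> carrier_vec m" "g \<in> carrier_vec m" using symmetric_relD[OF sym1 fg fg] by auto
    \<comment> \<open>Any non-real point of evaluation would do.\<close>
    define h where "h = g - \<i> \<cdot>\<^sub>v f"
    have h: "h \<in> carrier_vec m" using c by (simp add: h_def)
    have Im: "Im \<i> \<noteq> 0" by simp
    have "rel_resolvent R\<^sub>1 \<i> h = f"
      unfolding rel_resolvent_def
    proof (rule the_equality)
      show "\<exists>g. (f, g) \<in> R\<^sub>1 \<and> g - \<i> \<cdot>\<^sub>v f = h" using fg h_def by blast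
      show "x = f" if "\<exists>g. (x, g) \<in> R\<^sub>1 \<and> g - \<i> \<cdot>\<^sub>v x = h" for x
        using that symmetric_rel_resolvent_unique[OF sym1 _ fg Im] h_def by blast
    qed
    moreover have "rel_resolvent R\<^sub>1 \<i> h $v i = rel_resolvent R\<^sub>0 \<i> h $v i" if "i < m" for i
      using lim0 lim1 that h Im F unfolding has_strong_resolvent_limit_def by (metis tendsto_unique)
    moreover obtain g' where g': "(rel_resolvent R\<^sub>0 \<i> h, g') \<in> R\<^sub>0" "g' - \<i> \<cdot>\<^sub>v rel_resolvent R\<^sub>0 \<i> h = h"
      using rel_resolvent_in_rel[OF R\<^sub>0 Im h] by blast
    moreover have c': "rel_resolvent R\<^sub>0 \<i> h \<in> carrier_vec m" "g' \<in> carrier_vec m"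
      using symmetric_relD[OF sym0 g'(1) g'(1)] by auto
    ultimately have f: "rel_resolvent R\<^sub>0 \<i> h = f" using c by (intro eq_vecI) auto
    have "g' = g"
    proof (rule eq_vecI)
      fix i assume "i < dim_vec g"
      then show "g' $v i = g $v i"
        using arg_cong[OF g'(2), of "\<lambda>v. v $v i"] c c' unfolding f by (simp add: h_def)
    qed (use c c' in auto)
    then show "(f, g) \<in> R\<^sub>0" using g' f by simp
  qed
  show "R\<^sub>0 \<subseteq> R\<^sub>1"
    using sub sa unfolding rel_adjoint_def by blast
qed

lemma mat_graph_unique:
  assumes "B \<in> carrier_mat m m" "C \<in> carrier_mat m m" "mat_graph m B \<subseteq> mat_graph m C"
  shows "mat_graph m B = mat_graph m C"
  using assms by (fastforce simp: mat_graph_def)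

text \<open>Compare the entries by applying the symmetry to pairs of unit vectors.\<close>

lemma mat_adjoint_eq_if_graph_symmetric:
  assumes B: "B \<in> carrier_mat m m" and sym: "symmetric_rel m (mat_graph m B)"
  shows "mat_adjoint B = B"
proof (rule eq_matI)
  show dim: "dim_row (mat_adjoint B) = dim_row B" "dim_col (mat_adjoint B) = dim_col B"
    using B by (auto simp: mat_adjoint_def)
  fix i j assume "i < dim_row B" "j < dim_col B"
  then have i: "i < m" and j: "j < m" using B by auto
  have col: "(B *\<^sub>v unit_vec m j) $v i = B $$ (i, j)" if "i < m" "j < m" for i j
    using B that by simp
  have graph: "(unit_vec m j, B *\<^sub>v unit_vec m j) \<in> mat_graph m B" for j
    by (auto simp: mat_graph_def)
  have carr: "B *\<^sub>v unit_vec m j \<in> carrier_vec m" for j using B by simp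
  have "B $$ (i, j) = (B *\<^sub>v unit_vec m j) \<bullet>c unit_vec m i"
    using i j by (simp add: cscalar_prod_unit_vec[OF carr] col del: index_mult_mat_vec)
  also have "\<dots> = unit_vec m j \<bullet>c (B *\<^sub>v unit_vec m i)"
    by (rule symmetric_relD(3)[OF sym graph graph])
  also have "\<dots> = cnj ((B *\<^sub>v unit_vec m i) \<bullet>c unit_vec m j)"
    using carr[of i] by (simp add: cscalar_prod_eq_sum[of _ m] mult.commute del: index_mult_mat_vec)
  also have "\<dots> = cnj (B $$ (j, i))"
    using i j by (simp add: cscalar_prod_unit_vec[OF carr] col del: index_mult_mat_vec)
  finally show "mat_adjoint B $$ (i, j) = B $$ (i, j)"
    using B i j by (simp add: mat_adjoint_def mat_of_rows_def cols_nth)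
qed

section \<open>The Weyl function and its limit at zero\<close>

lemma weyl_function_eq:
  "weyl_function T \<Gamma>\<^sub>0 \<Gamma>\<^sub>1 z = {(\<Gamma>\<^sub>0 f, \<Gamma>\<^sub>1 f) | f. (f, \<lambda>t. z * f t) \<in> T}"
  by (auto simp: weyl_function_def gamma_field_def defect_space_def)

text \<open>For \<open>x = 0\<close> this includes the relation that will turn out to be the limit.\<close>

lemma weyl_function_total_symmetric:
  assumes ab: "a < b" and n: "n \<ge> 1" and x: "x \<le> 0"
  shows "total_symmetric_rel (2 * n) (weyl_function (maximal_operator a b n) (Gamma0 a b n) (Gamma1 a b n) (complex_of_real x))"
  unfolding total_symmetric_rel_def symmetric_rel_def weyl_function_eq
proof (intro conjI subsetI)
  let ?R = "{(Gamma0 a b n f, Gamma1 a b n f) | f. (f, \<lambda>t. complex_of_real x * f t) \<in> maximal_operator a b n}"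
  show "p \<in> carrier_vec (2 * n) \<times> carrier_vec (2 * n)" if "p \<in> ?R" for p
    using that by (auto simp: Gamma0_def Gamma1_def)
  have "Gamma1 a b n f \<bullet>c Gamma0 a b n h = Gamma0 a b n f \<bullet>c Gamma1 a b n h"
    if "(f, \<lambda>t. complex_of_real x * f t) \<in> maximal_operator a b n" "(h, \<lambda>t. complex_of_real x * h t) \<in> maximal_operator a b n" for f h
    using green_identity[OF that ab n] by (simp add: L2_inner_cmult_left L2_inner_cmult_right)
  then show "\<forall>(f, g)\<in>?R. \<forall>(h, k)\<in>?R. g \<bullet>c h = f \<bullet>c k" by auto
  fix h :: "complex Matrix.vec" assume "h \<in> carrier_vec (2 * n)"
  from boundary_value_problem_solvable[OF L2_continuous[OF continuous_on_const] ab n x this, of 0]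
  obtain f where "(f, \<lambda>t. complex_of_real x * f t) \<in> maximal_operator a b n" "Gamma0 a b n f = h" by auto
  then show "h \<in> Domain ?R" by blast
qed

text \<open>With \<open>u = w x - f\<close>, where \<open>w x\<close> and \<open>f\<close> have the same boundary vector and solve the equations with
  parameters \<open>x\<close> and \<open>0\<close>, the lower bound of the Dirichlet operator gives \<open>\<parallel>u\<parallel> \<le> \<parallel>f\<parallel>\<close> uniformly in
  \<open>x < 0\<close>. The Green identity with the null solution \<open>g\<close> that has the \<open>i\<close>-th unit vector as boundary
  vector extracts the \<open>i\<close>-th entry of \<open>\<Gamma>\<^sub>1 u\<close> as \<open>x (w x, g)\<close>.\<close>

lemma weyl_function_tendsto_0:
  assumes ab: "a < b" and n: "n \<ge> 1"
  defines "M \<equiv> weyl_function (maximal_operator a b n) (Gamma0 a b n) (Gamma1 a b n)"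
  assumes hk: "(h, k) \<in> M 0"
  shows "\<exists>K. (\<forall>\<^sub>F x in at_left 0. (h, K x) \<in> M (complex_of_real x)) \<and> (\<forall>i<2 * n. ((\<lambda>x. K x $v i) \<longlongrightarrow> k $v i) (at_left 0))"
proof -
  let ?A = "maximal_operator a b n"
  obtain f where f: "(f, \<lambda>t. 0) \<in> ?A" "h = Gamma0 a b n f" "k = Gamma1 a b n f"
    using hk by (auto simp: M_def weyl_function_eq)
  have carr: "Gamma0 a b n f \<in> carrier_vec (2 * n)" "Gamma1 a b n f \<in> carrier_vec (2 * n)" for f
    by (simp_all add: Gamma0_def Gamma1_def)
  have "\<exists>w. (w, \<lambda>t. complex_of_real x * w t) \<in> ?A \<and> Gamma0 a b n w = h" if "x < 0" for x
    using boundary_value_problem_solvable[OF L2_0 ab n, of x h] that f carr by force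
  then obtain w where w: "\<And>x. x < 0 \<Longrightarrow> (w x, \<lambda>t. complex_of_real x * w x t) \<in> ?A" "\<And>x. x < 0 \<Longrightarrow> Gamma0 a b n (w x) = h"
    by metis
  define K where "K x = Gamma1 a b n (w x)" for x
  have neg: "\<forall>\<^sub>F x in at_left (0::real). x < 0" by (simp add: eventually_at_filter)
  have "\<forall>\<^sub>F x in at_left 0. (h, K x) \<in> M (complex_of_real x)"
    using neg by (rule eventually_mono) (use w in \<open>auto simp: M_def weyl_function_eq K_def\<close>)
  moreover have "((\<lambda>x. K x $v i) \<longlongrightarrow> k $v i) (at_left 0)" if i: "i < 2 * n" for i
  proof -
    obtain g where g: "(g, \<lambda>t. 0) \<in> ?A" "Gamma0 a b n g = unit_vec (2 * n) i"
      using boundary_value_problem_solvable[OF L2_0 ab n order_refl, of "unit_vec (2 * n) i"] by auto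
    let ?c = "2 * L2_norm a b f * L2_norm a b g"
    have bound: "norm (K x $v i - k $v i) \<le> \<bar>x\<bar> * ?c" if x: "x < 0" for x
    proof -
      define u where "u = (\<lambda>t. w x t + (- 1) * f t)"
      note wA = w(1)[OF x]
      have uA: "(u, \<lambda>t. complex_of_real x * w x t) \<in> ?A"
        using maximal_operator_linear_combination[OF wA f(1) ab, of "- 1"] by (simp add: u_def)
      have sob: "w x \<in> sobolev_space a b (2 * n)" "f \<in> sobolev_space a b (2 * n)"
        using wA f(1) by (auto simp: maximal_operator_def)
      have Gu: "Gamma0 a b n u = h + (- 1) \<cdot>\<^sub>v h" "Gamma1 a b n u = K x + (- 1) \<cdot>\<^sub>v k"
        unfolding u_def using Gamma_linear_combination[OF sob ab, of "- 1"] f(2,3) w(2)[OF x] by (auto simp: K_def)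
      have hc: "h \<in> carrier_vec (2 * n)" "k \<in> carrier_vec (2 * n)" "K x \<in> carrier_vec (2 * n)"
        using carr f by (simp_all add: K_def)
      have G0: "Gamma0 a b n u = 0\<^sub>v (2 * n)" using hc unfolding Gu by (intro eq_vecI) auto
      have L: "u \<in> L2 a b" "f \<in> L2 a b" "g \<in> L2 a b" "w x \<in> L2 a b"
        using maximal_operatorD[OF uA ab] maximal_operatorD[OF f(1) ab] maximal_operatorD[OF g(1) ab] maximal_operatorD[OF wA ab] by auto
      have "L2_norm a b u \<le> L2_norm a b (\<lambda>t. complex_of_real x * w x t - complex_of_real x * u t) / (- x)"
        by (rule dirichlet_operator_bounded_below[OF uA G0 ab n x])
      also have "(\<lambda>t. complex_of_real x * w x t - complex_of_real x * u t) = (\<lambda>t. complex_of_real x * f t)"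
        by (simp add: u_def algebra_simps)
      also have "L2_norm a b (\<lambda>t. complex_of_real x * f t) / (- x) = L2_norm a b f"
      proof -
        have "complex_of_real ((L2_norm a b (\<lambda>t. complex_of_real x * f t))\<^sup>2) = complex_of_real ((\<bar>x\<bar> * L2_norm a b f)\<^sup>2)"
        proof -
          have "(\<bar>x\<bar> * L2_norm a b f)\<^sup>2 = x * (x * (L2_norm a b f)\<^sup>2)"
            by (simp add: power_mult_distrib) (simp add: power2_eq_square)
          then show ?thesis
            unfolding L2_inner_self[symmetric] L2_inner_cmult_left L2_inner_cmult_right by (simp add: L2_inner_self)
        qed
        then have "L2_norm a b (\<lambda>t. complex_of_real x * f t) = \<bar>x\<bar> * L2_norm a b f"
          by (simp only: of_real_eq_iff power2_eq_iff_nonneg L2_norm_nonneg mult_nonneg_nonneg abs_ge_zero)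
        then show ?thesis using x by simp
      qed
      finally have un: "L2_norm a b u \<le> L2_norm a b f" .
      have "K x $v i - k $v i = Gamma1 a b n u \<bullet>c Gamma0 a b n g"
        unfolding g(2) using hc i by (simp add: cscalar_prod_unit_vec Gu)
      also have "\<dots> = L2_inner a b (\<lambda>t. complex_of_real x * w x t) g - L2_inner a b u (\<lambda>t. 0)"
        using green_identity[OF uA g(1) ab n] carr[of g] by (simp add: G0)
      also have "\<dots> = complex_of_real x * L2_inner a b (w x) g"
        unfolding L2_inner_cmult_left by (simp add: L2_inner_def)
      also have "w x = (\<lambda>t. u t + 1 * f t)" by (simp add: u_def)
      also have "L2_inner a b (\<lambda>t. u t + 1 * f t) g = L2_inner a b u g + 1 * L2_inner a b f g"
        by (rule L2_inner_linear_combination_left) (use L in auto)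
      finally have "norm (K x $v i - k $v i) = \<bar>x\<bar> * norm (L2_inner a b u g + L2_inner a b f g)"
        by (simp add: norm_mult)
      also have "\<dots> \<le> \<bar>x\<bar> * (L2_norm a b u * L2_norm a b g + L2_norm a b f * L2_norm a b g)"
        using L by (intro mult_left_mono order_trans[OF norm_triangle_ineq] add_mono L2_Cauchy_Schwarz) auto
      also have "\<dots> \<le> \<bar>x\<bar> * (L2_norm a b f * L2_norm a b g + L2_norm a b f * L2_norm a b g)"
        by (intro mult_left_mono add_mono mult_right_mono un) auto
      finally show ?thesis by (simp add: algebra_simps)
    qed
    have "((\<lambda>x. K x $v i - k $v i) \<longlongrightarrow> 0) (at_left 0)"
    proof (rule Lim_null_comparison)
      show "\<forall>\<^sub>F x in at_left 0. norm (K x $v i - k $v i) \<le> \<bar>x\<bar> * ?c"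
        using neg by (rule eventually_mono) (use bound in auto)
      have "((\<lambda>x. \<bar>x\<bar> * ?c) \<longlongrightarrow> \<bar>0\<bar> * ?c) (at_left (0::real))" by (intro tendsto_intros)
      then show "((\<lambda>x. \<bar>x\<bar> * ?c) \<longlongrightarrow> 0) (at_left (0::real))" by simp
    qed
    then show ?thesis by (rule LIM_zero_cancel)
  qed
  ultimately show ?thesis by blast
qed

text \<open>The vector \<open>s\<close> lists the derivatives of orders \<open>2n - 1, \<dots>, n\<close> at \<open>a\<close> of the polynomial of degree less
  than \<open>2n\<close> whose derivatives of orders \<open>0, \<dots>, n - 1\<close> are \<open>\<alpha>\<close> at \<open>a\<close> and \<open>\<beta>\<close> at \<open>b\<close>; it is the common
  factor in the rows of \<open>B\<^sub>K\<close>.\<close>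

lemma B_K_mult_vec:
  assumes V: "V \<in> carrier_mat n n" "mat_inverse (T2_mat a b n) = Some V"
    and \<alpha>: "\<alpha> \<in> carrier_vec n" "\<beta> \<in> carrier_vec n"
  defines "s \<equiv> V *\<^sub>v (S_mat n *\<^sub>v \<beta> - T1_mat a b n *\<^sub>v (S_mat n *\<^sub>v \<alpha>))"
  shows "B_K a b n *\<^sub>v (\<alpha> @\<^sub>v \<beta>) = (- (Q_mat n *\<^sub>v s)) @\<^sub>v (Q_mat n *\<^sub>v (T1_mat a b n *\<^sub>v s))"
proof -
  let ?Q = "Q_mat n" and ?S = "S_mat n" and ?T = "T1_mat a b n"
  have c: "?Q \<in> carrier_mat n n" "?S \<in> carrier_mat n n" "?T \<in> carrier_mat n n"
    by (simp_all add: Q_mat_def S_mat_def T1_mat_def)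
  note as = assoc_mult_mat_vec[of _ n n _ n]
  have s: "s = V *\<^sub>v (?S *\<^sub>v \<beta>) - V *\<^sub>v (?T *\<^sub>v (?S *\<^sub>v \<alpha>))"
    unfolding s_def using c V(1) \<alpha> by (intro mult_minus_distrib_mat_vec[of _ n n]) auto
  have neg: "(- A) *\<^sub>v x = - (A *\<^sub>v x)" if "A \<in> carrier_mat n n" "x \<in> carrier_vec n" for A :: "complex mat" and x
    using that by (intro eq_vecI) (auto simp: scalar_prod_def sum_negf)
  have minus: "- (x - y) = y + - x" "- x + y = y - x" if "x \<in> carrier_vec n" "y \<in> carrier_vec n" for x y :: "complex Matrix.vec"
    using that by (intro eq_vecI; simp)+
  have "B_K a b n *\<^sub>v (\<alpha> @\<^sub>v \<beta>) =
     ((?Q * V * ?T * ?S) *\<^sub>v \<alpha> + (- (?Q * V * ?S)) *\<^sub>v \<beta>) @\<^sub>v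
     ((- (?Q * ?T * V * ?T * ?S)) *\<^sub>v \<alpha> + (?Q * ?T * V * ?S) *\<^sub>v \<beta>)"
    unfolding B_K_def Let_def V(2) option.sel
    using c V(1) \<alpha> by (intro four_block_mat_mult_vec[of _ n n _ n _ n]) auto
  also have "(?Q * V * ?T * ?S) *\<^sub>v \<alpha> + (- (?Q * V * ?S)) *\<^sub>v \<beta> = - (?Q *\<^sub>v s)"
  proof -
    have "(?Q * V * ?T * ?S) *\<^sub>v \<alpha> = ?Q *\<^sub>v (V *\<^sub>v (?T *\<^sub>v (?S *\<^sub>v \<alpha>)))" "(?Q * V * ?S) *\<^sub>v \<beta> = ?Q *\<^sub>v (V *\<^sub>v (?S *\<^sub>v \<beta>))"
      using c V(1) \<alpha> by (simp_all add: as)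
    moreover have "?Q *\<^sub>v s = ?Q *\<^sub>v (V *\<^sub>v (?S *\<^sub>v \<beta>)) - ?Q *\<^sub>v (V *\<^sub>v (?T *\<^sub>v (?S *\<^sub>v \<alpha>)))"
      unfolding s using c V(1) \<alpha> by (intro mult_minus_distrib_mat_vec[of _ n n]) auto
    ultimately show ?thesis using c V(1) \<alpha> by (simp add: neg minus)
  qed
  also have "(- (?Q * ?T * V * ?T * ?S)) *\<^sub>v \<alpha> + (?Q * ?T * V * ?S) *\<^sub>v \<beta> = ?Q *\<^sub>v (?T *\<^sub>v s)"
  proof -
    have "(?Q * ?T * V * ?T * ?S) *\<^sub>v \<alpha> = ?Q *\<^sub>v (?T *\<^sub>v (V *\<^sub>v (?T *\<^sub>v (?S *\<^sub>v \<alpha>))))" "(?Q * ?T * V * ?S) *\<^sub>v \<beta> = ?Q *\<^sub>v (?T *\<^sub>v (V *\<^sub>v (?S *\<^sub>v \<beta>)))"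
      using c V(1) \<alpha> by (simp_all add: as assoc_mult_mat[of _ n n _ n _ n])
    moreover have "?Q *\<^sub>v (?T *\<^sub>v s) = ?Q *\<^sub>v (?T *\<^sub>v (V *\<^sub>v (?S *\<^sub>v \<beta>))) - ?Q *\<^sub>v (?T *\<^sub>v (V *\<^sub>v (?T *\<^sub>v (?S *\<^sub>v \<alpha>))))"
      unfolding s using c V(1) \<alpha> by (simp add: mult_minus_distrib_mat_vec[of _ n n])
    ultimately show ?thesis using c V(1) \<alpha> by (simp add: neg minus)
  qed
  finally show ?thesis .
qed

text \<open>For \<open>h = (\<alpha>, \<beta>)\<close> the polynomial \<open>e\<close> with Taylor coefficients \<open>u = S \<alpha>\<close> and \<open>s = T\<^sub>2\<^sup>-\<^sup>1 (w - T\<^sub>1 u)\<close> at \<open>a\<close>,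
  both listed by decreasing order, is a null solution. Its Taylor expansion at \<open>b\<close> gives
  \<open>T\<^sub>1 u + T\<^sub>2 s = w = S \<beta>\<close> for the derivatives of order less than \<open>n\<close>, so \<open>\<Gamma>\<^sub>0 e = h\<close>, and \<open>T\<^sub>1 s\<close> for the
  others. Together with \<open>s\<close> these are, up to the signs in \<open>Q\<close>, the entries of \<open>\<Gamma>\<^sub>1 e\<close>.\<close>

lemma graph_B_K_subset_weyl_function:
  assumes ab: "a < b" and n: "n \<ge> 1"
  shows "mat_graph (2 * n) (B_K a b n) \<subseteq> weyl_function (maximal_operator a b n) (Gamma0 a b n) (Gamma1 a b n) 0"
proof (rule subrelI)
  fix h k assume "(h, k) \<in> mat_graph (2 * n) (B_K a b n)"
  then have h: "h \<in> carrier_vec (2 * n)" and k: "k = B_K a b n *\<^sub>v h" by (auto simp: mat_graph_def)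
  obtain V where V: "V \<in> carrier_mat n n" "mat_inverse (T2_mat a b n) = Some V" "T2_mat a b n * V = 1\<^sub>m n"
    using T2_mat_inverse[OF ab n] by blast
  define \<alpha> \<beta> where "\<alpha> = Matrix.vec n (\<lambda>i. h $v i)" and "\<beta> = Matrix.vec n (\<lambda>i. h $v (n + i))"
  have ab_c: "\<alpha> \<in> carrier_vec n" "\<beta> \<in> carrier_vec n" by (simp_all add: \<alpha>_def \<beta>_def)
  have h_eq: "h = \<alpha> @\<^sub>v \<beta>" using h by (intro eq_vecI) (auto simp: \<alpha>_def \<beta>_def)
  define u where "u = S_mat n *\<^sub>v \<alpha>"
  define w where "w = S_mat n *\<^sub>v \<beta>"
  define s where "s = V *\<^sub>v (w - T1_mat a b n *\<^sub>v u)"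
  have S: "S_mat n \<in> carrier_mat n n" and T1: "T1_mat a b n \<in> carrier_mat n n" and T2: "T2_mat a b n \<in> carrier_mat n n"
    by (simp_all add: S_mat_def T1_mat_def T2_mat_def)
  have c: "u \<in> carrier_vec n" "w \<in> carrier_vec n" "s \<in> carrier_vec n"
    using S V(1) T1 ab_c by (auto simp: u_def w_def s_def)
  have flip: "(S_mat n *\<^sub>v v) $v j = v $v (n - Suc j)" if "v \<in> carrier_vec n" "j < n" for v j
  proof -
    have "(S_mat n *\<^sub>v v) $v j = (\<Sum>i<n. (if j + 1 + (i + 1) = n + 1 then 1 else 0) * v $v i)"
      using that by (simp add: S_mat_def scalar_prod_def lessThan_atLeast0)
    also have "\<dots> = (\<Sum>i<n. if i = n - Suc j then v $v i else 0)"
      using that by (intro sum.cong) auto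
    finally show ?thesis using that by simp
  qed
  have "T2_mat a b n *\<^sub>v s = w - T1_mat a b n *\<^sub>v u"
    unfolding s_def using V c T1 T2 by (subst assoc_mult_mat_vec[symmetric, of _ n n _ n]) auto
  then have w_eq: "w $v j = (T1_mat a b n *\<^sub>v u) $v j + (T2_mat a b n *\<^sub>v s) $v j" if "j < n" for j
    using that c T1 by (simp del: index_mult_mat_vec)
  define e where "e = (\<lambda>j x. (\<Sum>k<n. u $v k * taylor_monomial a (n - 1 - k) j x) + 1 * (\<Sum>k<n. s $v k * taylor_monomial a (2 * n - 1 - k) j x))"
  have jet: "jet_on a b m e" for m
    unfolding e_def by (intro jet_on_linear_combination jet_on_sum jet_on_taylor_monomial)
  have zero: "taylor_monomial a r j x = 0" if "r < j" for r j x using that by (simp add: taylor_monomial_def)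
  have ea: "e (n - Suc j) a = u $v j" "e (2 * n - Suc j) a = s $v j" if "j < n" for j
  proof -
    have "(\<Sum>k<n. u $v k * taylor_monomial a (n - 1 - k) (n - Suc j) a) = (\<Sum>k<n. if k = j then u $v k else 0)"
      using that by (intro sum.cong) (auto simp: taylor_monomial_at_base)
    moreover have "(\<Sum>k<n. s $v k * taylor_monomial a (2 * n - 1 - k) (n - Suc j) a) = 0"
      using that by (intro sum.neutral) (auto simp: taylor_monomial_at_base)
    ultimately show "e (n - Suc j) a = u $v j" using that by (simp add: e_def)
    have "(\<Sum>k<n. u $v k * taylor_monomial a (n - 1 - k) (2 * n - Suc j) a) = 0"
      using that by (intro sum.neutral) (auto simp: taylor_monomial_at_base)
    moreover have "(\<Sum>k<n. s $v k * taylor_monomial a (2 * n - 1 - k) (2 * n - Suc j) a) = (\<Sum>k<n. if k = j then s $v k else 0)"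
      using that by (intro sum.cong) (auto simp: taylor_monomial_at_base)
    ultimately show "e (2 * n - Suc j) a = s $v j" using that by (simp add: e_def)
  qed
  have eb: "e (n - Suc j) b = w $v j" "e (2 * n - Suc j) b = (T1_mat a b n *\<^sub>v s) $v j" if j: "j < n" for j
  proof -
    show "e (n - Suc j) b = w $v j"
      unfolding w_eq[OF j] T2_mat_mult_vec[OF c(3) j] using T1_mat_mult_vec[OF c(1) j, of "n - 1"] by (simp add: e_def del: index_mult_mat_vec)
    have "(\<Sum>k<n. u $v k * taylor_monomial a (n - 1 - k) (2 * n - Suc j) b) = 0"
      using j by (intro sum.neutral) (auto simp: zero)
    then show "e (2 * n - Suc j) b = (T1_mat a b n *\<^sub>v s) $v j"
      using T1_mat_mult_vec[OF c(3) j, of "2 * n - 1"] j by (simp add: e_def del: index_mult_mat_vec)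
  qed
  have top: "e (2 * n) = (\<lambda>x. 0)"
    by (auto simp: e_def fun_eq_iff zero intro!: sum.neutral)
  have cont: "e 0 \<in> L2 a b" using jet_on_continuous[OF jet[of 1]] by (intro L2_continuous) auto
  have sj: "sobolev_jet a b (2 * n) (e 0) e"
    unfolding sobolev_jet_iff using jet cont L2_0 by (simp add: top)
  have "(e 0, \<lambda>t. 0 * e 0 t) \<in> maximal_operator a b n"
    unfolding maximal_operator_iff[OF ab] using sj L2_0 by (auto simp: top intro!: exI[of _ e])
  moreover have "Gamma0 a b n (e 0) = h"
    unfolding Gamma_eq_boundary_values[OF sj ab]
  proof (rule eq_vecI)
    fix i assume "i < dim_vec h"
    then have i: "i < 2 * n" using h by simp
    show "boundary_values a b n e $v i = h $v i"
    proof (cases "i < n")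
      case True
      then have "n - Suc (n - Suc i) = i" "n - Suc i < n" by auto
      then show ?thesis using ea(1)[of "n - Suc i"] i True flip[OF ab_c(1), of "n - Suc i"]
        by (simp add: boundary_values_def u_def \<alpha>_def del: index_mult_mat_vec)
    next
      case False
      then have "n - Suc (n - Suc (i - n)) = i - n" "n - Suc (i - n) < n" "n + (i - n) = i" "i - n < n" using i by auto
      then show ?thesis using eb(1)[of "n - Suc (i - n)"] i False flip[OF ab_c(2), of "n - Suc (i - n)"]
        by (simp add: boundary_values_def w_def \<beta>_def del: index_mult_mat_vec)
    qed
  qed (use h in \<open>simp add: boundary_values_def\<close>)
  moreover have "Gamma1 a b n (e 0) = k"
    unfolding Gamma_eq_boundary_values[OF sj ab] k h_eq B_K_mult_vec[OF V(1,2) ab_c] u_def[symmetric] w_def[symmetric] s_def[symmetric]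
  proof (rule eq_vecI)
    have Qv: "(Q_mat n *\<^sub>v v) $v j = (- 1) ^ (n - j) * v $v j" if "v \<in> carrier_vec n" "j < n" for v j
    proof -
      have "(Q_mat n *\<^sub>v v) $v j = (\<Sum>i<n. (if j = i then (- 1) ^ (n - j) else 0) * v $v i)"
        using that by (simp add: Q_mat_def scalar_prod_def lessThan_atLeast0)
      also have "\<dots> = (\<Sum>i<n. if i = j then (- 1) ^ (n - j) * v $v i else 0)"
        by (intro sum.cong) auto
      finally show ?thesis using that by simp
    qed
    have Qc: "Q_mat n \<in> carrier_mat n n" by (simp add: Q_mat_def)
    let ?r = "(- (Q_mat n *\<^sub>v s)) @\<^sub>v (Q_mat n *\<^sub>v (T1_mat a b n *\<^sub>v s))"
    show "dim_vec (conormal_values a b n e) = dim_vec ?r" using Qc by (simp add: conormal_values_def)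
    fix i assume "i < dim_vec ?r"
    then have i: "i < 2 * n" using Qc by simp
    show "conormal_values a b n e $v i = ?r $v i"
    proof (cases "i < n")
      case True
      then have "n - i = Suc (n - Suc i)" by simp
      then show ?thesis using True i Qc Qv[OF c(3) True] ea(2)[OF True]
        by (simp add: conormal_values_def del: index_mult_mat_vec)
    next
      case False
      then have l: "i - n < n" using i by simp
      have Tc: "T1_mat a b n *\<^sub>v s \<in> carrier_vec n" using T1 c by simp
      show ?thesis using False i Qc Qv[OF Tc l] eb(2)[OF l]
        by (simp add: conormal_values_def del: index_mult_mat_vec)
    qed
  qed
  ultimately show "(h, k) \<in> weyl_function (maximal_operator a b n) (Gamma0 a b n) (Gamma1 a b n) 0"
    unfolding weyl_function_eq by blast
qed

text \<open>The Weyl function at \<open>0\<close> is itself the graph of a matrix, so containing the graph of \<open>B\<^sub>K\<close> it is equal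
  to it, and it hands its symmetry to \<open>B\<^sub>K\<close>.\<close>

lemma weyl_function_0:
  assumes ab: "a < b" and n: "n \<ge> 1"
  shows "weyl_function (maximal_operator a b n) (Gamma0 a b n) (Gamma1 a b n) 0 = mat_graph (2 * n) (B_K a b n)"
    and "mat_adjoint (B_K a b n) = B_K a b n"
proof -
  let ?M = "weyl_function (maximal_operator a b n) (Gamma0 a b n) (Gamma1 a b n) 0"
  have tot: "total_symmetric_rel (2 * n) ?M"
    using weyl_function_total_symmetric[OF ab n order_refl] by simp
  obtain C where C: "C \<in> carrier_mat (2 * n) (2 * n)" "?M = mat_graph (2 * n) C"
    using total_symmetric_rel_graph[OF tot] .
  obtain V where V: "V \<in> carrier_mat n n" "mat_inverse (T2_mat a b n) = Some V"
    using T2_mat_inverse[OF ab n] by blast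
  have B: "B_K a b n \<in> carrier_mat (2 * n) (2 * n)"
    unfolding B_K_def Let_def V(2) option.sel mult_2 using V(1)
    by (intro four_block_carrier_mat) (auto simp: Q_mat_def S_mat_def)
  have "mat_graph (2 * n) (B_K a b n) = mat_graph (2 * n) C"
    using graph_B_K_subset_weyl_function[OF ab n] C by (intro mat_graph_unique B) auto
  then show eq: "?M = mat_graph (2 * n) (B_K a b n)" using C by simp
  show "mat_adjoint (B_K a b n) = B_K a b n"
    using mat_adjoint_eq_if_graph_symmetric[OF B] tot eq by (simp add: total_symmetric_rel_def)
qed

theorem proposition3p3:
  fixes a b :: real and n :: nat
  assumes "n \<ge> 1" and "a < b"
  defines "A_star \<equiv> L2_adjoint a b (minimal_operator a b n)"
    and "M \<equiv> weyl_function (L2_adjoint a b (minimal_operator a b n)) (Gamma0 a b n) (Gamma1 a b n)"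
  shows
    "A_star = {(f, g). f \<in> sobolev_space a b (2 * n) \<and> g \<in> L2 a b \<and>
                  L2_eq a b g (\<lambda>x. (-1) ^ n * sobolev_deriv a b (2 * n) f (2 * n) x)} \<and>
     boundary_triplet a b A_star (2 * n) (Gamma0 a b n) (Gamma1 a b n) \<and>
     (\<forall>x<0. complex_of_real x \<in> resolvent_set a b (ker_extension A_star (2 * n) (Gamma0 a b n))) \<and>
     has_strong_resolvent_limit (2 * n) (\<lambda>x. M (complex_of_real x))
       (weyl_limit_zero (2 * n) M) (at_left 0) \<and>
     invertible_mat (T2_mat a b n) \<and>
     mat_graph (2 * n) (B_K a b n) = weyl_limit_zero (2 * n) M \<and>
     weyl_limit_zero (2 * n) M = mat_graph (2 * n) (mat_adjoint (B_K a b n))"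
proof -
  note n = \<open>n \<ge> 1\<close> and ab = \<open>a < b\<close>
  have A: "A_star = maximal_operator a b n"
    unfolding A_star_def by (rule adjoint_minimal_operator[OF ab n])
  have M: "M = weyl_function (maximal_operator a b n) (Gamma0 a b n) (Gamma1 a b n)"
    unfolding M_def adjoint_minimal_operator[OF ab n] ..
  have tot: "total_symmetric_rel (2 * n) (M (complex_of_real x))" if "x \<le> 0" for x
    unfolding M by (rule weyl_function_total_symmetric[OF ab n that])
  have lim: "has_strong_resolvent_limit (2 * n) (\<lambda>x. M (complex_of_real x)) (M 0) (at_left 0)"
  proof (rule has_strong_resolvent_limitI)
    show "\<forall>\<^sub>F x in at_left 0. total_symmetric_rel (2 * n) (M (complex_of_real x))"
      using tot by (auto simp: eventually_at_filter)
    show "total_symmetric_rel (2 * n) (M 0)" using tot[of 0] by simp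
    show "\<exists>K. (\<forall>\<^sub>F x in at_left 0. (h, K x) \<in> M (complex_of_real x)) \<and> (\<forall>i<2 * n. ((\<lambda>x. K x $v i) \<longlongrightarrow> k $v i) (at_left 0))"
      if "(h, k) \<in> M 0" for h k
      using weyl_function_tendsto_0[OF ab n] that unfolding M by blast
  qed
  have "weyl_limit_zero (2 * n) M = M 0"
    unfolding weyl_limit_zero_def
  proof (rule the_equality[of "\<lambda>R. has_strong_resolvent_limit (2 * n) (\<lambda>x. M (complex_of_real x)) R (at_left 0)", OF lim])
    show "R = M 0" if "has_strong_resolvent_limit (2 * n) (\<lambda>x. M (complex_of_real x)) R (at_left 0)" for R
      using strong_resolvent_limit_unique[OF lim _ that] tot[of 0] by simp
  qed
  moreover have "invertible_mat (T2_mat a b n)"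
    using T2_mat_inverse[OF ab n] by (auto simp: invertible_mat_def inverts_mat_def T2_mat_def)
  ultimately show ?thesis
    using A M lim weyl_function_0[OF ab n] boundary_triplet_maximal_operator[OF ab n] negative_axis_in_resolvent_set[OF ab n]
    by (simp add: maximal_operator_def)
qed

end
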